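(* Let $R$ be an absolute PCR over $R^+$. The category $\mathbf{Web}_R$ (and in particular $\mathbf{Web}^+_{R^+}$, the case where $R=R^+$ and $|\cdot|$ is the identity), with the PCM structure on hom-sets described below, is representable: with the summation object $D=(\mathbb N,\ell^\infty(\mathbb N))$, basis $\iota_i=e_i$ (where $(e_i)_j=\delta_{i,j}$) and diagonal $\Delta=\Delta_{\mathbb N}$, the tuple $(D\multimap-,(\pi_i)_{i\in\mathbb N},\Sigma,0)$ is a summability structure whose induced PCM structure on each hom-set $\mathcal C(X,Y)=M(X\multimap Y)$ is the one where a countable family $(f(i))_{i}$ is summable iff $(\overline{f(i)})_i$ is summable in $P(X\multimap Y)$ (pointwise sum defined and in $P(X\multimap Y)$), with sum the pointwise sum.
   Context: PCM: a nonempty set with a partial sum on countably indexed families ("summable" families) satisfying (Unary) singletons $(x)$ are summable with sum $x$, and (WPA) for summable $(x_a)_{a\in A}$ and a countable partition $\{A_i\}_{i\in I}$ of $A$ (parts possibly empty), each $(x_a)_{a\in A_i}$ is summable and $(\sum_{a\in A_i}x_a)_i$ is summable with sum $\sum_{a\in A}x_a$; strong if also (PA): if each $(x_a)_{a\in A_i}$ and $(\sum_{a\in A_i}x_a)_i$ are summable then $(x_a)_{a\in A}$ is summable. $0$ is the empty sum; $x\le y$ iff $x+z=y$ for some $z$. A PCR $(R,\Sigma,1,\cdot)$ is a PCM with a commutative monoid $(R,1,\cdot)$ such that for summable $(x_a),(y_b)$, $(x_ay_b)_{(a,b)}$ is summable with sum $(\sum x_a)(\sum y_b)$; strong if its PCM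 is strong. Setting: $R^+$ a strong PCR, $\mathcal B\subseteq R^+$ downward closed. Webs are countable sets. $\langle x,y\rangle=\sum_a x_ay_a$ (partial); $x\perp y$ iff $\langle x,y\rangle$ is defined and in $\mathcal B$; $F^\perp=\{y\mid\forall x\in F, x\perp y\}$. A covering of $(R^+)^W$ is $F$ such that every $a\in W$ has some $x\in F$ with $x_a$ invertible. An $R^+$-space is $X=(|X|,P(X))$ with $P(X)\subseteq(R^+)^{|X|}$, $P(X)^{\perp\perp}=P(X)$, and $P(X)$, $P(X)^\perp$ coverings; $X^\perp=(|X|,P(X)^\perp)$. $(x\otimes y)_{a,b}=x_ay_b$, $X\otimes Y=(|X|\times|Y|,(P(X)\otimes P(Y))^{\perp\perp})$, $X\multimap Y=(X\otimes Y^\perp)^\perp$; unit $1=(\{*\},\{e_*\}^{\perp\perp})$. A PCR $R$ is absolute over $R^+$ if there is $|\cdot|:R\to R^+$ with $|x|=0\iff x=0$, $|xy|=|x||y|$, $|1|=1$, and $(x_a)$ summable in $R$ iff $(|x_a|)$ summable in $R^+$, with $|\sum x_a|\le\sum|x_a|$. For $x\in R^{W}$, $\overline{x}_a=|x_a|$, and $M(X)=\{x\in R^{|X|}\mid\overline x\in P(X)\}$. $\mathbf{Web}_R$ has $R^+$-spaces as objects, morphisms $X\to Y$ the matrices in $M(X\multimap Y)\subseteq R^{|X|\times|Y|}$, composition $(t\cdot s)_{a,c}=\sum_b s_{a,b}t_{b,c}$, identity the identity matrix; it is symmetric monoidal closed with tensor of matrices $(s\otimes s')_{(a,a'),(b,b')}=s_{a,b}s'_{a',b'}$,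 unit $1$, the usual permutation matrices as unitors/associator/symmetry, internal hom $X\multimap Y$, evaluation $\mathrm{ev}_{((a,b),a'),b'}=\delta_{a,a'}\delta_{b,b'}$ and currying $\mathrm{cur}(s)_{a,(b,c)}=s_{(a,b),c}$; zero morphisms are zero matrices. For countable $A$, $\Delta_A$ is the constant-$1$ vector and $\ell^\infty(A)=\{\Delta_A\}^{\perp\perp}$. For a summation object $D$ (jointly epic $\iota_i:1\to D$, and $\Delta:1\to D$), $\pi_i=\mathrm{ev}\circ((D\multimap X)\otimes\iota_i)\circ\rho^{-1}$ and $\Sigma=\mathrm{ev}\circ((D\multimap X)\otimes\Delta)\circ\rho^{-1}$. A summability structure is $(S,(\pi_i),\Sigma,0)$ with $S$ an endofunctor, $\pi_i,\Sigma:S\Rightarrow\mathrm{Id}$ natural, $\pi_i$ jointly monic, and PCM structures on hom-sets such that for every $n\ge1$ a family $(f_{i_1,\dots,i_n})$ in $\mathcal C(X,Y)$ is summable iff some $f:X\to S^nY$ has $\pi_{i_1}\circ\cdots\circ\pi_{i_n}\circ f=f_{i_1,\dots,i_n}$, the sum being $\Sigma^{\circ n}\circ f$, and the empty sum is $0$. Representable means some summation object $D$ makes $(D\multimap-,(\pi_i),\Sigma,0)$ a summability structure (for the given PCM structure). *)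

theory Defs
  imports
    "HOL-Algebra.Group"
    "HOL-Library.Countable_Set"
    "HOL-Library.Disjoint_Sets"
    "HOL-Library.FuncSet"
begin

section \<open>Partial commutative monoids with countable sums\<close>

text \<open>
  A partial sum is given on families indexed by arbitrary subsets of \<^typ>\<open>nat\<close>; the result is
  \<^term>\<open>None\<close> if the family is not summable. Families indexed by a countable set of any other type
  are transported along \<^term>\<open>to_nat_on\<close>. The choice of the encoding is immaterial: the axioms
  below, applied to partitions into singletons, make sums invariant under reindexing.
\<close>

type_synonym 'x psum_op = "nat set \<Rightarrow> (nat \<Rightarrow> 'x) \<Rightarrow> 'x option"

definition has_psum :: "'x psum_op \<Rightarrow> ('i \<Rightarrow> 'x) \<Rightarrow> 'i set \<Rightarrow> 'x \<Rightarrow> bool" where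
  "has_psum S x A s \<longleftrightarrow>
     countable A \<and> S (to_nat_on A ` A) (\<lambda>n. x (from_nat_into A n)) = Some s"

definition psummable :: "'x psum_op \<Rightarrow> ('i \<Rightarrow> 'x) \<Rightarrow> 'i set \<Rightarrow> bool" where
  "psummable S x A \<longleftrightarrow> (\<exists>s. has_psum S x A s)"

definition the_psum :: "'x psum_op \<Rightarrow> ('i \<Rightarrow> 'x) \<Rightarrow> 'i set \<Rightarrow> 'x" where
  "the_psum S x A = (THE s. has_psum S x A s)"

definition partition_of :: "nat set \<Rightarrow> nat set \<Rightarrow> (nat \<Rightarrow> nat set) \<Rightarrow> bool" where
  "partition_of A I P \<longleftrightarrow> disjoint_family_on P I \<and> (\<Union>i\<in>I. P i) = A"

text \<open>\<open>cong\<close> says that only the values of a family on its index set matter.\<close>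

locale pcm =
  fixes C :: "'x set" and S :: "'x psum_op"
  assumes nonempty: "C \<noteq> {}"
    and closed: "S A x = Some s \<Longrightarrow> x \<in> A \<rightarrow> C \<and> s \<in> C"
    and cong: "(\<And>a. a \<in> A \<Longrightarrow> x a = y a) \<Longrightarrow> S A x = S A y"
    and unary: "x a \<in> C \<Longrightarrow> S {a} x = Some (x a)"
    and wpa: "S A x = Some s \<Longrightarrow> partition_of A I P \<Longrightarrow>
      \<exists>y. (\<forall>i\<in>I. S (P i) x = Some (y i)) \<and> S I y = Some s"

locale strong_pcm = pcm +
  assumes pa: "partition_of A I P \<Longrightarrow> (\<And>i. i \<in> I \<Longrightarrow> S (P i) x = Some (y i)) \<Longrightarrow>
      S I y = Some s \<Longrightarrow> \<exists>t. S A x = Some t"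

definition pzero :: "'x psum_op \<Rightarrow> 'x" where
  "pzero S = the (S {} (\<lambda>_. undefined))"

definition ple :: "'x set \<Rightarrow> 'x psum_op \<Rightarrow> 'x \<Rightarrow> 'x \<Rightarrow> bool" where
  "ple C S x y \<longleftrightarrow> (\<exists>z\<in>C. S {0, 1} (\<lambda>i. if i = 0 then x else z) = Some y)"


section \<open>Partial commutative rings\<close>

record 'x pcr = "'x monoid" + psum :: "'x psum_op"

locale pcr = comm_monoid R + pcm "carrier R" "psum R" for R :: "('x, 'z) pcr_scheme" (structure) +
  assumes distrib: "psum R A x = Some s \<Longrightarrow> psum R B y = Some t \<Longrightarrow>
      has_psum (psum R) (\<lambda>(a, b). x a \<otimes> y b) (A \<times> B) (s \<otimes> t)"

locale strong_pcr = pcr R + strong_pcm "carrier R" "psum R" for R :: "('x, 'z) pcr_scheme" (structure)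

abbreviation rzero :: "('x, 'z) pcr_scheme \<Rightarrow> 'x" where
  "rzero R \<equiv> pzero (psum R)"

text \<open>\<open>R\<close> is absolute over \<open>Rp\<close> (the \<open>R\<^sup>+\<close> of the theory) via \<open>\<nu>\<close>, the map written \<open>|_|\<close>.\<close>

definition absolute_pcr :: "'r pcr \<Rightarrow> 'p pcr \<Rightarrow> ('r \<Rightarrow> 'p) \<Rightarrow> bool" where
  "absolute_pcr R Rp \<nu> \<longleftrightarrow> pcr R \<and> pcr Rp \<and> \<nu> \<in> carrier R \<rightarrow> carrier Rp \<and>
     (\<forall>x\<in>carrier R. \<nu> x = rzero Rp \<longleftrightarrow> x = rzero R) \<and>
     (\<forall>x\<in>carrier R. \<forall>y\<in>carrier R. \<nu> (x \<otimes>\<^bsub>R\<^esub> y) = \<nu> x \<otimes>\<^bsub>Rp\<^esub> \<nu> y) \<and>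
     \<nu> \<one>\<^bsub>R\<^esub> = \<one>\<^bsub>Rp\<^esub> \<and>
     (\<forall>A. \<forall>x\<in>A \<rightarrow> carrier R.
        (\<exists>s. psum R A x = Some s) \<longleftrightarrow> (\<exists>t. psum Rp A (\<lambda>a. \<nu> (x a)) = Some t)) \<and>
     (\<forall>A. \<forall>x\<in>A \<rightarrow> carrier R. \<forall>s t.
        psum R A x = Some s \<longrightarrow> psum Rp A (\<lambda>a. \<nu> (x a)) = Some t \<longrightarrow>
        ple (carrier Rp) (psum Rp) (\<nu> s) t)"

definition downward_closed :: "'p pcr \<Rightarrow> 'p set \<Rightarrow> bool" where
  "downward_closed Rp B \<longleftrightarrow> B \<subseteq> carrier Rp \<and>
     (\<forall>y\<in>B. \<forall>x\<in>carrier Rp. ple (carrier Rp) (psum Rp) x y \<longrightarrow> x \<in> B)"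


section \<open>Webs, vectors and matrices\<close>

text \<open>
  Webs are countable sets of tokens. Since all objects of the category must live in one type that is
  closed under products of webs and contains the webs of the unit and of the summation object, tokens
  are freely generated from atoms of an arbitrary type \<open>'a\<close>.
  Vectors over a web \<open>W\<close> are elements of \<open>W \<rightarrow>\<^sub>E carrier R\<close>; a matrix indexed by \<open>V\<close> and \<open>W\<close> is a
  vector over \<open>wprod V W\<close>.
\<close>

datatype 'a tok = TAtom 'a | TStar | TNum nat | TPair "'a tok" "'a tok"

definition wprod :: "'a tok set \<Rightarrow> 'a tok set \<Rightarrow> 'a tok set" where
  "wprod V W = {TPair a b | a b. a \<in> V \<and> b \<in> W}"

definition mat :: "'a tok set \<Rightarrow> 'a tok set \<Rightarrow> ('a tok \<Rightarrow> 'a tok \<Rightarrow> 'x) \<Rightarrow> 'a tok \<Rightarrow> 'x" where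
  "mat V W f = (\<lambda>c\<in>wprod V W. case c of TPair a b \<Rightarrow> f a b | _ \<Rightarrow> undefined)"

definition kron :: "('x, 'z) pcr_scheme \<Rightarrow> 'b \<Rightarrow> 'b \<Rightarrow> 'x" where
  "kron R a b = (if a = b then \<one>\<^bsub>R\<^esub> else rzero R)"

definition const_one :: "('x, 'z) pcr_scheme \<Rightarrow> 'a tok set \<Rightarrow> 'a tok \<Rightarrow> 'x" where
  "const_one R W = (\<lambda>a\<in>W. \<one>\<^bsub>R\<^esub>)"

definition std_basis :: "('x, 'z) pcr_scheme \<Rightarrow> 'a tok set \<Rightarrow> 'a tok \<Rightarrow> 'a tok \<Rightarrow> 'x" where
  "std_basis R W a = (\<lambda>b\<in>W. kron R a b)"


section \<open>Spaces\<close>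

record ('a, 'p) space =
  web :: "'a tok set"
  pts :: "('a tok \<Rightarrow> 'p) set"

definition perp :: "'p pcr \<Rightarrow> 'p set \<Rightarrow> 'a tok set \<Rightarrow> ('a tok \<Rightarrow> 'p) \<Rightarrow> ('a tok \<Rightarrow> 'p) \<Rightarrow> bool" where
  "perp Rp B W x y \<longleftrightarrow> (\<exists>s\<in>B. has_psum (psum Rp) (\<lambda>a. x a \<otimes>\<^bsub>Rp\<^esub> y a) W s)"

definition orth :: "'p pcr \<Rightarrow> 'p set \<Rightarrow> 'a tok set \<Rightarrow> ('a tok \<Rightarrow> 'p) set \<Rightarrow> ('a tok \<Rightarrow> 'p) set" where
  "orth Rp B W F = {y \<in> W \<rightarrow>\<^sub>E carrier Rp. \<forall>x\<in>F. perp Rp B W x y}"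

definition covering :: "'p pcr \<Rightarrow> 'a tok set \<Rightarrow> ('a tok \<Rightarrow> 'p) set \<Rightarrow> bool" where
  "covering Rp W F \<longleftrightarrow> (\<forall>a\<in>W. \<exists>x\<in>F. x a \<in> Units Rp)"

definition is_space :: "'p pcr \<Rightarrow> 'p set \<Rightarrow> ('a, 'p) space \<Rightarrow> bool" where
  "is_space Rp B X \<longleftrightarrow> countable (web X) \<and> pts X \<subseteq> web X \<rightarrow>\<^sub>E carrier Rp \<and>
     orth Rp B (web X) (orth Rp B (web X) (pts X)) = pts X \<and>
     covering Rp (web X) (pts X) \<and> covering Rp (web X) (orth Rp B (web X) (pts X))"

definition dual :: "'p pcr \<Rightarrow> 'p set \<Rightarrow> ('a, 'p) space \<Rightarrow> ('a, 'p) space" where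
  "dual Rp B X = \<lparr>web = web X, pts = orth Rp B (web X) (pts X)\<rparr>"

definition tensor :: "'p pcr \<Rightarrow> 'p set \<Rightarrow> ('a, 'p) space \<Rightarrow> ('a, 'p) space \<Rightarrow> ('a, 'p) space" where
  "tensor Rp B X Y = (let W = wprod (web X) (web Y) in
     \<lparr>web = W,
      pts = orth Rp B W (orth Rp B W
        {mat (web X) (web Y) (\<lambda>a b. x a \<otimes>\<^bsub>Rp\<^esub> y b) | x y. x \<in> pts X \<and> y \<in> pts Y})\<rparr>)"

definition limp :: "'p pcr \<Rightarrow> 'p set \<Rightarrow> ('a, 'p) space \<Rightarrow> ('a, 'p) space \<Rightarrow> ('a, 'p) space" where
  "limp Rp B X Y = dual Rp B (tensor Rp B X (dual Rp B Y))"

definition unit_space :: "'p pcr \<Rightarrow> 'p set \<Rightarrow> ('a, 'p) space" where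
  "unit_space Rp B =
     \<lparr>web = {TStar}, pts = orth Rp B {TStar} (orth Rp B {TStar} {std_basis Rp {TStar} TStar})\<rparr>"

definition linf :: "'p pcr \<Rightarrow> 'p set \<Rightarrow> 'a tok set \<Rightarrow> ('a tok \<Rightarrow> 'p) set" where
  "linf Rp B A = orth Rp B A (orth Rp B A {const_one Rp A})"

definition nat_space :: "'p pcr \<Rightarrow> 'p set \<Rightarrow> ('a, 'p) space" where
  "nat_space Rp B = \<lparr>web = range TNum, pts = linf Rp B (range TNum)\<rparr>"

definition Mpts :: "'r pcr \<Rightarrow> ('r \<Rightarrow> 'p) \<Rightarrow> ('a, 'p) space \<Rightarrow> ('a tok \<Rightarrow> 'r) set" where
  "Mpts R \<nu> X = {x \<in> web X \<rightarrow>\<^sub>E carrier R. (\<lambda>a\<in>web X. \<nu> (x a)) \<in> pts X}"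


section \<open>Categories and summability structures\<close>

text \<open>
  Besides a category, the record carries the part of a symmetric monoidal closed structure that occurs
  in the definition of representability. Composition is annotated with objects, because a matrix does
  not determine its source and target: \<open>comp C X Y Z g f\<close> is \<open>g \<circ> f\<close> for \<open>f : X \<rightarrow> Y\<close> and \<open>g : Y \<rightarrow> Z\<close>.
\<close>

record ('o, 'm) cat =
  obj :: "'o set"
  hom :: "'o \<Rightarrow> 'o \<Rightarrow> 'm set"
  comp :: "'o \<Rightarrow> 'o \<Rightarrow> 'o \<Rightarrow> 'm \<Rightarrow> 'm \<Rightarrow> 'm"
  idm :: "'o \<Rightarrow> 'm"

record ('o, 'm) closed_cat = "('o, 'm) cat" +
  ten :: "'o \<Rightarrow> 'o \<Rightarrow> 'o"
  tenm :: "'o \<Rightarrow> 'o \<Rightarrow> 'o \<Rightarrow> 'o \<Rightarrow> 'm \<Rightarrow> 'm \<Rightarrow> 'm"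
    \<comment> \<open>\<open>tenm X X' Y Y' f f' : X \<otimes> X' \<rightarrow> Y \<otimes> Y'\<close> for \<open>f : X \<rightarrow> Y\<close>, \<open>f' : X' \<rightarrow> Y'\<close>\<close>
  unt :: "'o"
  runit :: "'o \<Rightarrow> 'm" \<comment> \<open>\<open>X \<otimes> 1 \<rightarrow> X\<close>\<close>
  ihom :: "'o \<Rightarrow> 'o \<Rightarrow> 'o"
  ev :: "'o \<Rightarrow> 'o \<Rightarrow> 'm" \<comment> \<open>\<open>ev X Y : (X \<multimap> Y) \<otimes> X \<rightarrow> Y\<close>\<close>
  cur :: "'o \<Rightarrow> 'o \<Rightarrow> 'o \<Rightarrow> 'm \<Rightarrow> 'm" \<comment> \<open>\<open>cur X Y Z\<close> maps \<open>X \<otimes> Y \<rightarrow> Z\<close> to \<open>X \<rightarrow> (Y \<multimap> Z)\<close>\<close>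

definition is_category :: "('o, 'm, 'z) cat_scheme \<Rightarrow> bool" where
  "is_category C \<longleftrightarrow>
     (\<forall>X\<in>obj C. idm C X \<in> hom C X X) \<and>
     (\<forall>X\<in>obj C. \<forall>Y\<in>obj C. \<forall>Z\<in>obj C. \<forall>f\<in>hom C X Y. \<forall>g\<in>hom C Y Z.
        comp C X Y Z g f \<in> hom C X Z) \<and>
     (\<forall>X\<in>obj C. \<forall>Y\<in>obj C. \<forall>f\<in>hom C X Y.
        comp C X X Y f (idm C X) = f \<and> comp C X Y Y (idm C Y) f = f) \<and>
     (\<forall>W\<in>obj C. \<forall>X\<in>obj C. \<forall>Y\<in>obj C. \<forall>Z\<in>obj C. \<forall>f\<in>hom C W X. \<forall>g\<in>hom C X Y. \<forall>h\<in>hom C Y Z.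
        comp C W Y Z h (comp C W X Y g f) = comp C W X Z (comp C X Y Z h g) f)"

definition is_endofunctor ::
  "('o, 'm, 'z) cat_scheme \<Rightarrow> ('o \<Rightarrow> 'o) \<Rightarrow> ('o \<Rightarrow> 'o \<Rightarrow> 'm \<Rightarrow> 'm) \<Rightarrow> bool" where
  "is_endofunctor C S Sm \<longleftrightarrow>
     (\<forall>X\<in>obj C. S X \<in> obj C) \<and>
     (\<forall>X\<in>obj C. \<forall>Y\<in>obj C. \<forall>f\<in>hom C X Y. Sm X Y f \<in> hom C (S X) (S Y)) \<and>
     (\<forall>X\<in>obj C. Sm X X (idm C X) = idm C (S X)) \<and>
     (\<forall>X\<in>obj C. \<forall>Y\<in>obj C. \<forall>Z\<in>obj C. \<forall>f\<in>hom C X Y. \<forall>g\<in>hom C Y Z.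
        Sm X Z (comp C X Y Z g f) = comp C (S X) (S Y) (S Z) (Sm Y Z g) (Sm X Y f))"

definition is_natural_to_id ::
  "('o, 'm, 'z) cat_scheme \<Rightarrow> ('o \<Rightarrow> 'o) \<Rightarrow> ('o \<Rightarrow> 'o \<Rightarrow> 'm \<Rightarrow> 'm) \<Rightarrow> ('o \<Rightarrow> 'm) \<Rightarrow> bool" where
  "is_natural_to_id C S Sm \<theta> \<longleftrightarrow>
     (\<forall>X\<in>obj C. \<theta> X \<in> hom C (S X) X) \<and>
     (\<forall>X\<in>obj C. \<forall>Y\<in>obj C. \<forall>f\<in>hom C X Y.
        comp C (S X) X Y f (\<theta> X) = comp C (S X) (S Y) Y (\<theta> Y) (Sm X Y f))"

definition zero_morphisms :: "('o, 'm, 'z) cat_scheme \<Rightarrow> ('o \<Rightarrow> 'o \<Rightarrow> 'm) \<Rightarrow> bool" where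
  "zero_morphisms C z \<longleftrightarrow>
     (\<forall>X\<in>obj C. \<forall>Y\<in>obj C. z X Y \<in> hom C X Y) \<and>
     (\<forall>X\<in>obj C. \<forall>Y\<in>obj C. \<forall>Z\<in>obj C. \<forall>f\<in>hom C X Y. comp C X Y Z (z Y Z) f = z X Z) \<and>
     (\<forall>X\<in>obj C. \<forall>Y\<in>obj C. \<forall>Z\<in>obj C. \<forall>g\<in>hom C Y Z. comp C X Y Z g (z X Y) = z X Z)"

text \<open>
  For \<open>f : X \<rightarrow> S\<^sup>n Y\<close>, \<open>iter_proj C S \<pi> X Y [i1, \<dots>, in] f\<close> is \<open>\<pi>\<close>-\<open>i1\<close> after \<open>\<dots>\<close> after \<open>\<pi>\<close>-\<open>in\<close> after \<open>f\<close>,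
  the projection \<open>\<pi>\<close>-\<open>ik\<close> being taken at \<open>S\<^sup>k\<^sup>-\<^sup>1 Y\<close>, and \<open>iter_sum C S \<sigma> X Y n f\<close> is \<open>\<Sigma>\<^sup>n \<circ> f\<close>.
\<close>

fun iter_proj :: "('o, 'm, 'z) cat_scheme \<Rightarrow> ('o \<Rightarrow> 'o) \<Rightarrow> (nat \<Rightarrow> 'o \<Rightarrow> 'm) \<Rightarrow>
    'o \<Rightarrow> 'o \<Rightarrow> nat list \<Rightarrow> 'm \<Rightarrow> 'm" where
  "iter_proj C S \<pi> X Y [] f = f"
| "iter_proj C S \<pi> X Y (i # is) f = comp C X (S Y) Y (\<pi> i Y) (iter_proj C S \<pi> X (S Y) is f)"

fun iter_sum :: "('o, 'm, 'z) cat_scheme \<Rightarrow> ('o \<Rightarrow> 'o) \<Rightarrow> ('o \<Rightarrow> 'm) \<Rightarrow>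
    'o \<Rightarrow> 'o \<Rightarrow> nat \<Rightarrow> 'm \<Rightarrow> 'm" where
  "iter_sum C S \<sigma> X Y 0 f = f"
| "iter_sum C S \<sigma> X Y (Suc n) f = comp C X (S Y) Y (\<sigma> Y) (iter_sum C S \<sigma> X (S Y) n f)"

text \<open>
  \<open>(S, Sm)\<close> is the endofunctor, \<open>\<sigma>\<close> the sum transformation, \<open>z\<close> the zero morphisms and \<open>H X Y\<close> the
  partial sum on \<open>hom C X Y\<close>. Families indexed by \<open>n\<close>-tuples are indexed by lists of length \<open>n\<close>.
\<close>

definition summability_structure ::
  "('o, 'm, 'z) cat_scheme \<Rightarrow> ('o \<Rightarrow> 'o) \<Rightarrow> ('o \<Rightarrow> 'o \<Rightarrow> 'm \<Rightarrow> 'm) \<Rightarrow> (nat \<Rightarrow> 'o \<Rightarrow> 'm) \<Rightarrow>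
   ('o \<Rightarrow> 'm) \<Rightarrow> ('o \<Rightarrow> 'o \<Rightarrow> 'm) \<Rightarrow> ('o \<Rightarrow> 'o \<Rightarrow> 'm psum_op) \<Rightarrow> bool" where
  "summability_structure C S Sm \<pi> \<sigma> z H \<longleftrightarrow>
     is_category C \<and> is_endofunctor C S Sm \<and>
     (\<forall>i. is_natural_to_id C S Sm (\<pi> i)) \<and> is_natural_to_id C S Sm \<sigma> \<and>
     zero_morphisms C z \<and>
     (\<forall>X\<in>obj C. \<forall>Y\<in>obj C. \<forall>f\<in>hom C X (S Y). \<forall>g\<in>hom C X (S Y).
        (\<forall>i. comp C X (S Y) Y (\<pi> i Y) f = comp C X (S Y) Y (\<pi> i Y) g) \<longrightarrow> f = g) \<and>
     (\<forall>X\<in>obj C. \<forall>Y\<in>obj C.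
        pcm (hom C X Y) (H X Y) \<and>
        pzero (H X Y) = z X Y \<and>
        (\<forall>n\<ge>1. \<forall>F\<in>{is. length is = n} \<rightarrow> hom C X Y.
           (psummable (H X Y) F {is. length is = n} \<longleftrightarrow>
              (\<exists>f\<in>hom C X ((S ^^ n) Y). \<forall>is. length is = n \<longrightarrow> iter_proj C S \<pi> X Y is f = F is)) \<and>
           (\<forall>f\<in>hom C X ((S ^^ n) Y). (\<forall>is. length is = n \<longrightarrow> iter_proj C S \<pi> X Y is f = F is) \<longrightarrow>
              has_psum (H X Y) F {is. length is = n} (iter_sum C S \<sigma> X Y n f))))"

definition inverse_mor :: "('o, 'm, 'z) cat_scheme \<Rightarrow> 'o \<Rightarrow> 'o \<Rightarrow> 'm \<Rightarrow> 'm" where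
  "inverse_mor C X Y f =
     (THE g. g \<in> hom C Y X \<and> comp C X Y X g f = idm C X \<and> comp C Y X Y f g = idm C Y)"

definition ihom_mor :: "('o, 'm) closed_cat \<Rightarrow> 'o \<Rightarrow> 'o \<Rightarrow> 'o \<Rightarrow> 'm \<Rightarrow> 'm" where
  "ihom_mor C D X Y f =
     (let DX = ihom C D X in cur C DX D Y (comp C (ten C DX D) X Y f (ev C D X)))"

text \<open>For \<open>h : 1 \<rightarrow> D\<close>, the transformation \<open>ev \<circ> ((D \<multimap> X) \<otimes> h) \<circ> \<rho>\<^sup>-\<^sup>1 : (D \<multimap> X) \<rightarrow> X\<close>.\<close>

definition eval_at :: "('o, 'm) closed_cat \<Rightarrow> 'o \<Rightarrow> 'm \<Rightarrow> 'o \<Rightarrow> 'm" where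
  "eval_at C D h X =
     (let DX = ihom C D X; DX1 = ten C DX (unt C); DXD = ten C DX D in
        comp C DX DX1 X
          (comp C DX1 DXD X (ev C D X) (tenm C DX (unt C) DX D (idm C DX) h))
          (inverse_mor C DX1 DX (runit C DX)))"

definition summation_object :: "('o, 'm) closed_cat \<Rightarrow> 'o \<Rightarrow> (nat \<Rightarrow> 'm) \<Rightarrow> 'm \<Rightarrow> bool" where
  "summation_object C D \<iota> \<Delta> \<longleftrightarrow>
     unt C \<in> obj C \<and> D \<in> obj C \<and> (\<forall>i. \<iota> i \<in> hom C (unt C) D) \<and> \<Delta> \<in> hom C (unt C) D \<and>
     (\<forall>X\<in>obj C. \<forall>f\<in>hom C D X. \<forall>g\<in>hom C D X.
        (\<forall>i. comp C (unt C) D X f (\<iota> i) = comp C (unt C) D X g (\<iota> i)) \<longrightarrow> f = g)"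

definition representable_by :: "('o, 'm) closed_cat \<Rightarrow> ('o \<Rightarrow> 'o \<Rightarrow> 'm) \<Rightarrow>
    ('o \<Rightarrow> 'o \<Rightarrow> 'm psum_op) \<Rightarrow> 'o \<Rightarrow> (nat \<Rightarrow> 'm) \<Rightarrow> 'm \<Rightarrow> bool" where
  "representable_by C z H D \<iota> \<Delta> \<longleftrightarrow>
     summation_object C D \<iota> \<Delta> \<and>
     summability_structure C (ihom C D) (ihom_mor C D)
       (\<lambda>i. eval_at C D (\<iota> i)) (eval_at C D \<Delta>) z H"

definition representable :: "('o, 'm) closed_cat \<Rightarrow> ('o \<Rightarrow> 'o \<Rightarrow> 'm) \<Rightarrow>
    ('o \<Rightarrow> 'o \<Rightarrow> 'm psum_op) \<Rightarrow> bool" where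
  "representable C z H \<longleftrightarrow> (\<exists>D \<iota> \<Delta>. representable_by C z H D \<iota> \<Delta>)"


section \<open>The category of webs\<close>

definition Web :: "'p pcr \<Rightarrow> 'p set \<Rightarrow> 'r pcr \<Rightarrow> ('r \<Rightarrow> 'p) \<Rightarrow>
    (('a, 'p) space, 'a tok \<Rightarrow> 'r) closed_cat" where
  "Web Rp B R \<nu> = \<lparr>
     obj = {X. is_space Rp B X},
     hom = (\<lambda>X Y. Mpts R \<nu> (limp Rp B X Y)),
     comp = (\<lambda>X Y Z t s. mat (web X) (web Z)
       (\<lambda>a c. the_psum (psum R) (\<lambda>b. s (TPair a b) \<otimes>\<^bsub>R\<^esub> t (TPair b c)) (web Y))),
     idm = (\<lambda>X. mat (web X) (web X) (kron R)),
     ten = tensor Rp B,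
     tenm = (\<lambda>X X' Y Y' s s'. mat (wprod (web X) (web X')) (wprod (web Y) (web Y'))
       (\<lambda>p q. case (p, q) of
          (TPair a a', TPair b b') \<Rightarrow> s (TPair a b) \<otimes>\<^bsub>R\<^esub> s' (TPair a' b') | _ \<Rightarrow> undefined)),
     unt = unit_space Rp B,
     runit = (\<lambda>X. mat (wprod (web X) {TStar}) (web X)
       (\<lambda>p b. case p of TPair a _ \<Rightarrow> kron R a b | _ \<Rightarrow> undefined)),
     ihom = limp Rp B,
     ev = (\<lambda>X Y. mat (wprod (wprod (web X) (web Y)) (web X)) (web Y)
       (\<lambda>p b'. case p of
          TPair (TPair a b) a' \<Rightarrow> kron R a a' \<otimes>\<^bsub>R\<^esub> kron R b b' | _ \<Rightarrow> undefined)),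
     cur = (\<lambda>X Y Z s. mat (web X) (wprod (web Y) (web Z))
       (\<lambda>a q. case q of TPair b c \<Rightarrow> s (TPair (TPair a b) c) | _ \<Rightarrow> undefined))\<rparr>"

definition Web_zero :: "'r pcr \<Rightarrow> ('a, 'p) space \<Rightarrow> ('a, 'p) space \<Rightarrow> 'a tok \<Rightarrow> 'r" where
  "Web_zero R X Y = mat (web X) (web Y) (\<lambda>_ _. rzero R)"

definition Web_psum :: "'p pcr \<Rightarrow> 'p set \<Rightarrow> 'r pcr \<Rightarrow> ('r \<Rightarrow> 'p) \<Rightarrow>
    ('a, 'p) space \<Rightarrow> ('a, 'p) space \<Rightarrow> ('a tok \<Rightarrow> 'r) psum_op" where
  "Web_psum Rp B R \<nu> X Y A f =
     (if f \<in> A \<rightarrow> Mpts R \<nu> (limp Rp B X Y) \<and>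
         (\<exists>s\<in>pts (limp Rp B X Y). \<forall>c\<in>web (limp Rp B X Y). psum Rp A (\<lambda>i. \<nu> (f i c)) = Some (s c))
      then Some (\<lambda>c\<in>web (limp Rp B X Y). the (psum R A (\<lambda>i. f i c)))
      else None)"

text \<open>A vector over \<open>W\<close> as a matrix with a single row, i.e. as a morphism from the unit.\<close>

definition point :: "'a tok set \<Rightarrow> ('a tok \<Rightarrow> 'r) \<Rightarrow> 'a tok \<Rightarrow> 'r" where
  "point W x = mat {TStar} W (\<lambda>_. x)"

definition Web_inj :: "'r pcr \<Rightarrow> nat \<Rightarrow> 'a tok \<Rightarrow> 'r" where
  "Web_inj R i = point (range TNum) (std_basis R (range TNum) (TNum i))"

definition Web_diag :: "'r pcr \<Rightarrow> 'a tok \<Rightarrow> 'r" where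
  "Web_diag R = point (range TNum) (const_one R (range TNum))"

end

theory Submission
  imports Defs
begin

text \<open>
  A matrix \<open>f\<close> lies in \<open>P(X \<multimap> Y)\<close> iff \<open>\<Sum>\<^sub>a\<^sub>,\<^sub>b x\<^sub>a y\<^sub>b f\<^sub>a\<^sub>b\<close> lies in \<open>B\<close> for all \<open>x \<in> P(X)\<close> and \<open>y \<in> P(Y)\<^sup>\<bottom>\<close>; the
  coverings supply coordinates that are units, so partial sums of such expressions can be
  divided by \<open>x\<^sub>a y\<^sub>b\<close>. As \<open>P(\<nat>)\<^sup>\<bottom>\<close> consists of the families with sum in \<open>B\<close>, this and Fubini in the strong
  ring \<open>Rp\<close> give the key equivalence: \<open>h\<close> lies in \<open>P(X \<multimap> (\<nat> \<multimap> Y))\<close> iff the pointwise sum of its slices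
  \<open>h\<^sub>a\<^sub>,\<^sub>(\<^sub>i\<^sub>,\<^sub>b\<^sub>)\<close> over \<open>i\<close> exists and lies in \<open>P(X \<multimap> Y)\<close>. Hence a morphism into \<open>\<nat> \<multimap> Y\<close> is a summable
  sequence of morphisms, and families indexed by \<open>n\<close>-tuples are handled by induction on \<open>n\<close>.
  Sums in \<open>R\<close> are only rearranged where the corresponding sum of absolute values exists in \<open>Rp\<close>.
\<close>

section \<open>Sums in partial commutative monoids and rings\<close>

text \<open>\<open>R\<close> is only known to satisfy the weak axiom WPA: a sum that exists may be
  split along a partition, but existing partial sums need not assemble to a sum. Assembly is PA,
  available in \<open>Rp\<close>. So nontrivial summability over \<open>R\<close> is first obtained
  for absolute values in \<open>Rp\<close>, by assembly or by domination, and the value is then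
  computed by splitting the sum in \<open>R\<close>. Going from values back to absolute values loses
  equality, as \<open>|\<Sigma>x|\<close> is only bounded by \<open>\<Sigma>|x|\<close>; this is
  harmless because \<open>B\<close> is downward closed, and so is the set of matrices tested against
  it (\<open>lin_mono\<close>).

  A second obstacle: the maps in \<open>eval_at\<close> and \<open>ihom_mor\<close> factor through
  tensor products, which may fail to be objects of the category. These factors are composed as plain
  arrays over webs (\<open>comp_mat\<close>), and the morphism property is proved for the resulting
  matrices, whose sources are spaces.\<close>

context pcm
begin

text \<open>WPA for the partition of \<open>N\<close> into the singletons \<open>{h m}\<close>,
  indexed by \<open>M\<close>; \<open>unary\<close> identifies the block sums with the terms
  \<open>x (h m)\<close>.\<close>

lemma psum_reindex_nat:
  assumes s: "S N x = Some s" and h: "inj_on h M" "h ` M = N"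
  shows "S M (\<lambda>m. x (h m)) = Some s"
proof -
  have "partition_of N M (\<lambda>m. {h m})"
    using h by (auto simp: partition_of_def disjoint_family_on_def inj_on_def)
  then obtain y where y: "\<forall>m\<in>M. S {h m} x = Some (y m)" "S M y = Some s"
    using wpa[OF s] by blast
  have "y m = x (h m)" if "m \<in> M" for m
    using closed[OF s] y(1) h that by (metis PiE Pi_mem image_eqI option.inject unary)
  then show ?thesis
    using y(2) cong[of M y "\<lambda>m. x (h m)"] by simp
qed

text \<open>The transition maps between \<open>e\<close> and \<open>to_nat_on A\<close> are
  injective, so \<open>psum_reindex_nat\<close> applies in both directions. This permits one
  enumeration of a large set to be used on all of its subsets.\<close>

lemma has_psum_enum:
  fixes e :: "'i \<Rightarrow> nat"
  assumes e: "inj_on e A"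
  shows "has_psum S x A s \<longleftrightarrow> S (e ` A) (\<lambda>n. x (inv_into A e n)) = Some s"
proof -
  have A: "countable A"
    using e by (rule countableI)
  note t = inj_on_to_nat_on[OF A]
  have 1: "inv_into A e (e a) = a" "from_nat_into A (to_nat_on A a) = a" if "a \<in> A" for a
    using that e A by simp_all
  have "S (e ` A) (\<lambda>n. x (inv_into A e n)) = Some s"
    if "S (to_nat_on A ` A) (\<lambda>n. x (from_nat_into A n)) = Some s"
  proof -
    have "inj_on (\<lambda>n. to_nat_on A (inv_into A e n)) (e ` A)"
      "(\<lambda>n. to_nat_on A (inv_into A e n)) ` e ` A = to_nat_on A ` A"
      using e t by (auto simp: inj_on_def image_image)
    from psum_reindex_nat[OF that this] show ?thesis
      by (subst cong[where y = "\<lambda>n. x (from_nat_into A (to_nat_on A (inv_into A e n)))"])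
        (auto simp: 1)
  qed
  moreover have "S (to_nat_on A ` A) (\<lambda>n. x (from_nat_into A n)) = Some s"
    if "S (e ` A) (\<lambda>n. x (inv_into A e n)) = Some s"
  proof -
    have "inj_on (\<lambda>n. e (from_nat_into A n)) (to_nat_on A ` A)"
      "(\<lambda>n. e (from_nat_into A n)) ` to_nat_on A ` A = e ` A"
      using e A by (auto simp: inj_on_def image_image)
    from psum_reindex_nat[OF that this] show ?thesis
      by (subst cong[where y = "\<lambda>n. x (inv_into A e (e (from_nat_into A n)))"])
        (auto simp: 1 A)
  qed
  ultimately show ?thesis
    unfolding has_psum_def using A by blast
qed

lemma has_psum_nat: "has_psum S x A s \<longleftrightarrow> S A x = Some s" for A :: "nat set"
  using has_psum_enum[of id A x s] cong[of A "\<lambda>n. x (inv_into A id n)" x]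
    inv_into_f_f[of id A] by simp

lemma has_psum_countable: "has_psum S x A s \<Longrightarrow> countable A"
  by (simp add: has_psum_def)

lemma has_psum_unique: "has_psum S x A s \<Longrightarrow> has_psum S x A t \<Longrightarrow> s = t"
  by (simp add: has_psum_def)

lemma the_psum_eq: "has_psum S x A s \<Longrightarrow> the_psum S x A = s"
  by (auto simp: the_psum_def intro: has_psum_unique)

lemma has_psum_the_psum: "psummable S x A \<Longrightarrow> has_psum S x A (the_psum S x A)"
  by (auto simp: psummable_def the_psum_eq)

lemma psummableI: "has_psum S x A s \<Longrightarrow> psummable S x A"
  by (auto simp: psummable_def)

lemma has_psum_cong:
  assumes "\<And>a. a \<in> A \<Longrightarrow> x a = y a"
  shows "has_psum S x A s \<longleftrightarrow> has_psum S y A s"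
proof (cases "countable A")
  case True
  then have "S (to_nat_on A ` A) (\<lambda>n. x (from_nat_into A n)) =
      S (to_nat_on A ` A) (\<lambda>n. y (from_nat_into A n))"
    using assms by (intro cong) auto
  then show ?thesis
    by (simp add: has_psum_def)
qed (simp add: has_psum_def)

lemma the_psum_cong:
  "(\<And>a. a \<in> A \<Longrightarrow> x a = y a) \<Longrightarrow> the_psum S x A = the_psum S y A"
  by (simp add: the_psum_def cong: has_psum_cong)

lemma has_psum_terms: "has_psum S x A s \<Longrightarrow> a \<in> A \<Longrightarrow> x a \<in> C"
  using closed[of "to_nat_on A ` A" "\<lambda>n. x (from_nat_into A n)" s]
  by (auto simp: has_psum_def Pi_iff)

lemma has_psum_closed: "has_psum S x A s \<Longrightarrow> s \<in> C"
  using closed by (auto simp: has_psum_def)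

lemma the_psum_closed: "psummable S x A \<Longrightarrow> the_psum S x A \<in> C"
  using has_psum_closed has_psum_the_psum by blast

lemma has_psum_reindex:
  assumes h: "inj_on h A"
  shows "has_psum S x (h ` A) s \<longleftrightarrow> has_psum S (\<lambda>a. x (h a)) A s"
proof (cases "countable A")
  case True
  then have hA: "countable (h ` A)" by simp
  define e where "e = to_nat_on (h ` A)"
  have e: "inj_on e (h ` A)"
    unfolding e_def by (rule inj_on_to_nat_on[OF hA])
  have eh: "inj_on (\<lambda>a. e (h a)) A"
    using h e by (auto simp: inj_on_def)
  have "inv_into (h ` A) e (e (h a)) = h a" "inv_into A (\<lambda>a. e (h a)) (e (h a)) = a"
    if "a \<in> A" for a
    using that e inv_into_f_f[OF eh] by simp_all
  then have "S (e ` h ` A) (\<lambda>n. x (inv_into (h ` A) e n)) =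
      S (e ` h ` A) (\<lambda>n. x (h (inv_into A (\<lambda>a. e (h a)) n)))"
    by (intro cong) auto
  then show ?thesis
    by (simp add: has_psum_enum[OF e] has_psum_enum[OF eh] image_image)
next
  case False
  then show ?thesis
    using h by (auto simp: has_psum_def dest: countable_image_inj_on)
qed

lemma has_psum_bij_betw:
  "bij_betw h A A' \<Longrightarrow> has_psum S x A' s \<longleftrightarrow> has_psum S (\<lambda>a. x (h a)) A s"
  using has_psum_reindex[of h A x s] by (simp add: bij_betw_def)

text \<open>WPA for arbitrary index types. One enumeration \<open>e\<close> of \<open>A\<close> is
  restricted to every block, so the blocks stay disjoint in \<open>nat\<close>;
  \<open>has_psum_enum\<close> then reads each restricted sum as a sum over
  \<open>P i\<close>.\<close>

lemma has_psum_partition: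
  assumes s: "has_psum S x A s" and I: "countable I"
    and P: "disjoint_family_on P I" "(\<Union>i\<in>I. P i) = A"
  shows "\<exists>y. (\<forall>i\<in>I. has_psum S x (P i) (y i)) \<and> has_psum S y I s"
proof -
  have A: "countable A"
    using s by (rule has_psum_countable)
  define e where "e = to_nat_on A"
  have e: "inj_on e A"
    unfolding e_def by (rule inj_on_to_nat_on[OF A])
  let ?I = "to_nat_on I ` I" and ?x = "\<lambda>n. x (inv_into A e n)"
  let ?P = "\<lambda>n. e ` P (from_nat_into I n)"
  have PA: "P i \<subseteq> A" if "i \<in> I" for i
    using P that by auto
  have "e ` P i \<inter> e ` P j = {}" if "i \<in> I" "j \<in> I" "i \<noteq> j" for i j
    using inj_on_image_Int[OF e PA PA] disjoint_family_onD[OF P(1)] that by (metis image_empty)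
  then have "disjoint_family_on ?P ?I"
    using I by (auto simp: disjoint_family_on_def)
  then have "partition_of (e ` A) ?I ?P"
    unfolding partition_of_def
  proof
    show "\<Union> (?P ` ?I) = e ` A"
      using I P(2) by (auto simp: image_image)
  qed
  then obtain y where y: "\<forall>n\<in>?I. S (?P n) ?x = Some (y n)" "S ?I y = Some s"
    using wpa[OF s[unfolded has_psum_enum[OF e]]] by blast
  show ?thesis
  proof (intro exI[of _ "\<lambda>i. y (to_nat_on I i)"] conjI ballI)
    fix i assume i: "i \<in> I"
    have ei: "inj_on e (P i)"
      using e PA[OF i] inj_on_subset by blast
    have "S (e ` P i) ?x = S (e ` P i) (\<lambda>n. x (inv_into (P i) e n))"
      using e ei PA[OF i] by (intro cong) (auto simp: subset_iff)
    moreover have "S (e ` P i) ?x = Some (y (to_nat_on I i))"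
      using y(1)[rule_format, of "to_nat_on I i"] i I by simp
    ultimately show "has_psum S x (P i) (y (to_nat_on I i))"
      by (simp add: has_psum_enum[OF ei])
  next
    have "has_psum S y ?I s"
      using y(2) by (simp add: has_psum_nat)
    then show "has_psum S (\<lambda>i. y (to_nat_on I i)) I s"
      by (simp add: has_psum_reindex inj_on_to_nat_on I)
  qed
qed

lemma has_psum_Sigma:
  assumes "has_psum S f (Sigma A T) s" "countable A"
  shows "\<exists>y. (\<forall>a\<in>A. has_psum S (\<lambda>b. f (a, b)) (T a) (y a)) \<and> has_psum S y A s"
proof -
  have "disjoint_family_on (\<lambda>a. Pair a ` T a) A" "(\<Union>a\<in>A. Pair a ` T a) = Sigma A T"
    by (auto simp: disjoint_family_on_def)
  from has_psum_partition[OF assms this] show ?thesis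
    by (simp add: has_psum_reindex inj_on_def)
qed

lemma has_psum_singleton: "x a \<in> C \<Longrightarrow> has_psum S x {a} (x a)"
  using has_psum_reindex[of "\<lambda>_. a" "{0::nat}" x "x a"] unary[of "\<lambda>_. x a" 0]
  by (simp add: has_psum_nat)

text \<open>The partition into \<open>T\<close> and its complement, indexed by \<open>bool\<close>.
  The sum \<open>u\<close> of the complement later serves as the difference in
  \<open>ple\<close>.\<close>

lemma has_psum_subset:
  assumes "has_psum S x A s" "T \<subseteq> A"
  obtains t u where "has_psum S x T t" "has_psum S x (A - T) u"
    "has_psum S (\<lambda>b. if b then t else u) UNIV s"
proof -
  have "disjoint_family_on (\<lambda>b. if b then T else A - T) UNIV" "(\<Union>b. if b then T else A - T) = A"
    using assms(2) by (auto simp: disjoint_family_on_def split: if_splits)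
  from has_psum_partition[OF assms(1) _ this]
  obtain y where y: "\<forall>b. has_psum S x (if b then T else A - T) (y b)" "has_psum S y UNIV s"
    by auto
  have "(\<lambda>b. if b then y True else y False) = y"
    by (rule ext) simp
  with y(2) have "has_psum S (\<lambda>b. if b then y True else y False) UNIV s"
    by simp
  moreover have "has_psum S x T (y True)" "has_psum S x (A - T) (y False)"
    using y(1)[rule_format, of True] y(1)[rule_format, of False] by simp_all
  ultimately show thesis
    by (intro that)
qed

lemma psummable_subset:
  assumes "psummable S x A" "T \<subseteq> A"
  shows "psummable S x T"
proof -
  obtain s where "has_psum S x A s"
    using assms(1) by (auto simp: psummable_def)
  from this assms(2) obtain t where "has_psum S x T t"
    by (rule has_psum_subset)
  then show ?thesis
    by (rule psummableI)
qed

text \<open>\<open>pzero\<close> is the value of a partial operation, so existence is the point: a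
  one-term family is summable, hence so is its restriction to the empty set, and \<open>cong\<close>
  makes the result independent of the family.\<close>

lemma has_psum_empty: "has_psum S x {} (pzero S)"
proof -
  obtain c where c: "c \<in> C"
    using nonempty by blast
  obtain t where t: "has_psum S (\<lambda>_::nat. c) {} t"
    using psummable_subset[of "\<lambda>_::nat. c" "{0}" "{}"] has_psum_singleton[of "\<lambda>_::nat. c" 0] c
    by (auto simp: psummable_def)
  then have "S {} (\<lambda>_. undefined) = Some t"
    using cong[of "{}" "\<lambda>_. c" "\<lambda>_. undefined"] by (simp add: has_psum_nat)
  then show ?thesis
    using cong[of "{}" "\<lambda>n. x (from_nat_into {} n)" "\<lambda>_. undefined"]
    by (simp add: pzero_def has_psum_def)
qed

lemma pzero_closed [simp]: "pzero S \<in> C"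
  using has_psum_closed[OF has_psum_empty] .

text \<open>Padding with zeros involves no assembly: the blocks \<open>{a} \<inter> T\<close> for
  \<open>a\<close> in \<open>A\<close> partition \<open>T\<close>, the new indices getting empty
  blocks, and WPA yields a sum over all of \<open>A\<close>.\<close>

lemma has_psum_superset:
  assumes s: "has_psum S x T s" and A: "T \<subseteq> A" "countable A"
    and 0: "\<And>a. a \<in> A - T \<Longrightarrow> x a = pzero S"
  shows "has_psum S x A s"
proof -
  have "disjoint_family_on (\<lambda>a. {a} \<inter> T) A" "(\<Union>a\<in>A. {a} \<inter> T) = T"
    using A by (auto simp: disjoint_family_on_def)
  from has_psum_partition[OF s A(2) this]
  obtain y where y: "\<forall>a\<in>A. has_psum S x ({a} \<inter> T) (y a)" "has_psum S y A s"
    by auto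
  have "y a = x a" if "a \<in> A" for a
  proof (cases "a \<in> T")
    case True
    then have "has_psum S x {a} (y a)"
      using y(1)[rule_format, OF that] by simp
    moreover have "has_psum S x {a} (x a)"
      by (intro has_psum_singleton has_psum_terms[OF s True])
    ultimately show ?thesis
      by (rule has_psum_unique)
  next
    case False
    then have "has_psum S x {} (y a)"
      using y(1)[rule_format, OF that] by simp
    then have "y a = pzero S"
      using has_psum_empty by (rule has_psum_unique)
    then show ?thesis
      using 0 that False by simp
  qed
  then show ?thesis
    using y(2) has_psum_cong[of A y x] by simp
qed

lemma has_psum_zero:
  "countable A \<Longrightarrow> (\<And>a. a \<in> A \<Longrightarrow> x a = pzero S) \<Longrightarrow> has_psum S x A (pzero S)"
  by (rule has_psum_superset[OF has_psum_empty]) auto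

lemma has_psum_support:
  assumes A: "T \<subseteq> A" "countable A" and 0: "\<And>a. a \<in> A - T \<Longrightarrow> x a = pzero S"
  shows "has_psum S x A s \<longleftrightarrow> has_psum S x T s"
proof
  assume "has_psum S x A s"
  then obtain t u where tu: "has_psum S x T t" "has_psum S x (A - T) u"
    "has_psum S (\<lambda>b. if b then t else u) UNIV s"
    using A(1) by (rule has_psum_subset)
  have "u = pzero S"
    using tu(2) has_psum_zero[of "A - T" x] 0 A(2) has_psum_unique by blast
  \<comment> \<open>\<open>t\<close> plus zero is \<open>t\<close>: a one-term family over
    \<open>bool\<close>, padded with a zero.\<close>
  moreover have "has_psum S (\<lambda>b. if b then t else pzero S) {True} t"
    using has_psum_singleton[of "\<lambda>b. if b then t else pzero S" True] has_psum_closed[OF tu(1)]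
    by simp
  then have "has_psum S (\<lambda>b. if b then t else pzero S) UNIV t"
    by (rule has_psum_superset) auto
  ultimately show "has_psum S x T s"
    using tu has_psum_unique by blast
qed (rule has_psum_superset[OF _ A 0])

text \<open>For sums whose terms contain a Kronecker delta: the support lies in the image of
  \<open>h\<close>, and the sum collapses to the parameters of \<open>h\<close>.\<close>

lemma has_psum_reindex_support:
  assumes "inj_on h T" "h ` T \<subseteq> A" "countable A" "\<And>a. a \<in> A \<Longrightarrow> a \<notin> h ` T \<Longrightarrow> x a = pzero S"
  shows "has_psum S x A s \<longleftrightarrow> has_psum S (\<lambda>t. x (h t)) T s"
  using has_psum_support[of "h ` T" A x s] has_psum_reindex[of h T x s] assms by auto

lemma has_psum_single:
  assumes "a \<in> A" "countable A" "x a \<in> C" "\<And>b. b \<in> A \<Longrightarrow> b \<noteq> a \<Longrightarrow> x b = pzero S"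
  shows "has_psum S x A (x a)"
  using assms by (intro has_psum_superset[OF has_psum_singleton]) auto

lemma pleI:
  assumes "has_psum S x A s" "T \<subseteq> A" "has_psum S x T t"
  shows "ple C S t s"
proof -
  obtain t' u where tu: "has_psum S x T t'" "has_psum S x (A - T) u"
    "has_psum S (\<lambda>b. if b then t' else u) UNIV s"
    using assms(1,2) by (rule has_psum_subset)
  have t': "t' = t"
    using assms(3) tu(1) has_psum_unique by blast
  \<comment> \<open>\<open>ple\<close> is stated with the indices 0 and 1, the two-block partition
    with booleans.\<close>
  have "bij_betw (\<lambda>n::nat. n = 0) {0, 1} UNIV"
    by (auto simp: bij_betw_def inj_on_def)
  from has_psum_bij_betw[OF this, THEN iffD1, OF tu(3)]
  have "S {0, 1} (\<lambda>i. if i = 0 then t else u) = Some s"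
    by (simp add: has_psum_nat t' cong: if_cong)
  then show ?thesis
    using has_psum_closed[OF tu(2)] by (auto simp: ple_def)
qed

lemma ple_refl: "x \<in> C \<Longrightarrow> ple C S x x"
  by (rule pleI[of "\<lambda>_. x" "{0::nat}" _ "{0}"]) (auto intro: has_psum_singleton[of "\<lambda>_. x" for x])

lemma ple_zero: "x \<in> C \<Longrightarrow> ple C S (pzero S) x"
  by (rule pleI[of "\<lambda>_. x" "{0::nat}" _ "{}"]) 
    (auto intro: has_psum_singleton[of "\<lambda>_. x" for x] has_psum_empty)

lemma psummable_cong:
  "(\<And>a. a \<in> A \<Longrightarrow> x a = y a) \<Longrightarrow> psummable S x A \<longleftrightarrow> psummable S y A"
  by (simp add: psummable_def cong: has_psum_cong)

lemma has_psum_TimesD: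
  assumes "has_psum S f (A \<times> T) s" "countable A"
  shows "\<forall>a\<in>A. psummable S (\<lambda>b. f (a, b)) T"
    and "has_psum S (\<lambda>a. the_psum S (\<lambda>b. f (a, b)) T) A s"
proof -
  obtain y where y: "\<forall>a\<in>A. has_psum S (\<lambda>b. f (a, b)) T (y a)" "has_psum S y A s"
    using has_psum_Sigma[OF assms] by auto
  then show "\<forall>a\<in>A. psummable S (\<lambda>b. f (a, b)) T"
    by (auto intro: psummableI)
  have "the_psum S (\<lambda>b. f (a, b)) T = y a" if "a \<in> A" for a
    using y(1) that by (simp add: the_psum_eq)
  then show "has_psum S (\<lambda>a. the_psum S (\<lambda>b. f (a, b)) T) A s"
    using y(2) by (simp cong: has_psum_cong)
qed

lemma has_psum_wprod:
  "has_psum S f (wprod V W) s \<longleftrightarrow> has_psum S (\<lambda>(a, b). f (TPair a b)) (V \<times> W) s"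
proof -
  have "bij_betw (\<lambda>(a, b). TPair a b) (V \<times> W) (wprod V W)"
    by (auto simp: bij_betw_def inj_on_def wprod_def)
  from has_psum_bij_betw[OF this] show ?thesis
    by (simp add: case_prod_unfold)
qed

lemma the_psum_single:
  "a \<in> A \<Longrightarrow> countable A \<Longrightarrow> x a \<in> C \<Longrightarrow> (\<And>b. b \<in> A \<Longrightarrow> b \<noteq> a \<Longrightarrow> x b = pzero S) \<Longrightarrow>
    the_psum S x A = x a"
  by (intro the_psum_eq has_psum_single)

lemma has_psum_swap:
  "has_psum S f (A \<times> T) s \<longleftrightarrow> has_psum S (\<lambda>(b, a). f (a, b)) (T \<times> A) s"
proof -
  have "bij_betw prod.swap (T \<times> A) (A \<times> T)"
    by (auto simp: bij_betw_def)
  from has_psum_bij_betw[OF this] show ?thesis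
    by (simp add: case_prod_unfold prod.swap_def)
qed

lemma the_psum_reindex_support:
  assumes "inj_on h T" "h ` T \<subseteq> A" "countable A" "\<And>a. a \<in> A \<Longrightarrow> a \<notin> h ` T \<Longrightarrow> x a = pzero S"
  shows "the_psum S x A = the_psum S (\<lambda>t. x (h t)) T"
  using has_psum_reindex_support[OF assms] by (simp add: the_psum_def)

lemma the_psum_zero:
  "countable A \<Longrightarrow> (\<And>a. a \<in> A \<Longrightarrow> x a = pzero S) \<Longrightarrow> the_psum S x A = pzero S"
  by (intro the_psum_eq has_psum_zero)

end

text \<open>PA gives only that some sum \<open>t\<close> exists. WPA splits it again along the same
  blocks, and uniqueness of sums forces \<open>t = s\<close>. All later arguments use PA through
  this lemma.\<close>

lemma (in strong_pcm) has_psum_SigmaI: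
  assumes y: "\<And>a. a \<in> A \<Longrightarrow> has_psum S (\<lambda>b. f (a, b)) (T a) (y a)" and s: "has_psum S y A s"
  shows "has_psum S f (Sigma A T) s"
proof -
  have A: "countable A"
    using s by (rule has_psum_countable)
  have ST: "countable (Sigma A T)"
    using A y has_psum_countable by (intro countable_SIGMA) blast+
  define e where "e = to_nat_on (Sigma A T)"
  have e: "inj_on e (Sigma A T)"
    unfolding e_def by (rule inj_on_to_nat_on[OF ST])
  let ?I = "to_nat_on A ` A" and ?f = "\<lambda>n. f (inv_into (Sigma A T) e n)"
  let ?P = "\<lambda>n. (\<lambda>b. e (from_nat_into A n, b)) ` T (from_nat_into A n)"
  have part: "partition_of (e ` Sigma A T) ?I ?P"
    unfolding partition_of_def
  proof
    show "disjoint_family_on ?P ?I"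
      using A e by (auto simp: disjoint_family_on_def inj_on_def)
    show "\<Union> (?P ` ?I) = e ` Sigma A T"
      using A by (auto simp: image_image)
  qed
  have blocks: "S (?P n) ?f = Some (y (from_nat_into A n))" if n: "n \<in> ?I" for n
  proof -
    obtain a where "a \<in> A" "n = to_nat_on A a"
      using n by blast
    with A have a: "a \<in> A" "from_nat_into A n = a"
      by simp_all
    have "inj_on (\<lambda>b. e (a, b)) (T a)"
      using e a by (auto simp: inj_on_def)
    moreover have "has_psum S (\<lambda>b. ?f (e (a, b))) (T a) (y a)"
      using y[OF a(1)] e a(1) by (subst has_psum_cong[where y = "\<lambda>b. f (a, b)"]) auto
    ultimately show ?thesis
      using has_psum_reindex[of "\<lambda>b. e (a, b)" "T a" ?f "y a"] a by (simp add: has_psum_nat)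
  qed
  have "S ?I (\<lambda>n. y (from_nat_into A n)) = Some s"
    using s by (simp add: has_psum_def)
  from pa[OF part blocks this] obtain t where "S (e ` Sigma A T) ?f = Some t"
    by auto
  then have t: "has_psum S f (Sigma A T) t"
    by (simp add: has_psum_enum[OF e])
  then obtain y' where y': "\<forall>a\<in>A. has_psum S (\<lambda>b. f (a, b)) (T a) (y' a)" "has_psum S y' A t"
    using has_psum_Sigma A by blast
  then have "has_psum S y A t"
    using has_psum_cong[of A y' y] y has_psum_unique by blast
  then show ?thesis
    using t s has_psum_unique by blast
qed

text \<open>With complements \<open>z a\<close> such that \<open>x a\<close> plus \<open>z a\<close>
  is \<open>y a\<close>, the doubled family over \<open>A \<times> {0, 1}\<close> has sum
  \<open>s\<close> by assembly, and \<open>x\<close> is its restriction to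
  \<open>A \<times> {0}\<close>.\<close>

lemma (in strong_pcm) has_psum_mono:
  assumes le: "\<And>a. a \<in> A \<Longrightarrow> ple C S (x a) (y a)" and s: "has_psum S y A s"
  shows "\<exists>t. has_psum S x A t \<and> ple C S t s"
proof -
  have "\<forall>a\<in>A. \<exists>z. has_psum S (\<lambda>i::nat. if i = 0 then x a else z) {0, 1} (y a)"
    using le by (fastforce simp: ple_def has_psum_nat)
  then obtain z where z: "\<forall>a\<in>A. has_psum S (\<lambda>i::nat. if i = 0 then x a else z a) {0, 1} (y a)"
    by metis
  have *: "has_psum S (\<lambda>(a, i::nat). if i = 0 then x a else z a) (A \<times> {0, 1}) s"
    using z s by (intro has_psum_SigmaI) auto
  obtain t where t: "has_psum S (\<lambda>(a, i::nat). if i = 0 then x a else z a) (A \<times> {0}) t"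
    by (rule has_psum_subset[OF *, of "A \<times> {0}"]) auto
  have "A \<times> {0::nat} = (\<lambda>a. (a, 0)) ` A"
    by auto
  then have "has_psum S x A t"
    using t by (simp add: has_psum_reindex inj_on_def)
  moreover have "ple C S t s"
    by (rule pleI[OF * _ t]) auto
  ultimately show ?thesis
    by blast
qed

lemma (in strong_pcm) has_psum_Times_iff:
  assumes "countable A"
  shows "has_psum S f (A \<times> T) s \<longleftrightarrow>
    (\<forall>a\<in>A. psummable S (\<lambda>b. f (a, b)) T) \<and> has_psum S (\<lambda>a. the_psum S (\<lambda>b. f (a, b)) T) A s"
  using has_psum_TimesD[of f A T s] assms
    has_psum_SigmaI[of A f "\<lambda>_. T" "\<lambda>a. the_psum S (\<lambda>b. f (a, b)) T" s]
  by (auto simp: has_psum_the_psum)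

section \<open>Multiplication and sums in a partial ring\<close>

context pcr
begin

lemma has_psum_mult:
  assumes x: "has_psum (psum R) x A s" and y: "has_psum (psum R) y T t"
  shows "has_psum (psum R) (\<lambda>(a, b). x a \<otimes> y b) (A \<times> T) (s \<otimes> t)"
proof -
  let ?A = "to_nat_on A ` A" and ?T = "to_nat_on T ` T"
  have c: "countable A" "countable T"
    using x y by (auto dest: has_psum_countable)
  have "has_psum (psum R) (\<lambda>(m, n). x (from_nat_into A m) \<otimes> y (from_nat_into T n))
      (?A \<times> ?T) (s \<otimes> t)"
    using x y by (intro distrib) (auto simp: has_psum_def)
  moreover have "bij_betw (map_prod (to_nat_on A) (to_nat_on T)) (A \<times> T) (?A \<times> ?T)"
    using c inj_on_to_nat_on by (intro bij_betw_imageI map_prod_inj_on map_prod_surj_on) auto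
  ultimately have "has_psum (psum R) (\<lambda>p. case map_prod (to_nat_on A) (to_nat_on T) p of
      (m, n) \<Rightarrow> x (from_nat_into A m) \<otimes> y (from_nat_into T n)) (A \<times> T) (s \<otimes> t)"
    using has_psum_bij_betw by blast
  then show ?thesis
    by (rule has_psum_cong[THEN iffD1, rotated]) (auto simp: c)
qed

text \<open>Distributivity against the one-term family \<open>c\<close> over the unit type.\<close>

lemma has_psum_scale:
  assumes c: "c \<in> carrier R" and x: "has_psum (psum R) x A s"
  shows "has_psum (psum R) (\<lambda>a. c \<otimes> x a) A (c \<otimes> s)"
proof -
  have "has_psum (psum R) (\<lambda>(u, a). c \<otimes> x a) ({()} \<times> A) (c \<otimes> s)"
    using has_psum_mult[OF has_psum_singleton[of "\<lambda>_. c"] x] c by simp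
  moreover have "{()} \<times> A = Pair () ` A"
    by auto
  ultimately show ?thesis
    by (simp add: has_psum_reindex inj_on_def)
qed

text \<open>Scaling the empty family gives the empty family again, so its sum is fixed by
  \<open>c\<close>.\<close>

lemma r_null [simp]: "c \<in> carrier R \<Longrightarrow> c \<otimes> rzero R = rzero R"
  using has_psum_scale[OF _ has_psum_empty] has_psum_empty has_psum_unique by blast

lemma l_null [simp]: "c \<in> carrier R \<Longrightarrow> rzero R \<otimes> c = rzero R"
  using r_null m_comm pzero_closed by metis

lemma kron_closed [simp]: "kron R a b \<in> carrier R"
  by (simp add: kron_def)

lemma psummable_scale_unit:
  assumes u: "u \<in> Units R" and x: "\<And>a. a \<in> A \<Longrightarrow> x a \<in> carrier R"
    and s: "psummable (psum R) (\<lambda>a. u \<otimes> x a) A"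
  shows "psummable (psum R) x A"
proof -
  obtain t where "has_psum (psum R) (\<lambda>a. u \<otimes> x a) A t"
    using s by (auto simp: psummable_def)
  then have "has_psum (psum R) (\<lambda>a. inv u \<otimes> (u \<otimes> x a)) A (inv u \<otimes> t)"
    using u by (intro has_psum_scale) auto
  moreover have "inv u \<otimes> (u \<otimes> x a) = x a" if "a \<in> A" for a
    using u x that by (simp add: m_assoc[symmetric] Units_closed)
  ultimately show ?thesis
    by (auto simp: psummable_def cong: has_psum_cong)
qed

lemma ple_scale:
  assumes "c \<in> carrier R" "x \<in> carrier R" "ple (carrier R) (psum R) x y"
  shows "ple (carrier R) (psum R) (c \<otimes> x) (c \<otimes> y)"
proof -
  obtain z where z: "z \<in> carrier R" "has_psum (psum R) (\<lambda>i::nat. if i = 0 then x else z) {0, 1} y"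
    using assms(3) by (auto simp: ple_def has_psum_nat)
  have "has_psum (psum R) (\<lambda>i::nat. if i = 0 then c \<otimes> x else c \<otimes> z) {0, 1} (c \<otimes> y)"
    using has_psum_scale[OF assms(1) z(2)] by (simp add: if_distrib cong: if_cong)
  then show ?thesis
    using z(1) assms(1) by (auto simp: ple_def has_psum_nat)
qed

lemma the_psum_scale:
  assumes "c \<in> carrier R" "psummable (psum R) x A"
  shows "psummable (psum R) (\<lambda>a. c \<otimes> x a) A"
    and "the_psum (psum R) (\<lambda>a. c \<otimes> x a) A = c \<otimes> the_psum (psum R) x A"
  using has_psum_scale[OF assms(1) has_psum_the_psum[OF assms(2)]]
  by (auto simp: the_psum_eq intro: psummableI)

text \<open>Both iterated sums are splittings of one double sum, along \<open>Y\<close> and along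
  \<open>X\<close>, so WPA suffices. Lacking PA, the existence of the double sum has to be
  assumed.\<close>

lemma the_psum_assoc:
  assumes c: "countable X" "countable Y"
    and f: "\<And>x. x \<in> X \<Longrightarrow> f x \<in> carrier R" and h: "\<And>y. y \<in> Y \<Longrightarrow> h y \<in> carrier R"
    and g: "\<And>x y. x \<in> X \<Longrightarrow> y \<in> Y \<Longrightarrow> g x y \<in> carrier R"
    and sum: "psummable (psum R) (\<lambda>(y, x). f x \<otimes> g x y \<otimes> h y) (Y \<times> X)"
    and fg: "\<And>y. y \<in> Y \<Longrightarrow> psummable (psum R) (\<lambda>x. f x \<otimes> g x y) X"
    and gh: "\<And>x. x \<in> X \<Longrightarrow> psummable (psum R) (\<lambda>y. g x y \<otimes> h y) Y"
  shows "the_psum (psum R) (\<lambda>y. the_psum (psum R) (\<lambda>x. f x \<otimes> g x y) X \<otimes> h y) Y =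
    the_psum (psum R) (\<lambda>x. f x \<otimes> the_psum (psum R) (\<lambda>y. g x y \<otimes> h y) Y) X"
proof -
  obtain s where s: "has_psum (psum R) (\<lambda>(y, x). f x \<otimes> g x y \<otimes> h y) (Y \<times> X) s"
    using sum by (auto simp: psummable_def)
  have "has_psum (psum R) (\<lambda>y. the_psum (psum R) (\<lambda>x. h y \<otimes> (f x \<otimes> g x y)) X) Y s"
    using has_psum_TimesD(2)[OF s c(2)]
    by (rule has_psum_cong[THEN iffD1, rotated]) (auto simp: f g h m_comm intro!: the_psum_cong)
  then have "has_psum (psum R) (\<lambda>y. the_psum (psum R) (\<lambda>x. f x \<otimes> g x y) X \<otimes> h y) Y s"
    by (rule has_psum_cong[THEN iffD1, rotated]) (simp add: the_psum_scale fg h the_psum_closed m_comm)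
  moreover have s': "has_psum (psum R) (\<lambda>(x, y). f x \<otimes> g x y \<otimes> h y) (X \<times> Y) s"
    using s by (subst (asm) has_psum_swap) simp
  have "has_psum (psum R) (\<lambda>x. the_psum (psum R) (\<lambda>y. f x \<otimes> (g x y \<otimes> h y)) Y) X s"
    using has_psum_TimesD(2)[OF s' c(1)]
    by (rule has_psum_cong[THEN iffD1, rotated]) (auto simp: f g h m_assoc intro!: the_psum_cong)
  then have "has_psum (psum R) (\<lambda>x. f x \<otimes> the_psum (psum R) (\<lambda>y. g x y \<otimes> h y) Y) X s"
    by (rule has_psum_cong[THEN iffD1, rotated]) (simp add: the_psum_scale gh f)
  ultimately show ?thesis
    by (simp add: the_psum_eq)
qed

lemma the_psum_kron_left:
  assumes "a \<in> A" "countable A" "\<And>b. b \<in> A \<Longrightarrow> x b \<in> carrier R"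
  shows "the_psum (psum R) (\<lambda>b. kron R a b \<otimes> x b) A = x a"
  using the_psum_single[of a A "\<lambda>b. kron R a b \<otimes> x b"] assms by (simp add: kron_def)

lemma the_psum_kron_right:
  assumes "a \<in> A" "countable A" "\<And>b. b \<in> A \<Longrightarrow> x b \<in> carrier R"
  shows "the_psum (psum R) (\<lambda>b. x b \<otimes> kron R b a) A = x a"
  using the_psum_single[of a A "\<lambda>b. x b \<otimes> kron R b a"] assms by (simp add: kron_def)

end


section \<open>Spaces and linear matrices\<close>

lemma mat_apply [simp]: "a \<in> V \<Longrightarrow> b \<in> W \<Longrightarrow> mat V W f (TPair a b) = f a b"
  by (auto simp: mat_def wprod_def)

lemma TPair_in_wprod [simp]: "TPair a b \<in> wprod V W \<longleftrightarrow> a \<in> V \<and> b \<in> W"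
  by (simp add: wprod_def)

lemma wprodE [elim!]:
  assumes "c \<in> wprod V W"
  obtains a b where "c = TPair a b" "a \<in> V" "b \<in> W"
  using assms by (auto simp: wprod_def)

lemma mat_extensional [simp]: "mat V W f \<in> extensional (wprod V W)"
  by (simp add: mat_def)

lemma mat_in_PiE [simp]:
  "mat V W f \<in> wprod V W \<rightarrow>\<^sub>E A \<longleftrightarrow> (\<forall>a\<in>V. \<forall>b\<in>W. f a b \<in> A)"
proof
  assume t: "mat V W f \<in> wprod V W \<rightarrow>\<^sub>E A"
  have "f a b \<in> A" if "a \<in> V" "b \<in> W" for a b
    using PiE_mem[OF t, of "TPair a b"] that by simp
  then show "\<forall>a\<in>V. \<forall>b\<in>W. f a b \<in> A"
    by blast
qed (auto simp: PiE_def mat_def wprod_def)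

lemma extensional_wprod_eqI:
  assumes "s \<in> extensional (wprod V W)" "t \<in> extensional (wprod V W)"
    and "\<And>a b. a \<in> V \<Longrightarrow> b \<in> W \<Longrightarrow> s (TPair a b) = t (TPair a b)"
  shows "s = t"
  by (rule extensionalityI[OF assms(1,2)]) (auto simp: wprod_def assms(3))

lemma mat_eta: "t \<in> wprod V W \<rightarrow>\<^sub>E A \<Longrightarrow> mat V W (\<lambda>a b. t (TPair a b)) = t"
  by (rule extensional_wprod_eqI[where V = V and W = W]) (simp_all add: PiE_def)

lemma mat_eq_iff: "mat V W f = mat V W g \<longleftrightarrow> (\<forall>a\<in>V. \<forall>b\<in>W. f a b = g a b)"
proof
  assume eq: "mat V W f = mat V W g"
  have "f a b = g a b" if "a \<in> V" "b \<in> W" for a b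
    using fun_cong[OF eq, of "TPair a b"] that by simp
  then show "\<forall>a\<in>V. \<forall>b\<in>W. f a b = g a b"
    by blast
qed (rule extensional_wprod_eqI[where V = V and W = W], simp_all)

lemma mat_cong: "(\<And>a b. a \<in> V \<Longrightarrow> b \<in> W \<Longrightarrow> f a b = g a b) \<Longrightarrow> mat V W f = mat V W g"
  by (simp add: mat_eq_iff)

lemma countable_wprod [simp]: "countable V \<Longrightarrow> countable W \<Longrightarrow> countable (wprod V W)"
proof -
  have "wprod V W = (\<lambda>(a, b). TPair a b) ` (V \<times> W)"
    by (auto simp: wprod_def)
  then show "countable V \<Longrightarrow> countable W \<Longrightarrow> countable (wprod V W)"
    by simp
qed

text \<open>\<open>B_unit\<close> is what makes \<open>D\<close> a space: a unit that occurs as a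
  term of a family with sum in \<open>B\<close> lies in \<open>B\<close> by downward closure, so a
  covering dual of \<open>D\<close> forces \<open>B\<close> to contain a unit. Conversely, such a
  unit provides the coverings of the duals of \<open>D\<close> and of the unit space.\<close>

locale abs_web =
  fixes Rp :: "'p pcr" and B :: "'p set" and R :: "'r pcr" and \<nu> :: "'r \<Rightarrow> 'p"
  assumes strong: "strong_pcr Rp"
    and downward: "downward_closed Rp B"
    and B_unit: "B \<inter> Units Rp \<noteq> {}"
    and absolute: "absolute_pcr R Rp \<nu>"

sublocale abs_web \<subseteq> P: strong_pcr Rp
  by (rule strong)

sublocale abs_web \<subseteq> R: pcr R
  using absolute by (simp add: absolute_pcr_def)

context abs_web
begin

abbreviation pmult (infixl "\<star>" 70) where "x \<star> y \<equiv> x \<otimes>\<^bsub>Rp\<^esub> y"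
abbreviation rmult (infixl "\<odot>" 70) where "x \<odot> y \<equiv> x \<otimes>\<^bsub>R\<^esub> y"
abbreviation "Cp \<equiv> carrier Rp"
abbreviation "Cr \<equiv> carrier R"
abbreviation "lle \<equiv> ple Cp (psum Rp)"
abbreviation "Q X \<equiv> orth Rp B (web X) (pts X)"

text \<open>The orthogonality condition for families over any index type, so that double and triple
  sums can be regrouped before they are packed into tokens.\<close>

definition bsum :: "('i \<Rightarrow> 'p) \<Rightarrow> 'i set \<Rightarrow> bool" where
  "bsum f A \<longleftrightarrow> (\<exists>s\<in>B. has_psum (psum Rp) f A s)"

lemma B_le: "s \<in> B \<Longrightarrow> t \<in> Cp \<Longrightarrow> lle t s \<Longrightarrow> t \<in> B"
  using downward by (auto simp: downward_closed_def)

lemma B_closed: "s \<in> B \<Longrightarrow> s \<in> Cp"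
  using downward by (auto simp: downward_closed_def)

lemma zero_in_B: "rzero Rp \<in> B"
proof -
  obtain b where "b \<in> B"
    using B_unit by blast
  then show ?thesis
    using B_le[OF _ P.pzero_closed] P.ple_zero B_closed by blast
qed

lemma bsum_cong: "(\<And>a. a \<in> A \<Longrightarrow> f a = g a) \<Longrightarrow> bsum f A \<longleftrightarrow> bsum g A"
  by (simp add: bsum_def cong: P.has_psum_cong)

text \<open>Here downward closure of \<open>B\<close> combines with PA: domination gives summability
  by \<open>has_psum_mono\<close>, and the smaller sum stays in \<open>B\<close>.\<close>

lemma bsum_mono:
  assumes "bsum g A" "\<And>a. a \<in> A \<Longrightarrow> lle (f a) (g a)"
  shows "bsum f A"
proof -
  obtain s where s: "s \<in> B" "has_psum (psum Rp) g A s"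
    using assms(1) by (auto simp: bsum_def)
  obtain t where t: "has_psum (psum Rp) f A t" "lle t s"
    using P.has_psum_mono[OF assms(2) s(2)] by auto
  have "t \<in> B"
    using B_le[OF s(1) P.has_psum_closed[OF t(1)] t(2)] .
  then show ?thesis
    unfolding bsum_def using t(1) by (rule rev_bexI)
qed

lemma bsum_cong_Times:
  "(\<And>a b. a \<in> A \<Longrightarrow> b \<in> T \<Longrightarrow> f a b = g a b) \<Longrightarrow>
    bsum (\<lambda>(a, b). f a b) (A \<times> T) \<longleftrightarrow> bsum (\<lambda>(a, b). g a b) (A \<times> T)"
  by (rule bsum_cong) auto

lemma bsum_bij_betw: "bij_betw h A A' \<Longrightarrow> bsum f A' \<longleftrightarrow> bsum (\<lambda>a. f (h a)) A"
  by (simp add: bsum_def P.has_psum_bij_betw)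

lemma bsum_reindex_support:
  assumes "inj_on h T" "h ` T \<subseteq> A" "countable A" "\<And>a. a \<in> A \<Longrightarrow> a \<notin> h ` T \<Longrightarrow> f a = rzero Rp"
  shows "bsum f A \<longleftrightarrow> bsum (\<lambda>t. f (h t)) T"
  using P.has_psum_reindex_support[OF assms] by (simp add: bsum_def)

lemma bsum_wprod: "bsum f (wprod V W) \<longleftrightarrow> bsum (\<lambda>(a, b). f (TPair a b)) (V \<times> W)"
  by (simp add: bsum_def P.has_psum_wprod)

lemma bsum_Times_iff:
  "countable A \<Longrightarrow> bsum f (A \<times> T) \<longleftrightarrow> (\<forall>a\<in>A. psummable (psum Rp) (\<lambda>b. f (a, b)) T) \<and>
    bsum (\<lambda>a. the_psum (psum Rp) (\<lambda>b. f (a, b)) T) A"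
  by (auto simp: bsum_def P.has_psum_Times_iff)

lemma bsum_Times3_iff:
  assumes "countable A" "countable T"
  shows "bsum (\<lambda>((a, b), c). f a b c) ((A \<times> T) \<times> U) \<longleftrightarrow>
    (\<forall>a\<in>A. \<forall>b\<in>T. psummable (psum Rp) (f a b) U) \<and>
    bsum (\<lambda>(a, b). the_psum (psum Rp) (f a b) U) (A \<times> T)"
  using assms by (subst bsum_Times_iff) (auto simp: case_prod_unfold)

lemma bsum_swap: "bsum f (A \<times> T) \<longleftrightarrow> bsum (\<lambda>(b, a). f (a, b)) (T \<times> A)"
proof -
  have "bij_betw prod.swap (T \<times> A) (A \<times> T)"
    by (auto simp: bij_betw_def)
  from bsum_bij_betw[OF this] show ?thesis
    by (simp add: case_prod_unfold prod.swap_def)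
qed

lemma bsum_zero: "countable A \<Longrightarrow> (\<And>a. a \<in> A \<Longrightarrow> f a = rzero Rp) \<Longrightarrow> bsum f A"
  using zero_in_B P.has_psum_zero by (auto simp: bsum_def)

section \<open>Orthogonals and the points of a space\<close>

lemma mem_orth:
  "y \<in> orth Rp B W F \<longleftrightarrow> y \<in> W \<rightarrow>\<^sub>E Cp \<and> (\<forall>x\<in>F. bsum (\<lambda>a. x a \<star> y a) W)"
  by (simp add: orth_def perp_def bsum_def)

lemma orth_antimono: "F \<subseteq> G \<Longrightarrow> orth Rp B W G \<subseteq> orth Rp B W F"
  by (auto simp: orth_def)

lemma orth_subset_PiE: "orth Rp B W F \<subseteq> W \<rightarrow>\<^sub>E Cp"
  by (auto simp: orth_def)

lemma subset_biorth:
  assumes "F \<subseteq> W \<rightarrow>\<^sub>E Cp"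
  shows "F \<subseteq> orth Rp B W (orth Rp B W F)"
proof
  fix x assume x: "x \<in> F"
  have "bsum (\<lambda>a. y a \<star> x a) W" if y: "y \<in> orth Rp B W F" for y
  proof -
    have "bsum (\<lambda>a. x a \<star> y a) W"
      using x y by (simp add: mem_orth)
    moreover have "x a \<in> Cp" "y a \<in> Cp" if "a \<in> W" for a
      using x y assms that by (auto simp: mem_orth dest!: PiE_mem)
    ultimately show ?thesis
      by (simp add: P.m_comm cong: bsum_cong)
  qed
  then show "x \<in> orth Rp B W (orth Rp B W F)"
    using x assms by (auto simp: mem_orth)
qed

text \<open>The usual Galois argument: \<open>orth\<close> reverses inclusions, and a set of vectors
  lies in its biorthogonal.\<close>

lemma triple_orth:
  "F \<subseteq> W \<rightarrow>\<^sub>E Cp \<Longrightarrow> orth Rp B W (orth Rp B W (orth Rp B W F)) = orth Rp B W F"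
  by (intro subset_antisym orth_antimono subset_biorth orth_subset_PiE)

lemma space_countable: "is_space Rp B X \<Longrightarrow> countable (web X)"
  by (simp add: is_space_def)

lemma space_pts_subset: "is_space Rp B X \<Longrightarrow> pts X \<subseteq> web X \<rightarrow>\<^sub>E Cp"
  by (simp add: is_space_def)

lemma pts_closed: "is_space Rp B X \<Longrightarrow> x \<in> pts X \<Longrightarrow> a \<in> web X \<Longrightarrow> x a \<in> Cp"
  by (auto simp: is_space_def dest!: PiE_mem)

lemma Q_closed: "y \<in> Q X \<Longrightarrow> a \<in> web X \<Longrightarrow> y a \<in> Cp"
  by (auto simp: mem_orth dest!: PiE_mem)

lemma pts_Q: "x \<in> pts X \<Longrightarrow> y \<in> Q X \<Longrightarrow> bsum (\<lambda>a. x a \<star> y a) (web X)"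
  by (simp add: mem_orth)

lemma pts_iff:
  assumes "is_space Rp B X"
  shows "x \<in> pts X \<longleftrightarrow> x \<in> web X \<rightarrow>\<^sub>E Cp \<and> (\<forall>y\<in>Q X. bsum (\<lambda>a. y a \<star> x a) (web X))"
proof -
  have "pts X = orth Rp B (web X) (Q X)"
    using assms by (simp add: is_space_def)
  then show ?thesis
    by (metis mem_orth)
qed

lemma pts_unit:
  assumes "is_space Rp B X" "a \<in> web X"
  obtains x where "x \<in> pts X" "x a \<in> Units Rp"
  using assms by (auto simp: is_space_def covering_def)

lemma Q_unit:
  assumes "is_space Rp B X" "a \<in> web X"
  obtains y where "y \<in> Q X" "y a \<in> Units Rp"
  using assms by (auto simp: is_space_def covering_def)

text \<open>The test behind \<open>limp\<close>, for a curried function instead of a token-indexed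
  matrix: only the values on the webs count, so no extensionality has to be carried along.\<close>

definition lin :: "('a, 'p) space \<Rightarrow> ('a, 'p) space \<Rightarrow> ('a tok \<Rightarrow> 'a tok \<Rightarrow> 'p) \<Rightarrow> bool" where
  "lin X Y f \<longleftrightarrow> (\<forall>a\<in>web X. \<forall>b\<in>web Y. f a b \<in> Cp) \<and>
    (\<forall>x\<in>pts X. \<forall>y\<in>Q Y. bsum (\<lambda>(a, b). x a \<star> y b \<star> f a b) (web X \<times> web Y))"

lemma web_limp [simp]: "web (limp Rp B X Y) = wprod (web X) (web Y)"
  by (simp add: limp_def dual_def tensor_def Let_def)

lemma lin_cong:
  "(\<And>a b. a \<in> web X \<Longrightarrow> b \<in> web Y \<Longrightarrow> f a b = g a b) \<Longrightarrow> lin X Y f \<longleftrightarrow> lin X Y g"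
  unfolding lin_def by (intro conj_cong ball_cong refl bsum_cong_Times) simp_all

lemma lin_closed: "lin X Y f \<Longrightarrow> a \<in> web X \<Longrightarrow> b \<in> web Y \<Longrightarrow> f a b \<in> Cp"
  by (simp add: lin_def)

lemma lin_bsum:
  "lin X Y f \<Longrightarrow> x \<in> pts X \<Longrightarrow> y \<in> Q Y \<Longrightarrow>
    bsum (\<lambda>(a, b). x a \<star> y b \<star> f a b) (web X \<times> web Y)"
  by (simp add: lin_def)

lemma tensor_generators_subset:
  assumes "pts X \<subseteq> web X \<rightarrow>\<^sub>E Cp" "pts Y \<subseteq> web Y \<rightarrow>\<^sub>E Cp"
  shows "{mat (web X) (web Y) (\<lambda>a b. x a \<star> y b) |x y. x \<in> pts X \<and> y \<in> pts Y}
    \<subseteq> wprod (web X) (web Y) \<rightarrow>\<^sub>E Cp"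
proof clarify
  fix x y assume "x \<in> pts X" "y \<in> pts Y"
  then have "x \<in> web X \<rightarrow>\<^sub>E Cp" "y \<in> web Y \<rightarrow>\<^sub>E Cp"
    using assms by blast+
  then show "mat (web X) (web Y) (\<lambda>a b. x a \<star> y b) \<in> wprod (web X) (web Y) \<rightarrow>\<^sub>E Cp"
    by (auto dest: PiE_mem)
qed

text \<open>By \<open>triple_orth\<close> the biorthogonal closure in \<open>tensor\<close> does not
  change the orthogonal, so elementary tensors suffice as tests.\<close>

lemma mem_orth_tensor:
  assumes "pts X \<subseteq> web X \<rightarrow>\<^sub>E Cp" "pts Y \<subseteq> web Y \<rightarrow>\<^sub>E Cp"
  shows "t \<in> Q (tensor Rp B X Y) \<longleftrightarrow> t \<in> wprod (web X) (web Y) \<rightarrow>\<^sub>E Cp \<and>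
    (\<forall>x\<in>pts X. \<forall>y\<in>pts Y. bsum (\<lambda>(a, b). x a \<star> y b \<star> t (TPair a b)) (web X \<times> web Y))"
proof -
  have "Q (tensor Rp B X Y) = orth Rp B (wprod (web X) (web Y))
      {mat (web X) (web Y) (\<lambda>a b. x a \<star> y b) |x y. x \<in> pts X \<and> y \<in> pts Y}"
    using triple_orth[OF tensor_generators_subset[OF assms]] by (simp add: tensor_def Let_def)
  moreover have "bsum (\<lambda>c. mat (web X) (web Y) (\<lambda>a b. x a \<star> y b) c \<star> t c) (wprod (web X) (web Y))
      \<longleftrightarrow> bsum (\<lambda>(a, b). x a \<star> y b \<star> t (TPair a b)) (web X \<times> web Y)" for x y
    unfolding bsum_wprod by (rule bsum_cong) auto
  moreover have "(\<forall>s\<in>{mat (web X) (web Y) (\<lambda>a b. x a \<star> y b) |x y. x \<in> pts X \<and> y \<in> pts Y}. P s) \<longleftrightarrow>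
      (\<forall>x\<in>pts X. \<forall>y\<in>pts Y. P (mat (web X) (web Y) (\<lambda>a b. x a \<star> y b)))" for P
    by blast
  ultimately show ?thesis
    by (simp only: mem_orth)
qed

lemma mem_limp:
  assumes "pts X \<subseteq> web X \<rightarrow>\<^sub>E Cp"
  shows "t \<in> pts (limp Rp B X Y) \<longleftrightarrow>
    t \<in> wprod (web X) (web Y) \<rightarrow>\<^sub>E Cp \<and> lin X Y (\<lambda>a b. t (TPair a b))"
proof -
  have "pts (limp Rp B X Y) = Q (tensor Rp B X (dual Rp B Y))"
    by (simp add: limp_def dual_def)
  moreover have "pts (dual Rp B Y) = Q Y" "web (dual Rp B Y) = web Y"
    by (simp_all add: dual_def)
  moreover have "t (TPair a b) \<in> Cp" if "t \<in> wprod (web X) (web Y) \<rightarrow>\<^sub>E Cp" "a \<in> web X" "b \<in> web Y" for a b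
    using PiE_mem[OF that(1)] that(2,3) by simp
  ultimately show ?thesis
    using mem_orth_tensor[OF assms, of "dual Rp B Y" t] orth_subset_PiE[of "web Y" "pts Y"]
    by (simp add: lin_def) blast
qed

text \<open>Used for passing from \<open>\<Sigma>|x|\<close> to the smaller
  \<open>|\<Sigma>x|\<close>: multiplying by \<open>x a\<close> and \<open>y b\<close> preserves the
  order, and \<open>bsum_mono\<close> compares the pairings.\<close>

lemma lin_mono:
  assumes g: "lin X Y g" and X: "is_space Rp B X"
    and f: "\<And>a b. a \<in> web X \<Longrightarrow> b \<in> web Y \<Longrightarrow> f a b \<in> Cp \<and> lle (f a b) (g a b)"
  shows "lin X Y f"
  unfolding lin_def
proof (intro conjI ballI)
  fix x y assume x: "x \<in> pts X" and y: "y \<in> Q Y"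
  show "bsum (\<lambda>(a, b). x a \<star> y b \<star> f a b) (web X \<times> web Y)"
    by (rule bsum_mono[OF lin_bsum[OF g x y]])
      (auto intro!: P.ple_scale simp: f pts_closed[OF X x] Q_closed[OF y])
qed (simp add: f)

text \<open>Fubini writes the pairing as \<open>\<Sigma>_b y_b (\<Sigma>_a x_a f_ab)\<close>. As
  \<open>y\<close> ranges over \<open>Q Y\<close>, biorthogonality of \<open>pts Y\<close> turns the
  condition into membership of the vector of inner sums: linear matrices are those that map points
  to points.\<close>

lemma lin_iff_app:
  assumes X: "is_space Rp B X" and Y: "is_space Rp B Y"
  shows "lin X Y f \<longleftrightarrow> (\<forall>a\<in>web X. \<forall>b\<in>web Y. f a b \<in> Cp) \<and>
    (\<forall>x\<in>pts X. (\<forall>b\<in>web Y. psummable (psum Rp) (\<lambda>a. x a \<star> f a b) (web X)) \<and>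
      (\<lambda>b\<in>web Y. the_psum (psum Rp) (\<lambda>a. x a \<star> f a b) (web X)) \<in> pts Y)"
proof (cases "\<forall>a\<in>web X. \<forall>b\<in>web Y. f a b \<in> Cp")
  case True
  have "(\<forall>y\<in>Q Y. bsum (\<lambda>(a, b). x a \<star> y b \<star> f a b) (web X \<times> web Y)) \<longleftrightarrow>
      (\<forall>b\<in>web Y. psummable (psum Rp) (\<lambda>a. x a \<star> f a b) (web X)) \<and>
      (\<lambda>b\<in>web Y. the_psum (psum Rp) (\<lambda>a. x a \<star> f a b) (web X)) \<in> pts Y"
    (is "?L \<longleftrightarrow> ?S \<and> ?M") if x: "x \<in> pts X" for x
  proof -
    have eq: "bsum (\<lambda>(a, b). x a \<star> y b \<star> f a b) (web X \<times> web Y) \<longleftrightarrow>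
        (\<forall>b\<in>web Y. psummable (psum Rp) (\<lambda>a. y b \<star> (x a \<star> f a b)) (web X)) \<and>
        bsum (\<lambda>b. the_psum (psum Rp) (\<lambda>a. y b \<star> (x a \<star> f a b)) (web X)) (web Y)"
      if y: "y \<in> Q Y" for y
    proof -
      have "bsum (\<lambda>(a, b). x a \<star> y b \<star> f a b) (web X \<times> web Y) \<longleftrightarrow>
          bsum (\<lambda>(b, a). y b \<star> (x a \<star> f a b)) (web Y \<times> web X)"
        unfolding bsum_swap[of _ "web X"] using True
        by (intro bsum_cong)
          (auto simp: pts_closed[OF X x] Q_closed[OF y] P.m_lcomm P.m_assoc)
      then show ?thesis
        by (simp add: bsum_Times_iff space_countable[OF Y])
    qed
    have scale: "the_psum (psum Rp) (\<lambda>a. y b \<star> (x a \<star> f a b)) (web X) =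
        y b \<star> the_psum (psum Rp) (\<lambda>a. x a \<star> f a b) (web X)"
      if "?S" "y \<in> Q Y" "b \<in> web Y" for y b
      using that by (intro P.the_psum_scale) (auto simp: Q_closed)
    have bsum_eq: "bsum (\<lambda>b. the_psum (psum Rp) (\<lambda>a. y b \<star> (x a \<star> f a b)) (web X)) (web Y) \<longleftrightarrow>
        bsum (\<lambda>b. y b \<star> (\<lambda>b\<in>web Y. the_psum (psum Rp) (\<lambda>a. x a \<star> f a b) (web X)) b) (web Y)"
      if "?S" "y \<in> Q Y" for y
      using that by (intro bsum_cong) (simp add: scale)
    \<comment> \<open>Choosing \<open>y\<close> with \<open>y b\<close> a unit isolates the column
      \<open>b\<close>, whose summability survives division by \<open>y b\<close>.\<close>
    have S_imp: "?S" if ?L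
    proof
      fix b assume b: "b \<in> web Y"
      obtain y where y: "y \<in> Q Y" "y b \<in> Units Rp"
        by (rule Q_unit[OF Y b])
      show "psummable (psum Rp) (\<lambda>a. x a \<star> f a b) (web X)"
        by (rule P.psummable_scale_unit[OF y(2)])
          (use True b eq[OF y(1)] y(1) that in \<open>auto simp: pts_closed[OF X x]\<close>)
    qed
    have "?L \<longleftrightarrow> ?M" if S: ?S
    proof -
      have "psummable (psum Rp) (\<lambda>a. y b \<star> (x a \<star> f a b)) (web X)"
        if "y \<in> Q Y" "b \<in> web Y" for y b
        using that S by (intro P.the_psum_scale) (auto simp: Q_closed)
      moreover have "(\<lambda>b\<in>web Y. the_psum (psum Rp) (\<lambda>a. x a \<star> f a b) (web X)) \<in> web Y \<rightarrow>\<^sub>E Cp"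
        using S P.the_psum_closed by auto
      ultimately show ?thesis
        using S by (auto simp: eq bsum_eq pts_iff[OF Y])
    qed
    then show ?thesis
      using S_imp by blast
  qed
  then show ?thesis
    using True by (simp add: lin_def)
qed (auto simp: lin_def)

text \<open>The image \<open>u\<close> of \<open>x\<close> under \<open>f\<close> is a point of
  \<open>Y\<close>, so \<open>g\<close> may be tested on \<open>u\<close> and \<open>z\<close>.
  Expanding \<open>u\<close> gives a triple sum in \<open>B\<close>; regrouped with \<open>b\<close>
  innermost, it yields both the entries of the product and its test.\<close>

lemma lin_comp:
  assumes X: "is_space Rp B X" and Y: "is_space Rp B Y" and Z: "is_space Rp B Z"
    and f: "lin X Y f" and g: "lin Y Z g"
  shows "\<And>a c. a \<in> web X \<Longrightarrow> c \<in> web Z \<Longrightarrow> psummable (psum Rp) (\<lambda>b. f a b \<star> g b c) (web Y)"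
    and "lin X Z (\<lambda>a c. the_psum (psum Rp) (\<lambda>b. f a b \<star> g b c) (web Y))"
proof -
  note cl = pts_closed[OF X] Q_closed lin_closed[OF f] lin_closed[OF g]
  have *: "bsum (\<lambda>((a, c), b). x a \<star> z c \<star> (f a b \<star> g b c)) ((web X \<times> web Z) \<times> web Y)"
    if x: "x \<in> pts X" and z: "z \<in> Q Z" for x z
  proof -
    define u where "u = (\<lambda>b\<in>web Y. the_psum (psum Rp) (\<lambda>a. x a \<star> f a b) (web X))"
    have sum: "psummable (psum Rp) (\<lambda>a. x a \<star> f a b) (web X)" if "b \<in> web Y" for b
      using f x that by (simp add: lin_iff_app[OF X Y])
    have "u \<in> pts Y"
      using f x by (simp add: lin_iff_app[OF X Y] u_def)
    from lin_bsum[OF g this z]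
    have "bsum (\<lambda>(b, c). u b \<star> z c \<star> g b c) (web Y \<times> web Z)" .
    moreover have "psummable (psum Rp) (\<lambda>a. z c \<star> g b c \<star> (x a \<star> f a b)) (web X)"
      "u b \<star> z c \<star> g b c = the_psum (psum Rp) (\<lambda>a. z c \<star> g b c \<star> (x a \<star> f a b)) (web X)"
      if "b \<in> web Y" "c \<in> web Z" for b c
      using that z sum P.the_psum_closed[OF sum[OF that(1)]]
      by (simp_all add: P.the_psum_scale u_def cl P.m_ac)
    ultimately have bs: "bsum (\<lambda>((b, c), a). z c \<star> g b c \<star> (x a \<star> f a b)) ((web Y \<times> web Z) \<times> web X)"
      using bsum_cong_Times[of "web Y" "web Z" "\<lambda>b c. u b \<star> z c \<star> g b c"]
      by (simp add: bsum_Times3_iff space_countable Y Z)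
    have "bij_betw (\<lambda>((a, c), b). ((b, c), a))
        ((web X \<times> web Z) \<times> web Y) ((web Y \<times> web Z) \<times> web X)"
      by (rule bij_betw_byWitness[where f' = "\<lambda>((b, c), a). ((a, c), b)"]) auto
    from bsum_bij_betw[OF this, THEN iffD1, OF bs] show ?thesis
      by (rule bsum_cong[THEN iffD1, rotated]) (use x z in \<open>auto simp: cl P.m_ac\<close>)
  qed
  show sum: "psummable (psum Rp) (\<lambda>b. f a b \<star> g b c) (web Y)" if ac: "a \<in> web X" "c \<in> web Z" for a c
  proof -
    obtain x where x: "x \<in> pts X" "x a \<in> Units Rp"
      by (rule pts_unit[OF X ac(1)])
    obtain z where z: "z \<in> Q Z" "z c \<in> Units Rp"
      by (rule Q_unit[OF Z ac(2)])
    have "psummable (psum Rp) (\<lambda>b. x a \<star> z c \<star> (f a b \<star> g b c)) (web Y)"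
      using *[OF x(1) z(1)] ac by (simp add: bsum_Times3_iff space_countable X Z)
    then show ?thesis
      by (rule P.psummable_scale_unit[rotated 2]) (use x z ac in \<open>auto simp: cl\<close>)
  qed
  show "lin X Z (\<lambda>a c. the_psum (psum Rp) (\<lambda>b. f a b \<star> g b c) (web Y))"
    unfolding lin_def
  proof (intro conjI ballI)
    fix x z assume x: "x \<in> pts X" and z: "z \<in> Q Z"
    have "bsum (\<lambda>(a, c). the_psum (psum Rp) (\<lambda>b. x a \<star> z c \<star> (f a b \<star> g b c)) (web Y))
        (web X \<times> web Z)"
      using *[OF x z] by (simp add: bsum_Times3_iff space_countable X Z)
    then show "bsum (\<lambda>(a, c). x a \<star> z c \<star> the_psum (psum Rp) (\<lambda>b. f a b \<star> g b c) (web Y))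
        (web X \<times> web Z)"
      by (rule bsum_cong_Times[THEN iffD1, rotated])
        (use x z sum in \<open>simp add: cl P.the_psum_scale\<close>)
  qed (simp add: sum P.the_psum_closed)
qed

section \<open>The spaces \<open>D\<close>, \<open>1\<close> and
  \<open>D \<multimap> X\<close>\<close>

abbreviation "NN \<equiv> range TNum"
abbreviation "D \<equiv> nat_space Rp B"
abbreviation "DS \<equiv> limp Rp B D"

lemma is_space_biorth:
  assumes "countable W" "F \<subseteq> W \<rightarrow>\<^sub>E Cp" "covering Rp W F" "covering Rp W (orth Rp B W F)"
  shows "is_space Rp B \<lparr>web = W, pts = orth Rp B W (orth Rp B W F)\<rparr>"
proof -
  have "covering Rp W (orth Rp B W (orth Rp B W F))"
    using assms(3) subset_biorth[OF assms(2)] unfolding covering_def by blast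
  then show ?thesis
    using assms orth_subset_PiE by (simp add: is_space_def triple_orth)
qed

text \<open>The witness is a unit \<open>\<beta>\<close> of \<open>B\<close> at the token
  \<open>a\<close> and zero elsewhere; its pairing with a vector of \<open>F\<close> is
  \<open>\<beta>\<close> or zero, and both lie in \<open>B\<close>.\<close>

lemma covering_orthI:
  assumes W: "countable W" and F: "\<And>x a. x \<in> F \<Longrightarrow> a \<in> W \<Longrightarrow> x a = \<one>\<^bsub>Rp\<^esub> \<or> x a = rzero Rp"
  shows "covering Rp W (orth Rp B W F)"
  unfolding covering_def
proof
  fix a assume a: "a \<in> W"
  obtain \<beta> where \<beta>: "\<beta> \<in> B" "\<beta> \<in> Units Rp"
    using B_unit by blast
  let ?y = "\<lambda>b\<in>W. if b = a then \<beta> else rzero Rp"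
  have "?y \<in> orth Rp B W F"
    unfolding mem_orth
  proof (intro conjI ballI)
    fix x assume x: "x \<in> F"
    have "x b \<in> Cp" if "b \<in> W" for b
      using F[OF x that] by auto
    then have "has_psum (psum Rp) (\<lambda>b. x b \<star> ?y b) W (x a \<star> ?y a)"
      using W a B_closed[OF \<beta>(1)] by (intro P.has_psum_single) auto
    moreover have "x a \<star> ?y a \<in> B"
      using F[OF x a] a \<beta> B_closed[OF \<beta>(1)] zero_in_B by auto
    ultimately show "bsum (\<lambda>b. x b \<star> ?y b) W"
      unfolding bsum_def by (rule rev_bexI[rotated])
  qed (use B_closed[OF \<beta>(1)] in auto)
  moreover have "?y a \<in> Units Rp"
    using a \<beta> by simp
  ultimately show "\<exists>y\<in>orth Rp B W F. y a \<in> Units Rp"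
    by blast
qed

lemma web_nat_space [simp]: "web D = NN"
  by (simp add: nat_space_def)

lemma web_unit_space [simp]: "web (unit_space Rp B) = {TStar}"
  by (simp add: unit_space_def)

lemma const_one_closed: "const_one Rp W \<in> W \<rightarrow>\<^sub>E Cp"
  by (auto simp: const_one_def)

lemma is_space_nat: "is_space Rp B D"
  unfolding nat_space_def linf_def
proof (rule is_space_biorth)
  show "covering Rp NN {const_one Rp NN}"
    by (auto simp: covering_def const_one_def)
  show "covering Rp NN (orth Rp B NN {const_one Rp NN})"
    by (rule covering_orthI) (auto simp: const_one_def)
qed (use const_one_closed in auto)

lemma is_space_unit: "is_space Rp B (unit_space Rp B)"
  unfolding unit_space_def
proof (rule is_space_biorth)
  show "covering Rp {TStar} {std_basis Rp {TStar} TStar}"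
    by (auto simp: covering_def std_basis_def kron_def)
  show "covering Rp {TStar} (orth Rp B {TStar} {std_basis Rp {TStar} TStar})"
    by (rule covering_orthI) (auto simp: std_basis_def kron_def)
qed (auto simp: std_basis_def)

lemma Q_nat:
  fixes y :: "'a tok \<Rightarrow> 'p"
  shows "y \<in> Q D \<longleftrightarrow> y \<in> NN \<rightarrow>\<^sub>E Cp \<and> bsum y NN"
proof -
  let ?d = "const_one Rp (NN :: 'a tok set)"
  have Q: "Q (D :: ('a, 'p) space) = orth Rp B NN {?d}"
    unfolding nat_space_def linf_def space.simps
    by (rule triple_orth) (simp add: const_one_closed)
  have "bsum (\<lambda>i. ?d i \<star> y i) NN \<longleftrightarrow> bsum y NN" if "y \<in> NN \<rightarrow>\<^sub>E Cp"
    by (rule bsum_cong) (use that in \<open>auto simp: const_one_def dest: PiE_mem\<close>)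
  then show ?thesis
    unfolding Q mem_orth by auto
qed

lemma const_one_in_nat: "const_one Rp NN \<in> pts D"
  unfolding nat_space_def linf_def space.simps
  by (rule subsetD[OF subset_biorth]) (simp_all add: const_one_closed)

text \<open>A basis vector lies termwise below the constant vector one, so its pairing with
  \<open>y\<close> is dominated by the sum of \<open>y\<close>.\<close>

lemma std_basis_in_nat: "std_basis Rp NN (TNum i) \<in> pts D"
  unfolding pts_iff[OF is_space_nat]
proof (intro conjI ballI)
  fix y assume y: "y \<in> Q D"
  have "bsum y NN"
    using y Q_nat by blast
  then have "bsum (\<lambda>a. y a \<star> std_basis Rp NN (TNum i) a) NN"
    by (rule bsum_mono) (use Q_closed[OF y] in \<open>auto simp: std_basis_def kron_def P.ple_refl P.ple_zero\<close>)
  then show "bsum (\<lambda>a. y a \<star> std_basis Rp NN (TNum i) a) (web D)"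
    by simp
qed (auto simp: std_basis_def)

lemma DS_bsum:
  assumes X: "is_space Rp B X" and t: "t \<in> pts (DS X)" and h: "h \<in> pts D" and y: "y \<in> Q X"
  shows "bsum (\<lambda>(i, a). h i \<star> y a \<star> t (TPair i a)) (NN \<times> web X)"
  using t lin_bsum[OF _ h y] by (simp add: mem_limp[OF space_pts_subset[OF is_space_nat]])

text \<open>Among the points \<open>h\<close> of \<open>D\<close>, only the diagonal has to be
  tested: the row sums \<open>u i = \<Sigma>_a y_a t_ia\<close> then have their total in
  \<open>B\<close>, so \<open>u\<close> is in \<open>Q D\<close> and pairs with every other
  \<open>h\<close>.\<close>

lemma mem_DS:
  fixes X :: "('a, 'p) space"
  assumes X: "is_space Rp B X"
  shows "t \<in> pts (DS X) \<longleftrightarrow> t \<in> wprod NN (web X) \<rightarrow>\<^sub>E Cp \<and>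
    (\<forall>y\<in>Q X. bsum (\<lambda>(i, a). y a \<star> t (TPair i a)) (NN \<times> web X))"
proof (intro iffI conjI ballI)
  assume t: "t \<in> pts (DS X)"
  show tC: "t \<in> wprod NN (web X) \<rightarrow>\<^sub>E Cp"
    using t by (simp add: mem_limp[OF space_pts_subset[OF is_space_nat]])
  fix y assume y: "y \<in> Q X"
  show "bsum (\<lambda>(i, a). y a \<star> t (TPair i a)) (NN \<times> web X)"
    using DS_bsum[OF X t const_one_in_nat y]
    by (rule bsum_cong_Times[THEN iffD1, rotated]) (use Q_closed[OF y] in \<open>simp add: const_one_def\<close>)
next
  assume t: "t \<in> wprod NN (web X) \<rightarrow>\<^sub>E Cp \<and>
    (\<forall>y\<in>Q X. bsum (\<lambda>(i, a). y a \<star> t (TPair i a)) (NN \<times> web X))"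
  then have tC: "t (TPair i a) \<in> Cp" if "i \<in> NN" "a \<in> web X" for i a
    using PiE_mem[of t "wprod NN (web X)" "\<lambda>_. Cp" "TPair i a"] that by simp
  have "lin D X (\<lambda>i a. t (TPair i a))"
    unfolding lin_def
  proof (intro conjI ballI)
    fix h :: "'a tok \<Rightarrow> 'p" and y assume h: "h \<in> pts D" and y: "y \<in> Q X"
    have hC: "h i \<in> Cp" if "i \<in> NN" for i
      using pts_closed[OF is_space_nat h] that by simp
    define u :: "'a tok \<Rightarrow> 'p" where "u = (\<lambda>i\<in>NN. the_psum (psum Rp) (\<lambda>a. y a \<star> t (TPair i a)) (web X))"
    have s: "\<forall>i\<in>NN. psummable (psum Rp) (\<lambda>a. y a \<star> t (TPair i a)) (web X)"
      "bsum (\<lambda>i. the_psum (psum Rp) (\<lambda>a. y a \<star> t (TPair i a)) (web X)) NN"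
      using t y by (simp_all add: bsum_Times_iff)
    have "u \<in> NN \<rightarrow>\<^sub>E Cp" "bsum u NN"
      using s P.the_psum_closed by (auto simp: u_def cong: bsum_cong)
    then have "u \<in> Q D"
      using Q_nat by blast
    from pts_Q[OF h this] have "bsum (\<lambda>i. h i \<star> u i) NN"
      by simp
    then have "bsum (\<lambda>i. the_psum (psum Rp) (\<lambda>a. h i \<star> (y a \<star> t (TPair i a))) (web X)) NN"
      by (rule bsum_cong[THEN iffD1, rotated]) (simp add: u_def P.the_psum_scale hC s(1)[rule_format])
    then have "bsum (\<lambda>(i, a). h i \<star> (y a \<star> t (TPair i a))) (NN \<times> web X)"
      using s by (simp add: bsum_Times_iff P.the_psum_scale hC)
    then show "bsum (\<lambda>(i, a). h i \<star> y a \<star> t (TPair i a)) (web D \<times> web X)"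
      unfolding web_nat_space
      by (rule bsum_cong_Times[THEN iffD1, rotated]) (simp add: P.m_assoc hC tC Q_closed[OF y])
  qed (use tC in simp)
  then show "t \<in> pts (DS X)"
    using t by (simp add: mem_limp[OF space_pts_subset[OF is_space_nat]])
qed

lemma DS_closed:
  "is_space Rp B X \<Longrightarrow> t \<in> pts (DS X) \<Longrightarrow> i \<in> NN \<Longrightarrow> a \<in> web X \<Longrightarrow> t (TPair i a) \<in> Cp"
  using PiE_mem[of t "wprod NN (web X)" "\<lambda>_. Cp" "TPair i a"] by (simp add: mem_DS)

text \<open>The constant vector one tensored with \<open>y\<close>. Such vectors give the covering
  of the dual of \<open>DS X\<close>, and testing against them amounts to summing over
  \<open>NN\<close>, which is the forward half of \<open>lin_DS_iff\<close>.\<close>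

lemma diag_in_Q_DS:
  assumes X: "is_space Rp B X" and y: "y \<in> Q X"
  shows "mat NN (web X) (\<lambda>_ a. y a) \<in> Q (DS X)"
  unfolding mem_orth
proof (intro conjI ballI)
  fix t assume t: "t \<in> pts (DS X)"
  have "bsum (\<lambda>(i, a). y a \<star> t (TPair i a)) (NN \<times> web X)"
    using t y mem_DS[OF X] by blast
  then have "bsum (\<lambda>(i, a). t (TPair i a) \<star> y a) (NN \<times> web X)"
    by (rule bsum_cong_Times[THEN iffD1, rotated]) (simp add: P.m_comm Q_closed[OF y] DS_closed[OF X t])
  then show "bsum (\<lambda>c. t c \<star> mat NN (web X) (\<lambda>_ a. y a) c) (web (DS X))"
    by (simp add: bsum_wprod cong: bsum_cong_Times)
qed (use Q_closed[OF y] in simp)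

text \<open>A basis vector tensored with \<open>x\<close>; in the test of \<open>mem_DS\<close> only
  row \<open>i\<close> survives, and it is the pairing of \<open>x\<close> with
  \<open>y\<close>.\<close>

lemma basis_in_DS:
  assumes X: "is_space Rp B X" and x: "x \<in> pts X" and i: "i \<in> NN"
  shows "mat NN (web X) (\<lambda>j a. if j = i then x a else rzero Rp) \<in> pts (DS X)"
  unfolding mem_DS[OF X]
proof (intro conjI ballI)
  fix y assume y: "y \<in> Q X"
  have "bsum (\<lambda>a. y a \<star> x a) (web X)"
    using x y pts_iff[OF X] by blast
  moreover have "bsum (\<lambda>(j, a). y a \<star> mat NN (web X) (\<lambda>j a. if j = i then x a else rzero Rp) (TPair j a))
      (NN \<times> web X) \<longleftrightarrow> bsum (\<lambda>a. (\<lambda>(j, a). y a \<star> mat NN (web X)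
        (\<lambda>j a. if j = i then x a else rzero Rp) (TPair j a)) (i, a)) (web X)"
    using i space_countable[OF X] Q_closed[OF y]
    by (intro bsum_reindex_support) (auto simp: inj_on_def)
  ultimately show "bsum (\<lambda>(j, a). y a \<star> mat NN (web X) (\<lambda>j a. if j = i then x a else rzero Rp)
      (TPair j a)) (NN \<times> web X)"
    using i by (simp cong: bsum_cong)
qed (use pts_closed[OF X x] in simp)

text \<open>A tensor product of spaces need not be a space: for \<open>Rp = [0, \<infinity>)\<^sup>2\<close> and
  \<open>B = {(s, t). min s t \<le> 1}\<close>, the one-token space \<open>B\<close> has a tensor square whose dual contains no unit.
  So the coverings for \<open>D \<multimap> X\<close> have to be exhibited directly.\<close>

lemma is_space_DS:
  assumes X: "is_space Rp B X"
  shows "is_space Rp B (DS X)"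
  unfolding is_space_def
proof (intro conjI)
  show "countable (web (DS X))"
    using space_countable[OF X] by simp
  show "pts (DS X) \<subseteq> web (DS X) \<rightarrow>\<^sub>E Cp"
    using mem_DS[OF X] by (simp add: subset_iff)
  have "pts (DS X) = orth Rp B (web (DS X)) (pts (tensor Rp B D (dual Rp B X)))"
    by (simp add: limp_def dual_def tensor_def Let_def)
  moreover have "pts (tensor Rp B D (dual Rp B X)) \<subseteq> web (DS X) \<rightarrow>\<^sub>E Cp"
    using orth_subset_PiE by (simp add: tensor_def dual_def Let_def)
  ultimately show "orth Rp B (web (DS X)) (Q (DS X)) = pts (DS X)"
    by (simp add: triple_orth)
  show "covering Rp (web (DS X)) (pts (DS X))"
    unfolding covering_def
  proof
    fix c assume "c \<in> web (DS X)"
    then obtain i a where c: "c = TPair i a" "i \<in> NN" "a \<in> web X"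
      by (auto simp: wprod_def)
    obtain x where "x \<in> pts X" "x a \<in> Units Rp"
      by (rule pts_unit[OF X c(3)])
    with basis_in_DS[OF X _ c(2)] show "\<exists>t\<in>pts (DS X). t c \<in> Units Rp"
      using c by (intro bexI[of _ "mat NN (web X) (\<lambda>j a. if j = i then x a else rzero Rp)"]) auto
  qed
  show "covering Rp (web (DS X)) (Q (DS X))"
    unfolding covering_def
  proof
    fix c assume "c \<in> web (DS X)"
    then obtain i a where c: "c = TPair i a" "i \<in> NN" "a \<in> web X"
      by (auto simp: wprod_def)
    obtain y where "y \<in> Q X" "y a \<in> Units Rp"
      by (rule Q_unit[OF X c(3)])
    with diag_in_Q_DS[OF X] show "\<exists>t\<in>Q (DS X). t c \<in> Units Rp"
      using c by (intro bexI[of _ "mat NN (web X) (\<lambda>_ a. y a)"]) auto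
  qed
qed

lemma bsum_bijI: "bij_betw h A A' \<Longrightarrow> bsum f A' \<Longrightarrow> bsum (\<lambda>a. f (h a)) A"
  by (simp add: bsum_bij_betw)

text \<open>Forward, a test vector constant in \<open>i\<close> turns the condition into a sum over
  \<open>((a, b), i)\<close>, and the innermost sum is the sum of the slices. Backward, the same
  triple sum is regrouped with \<open>a\<close> innermost, which shows that \<open>h\<close> maps
  each \<open>x\<close> to a point of \<open>DS Y\<close>.\<close>

lemma lin_DS_iff:
  assumes X: "is_space Rp B X" and Y: "is_space Rp B Y"
    and hC: "\<And>a i b. a \<in> web X \<Longrightarrow> i \<in> NN \<Longrightarrow> b \<in> web Y \<Longrightarrow> h a (TPair i b) \<in> Cp"
  shows "lin X (DS Y) h \<longleftrightarrow>
    (\<forall>a\<in>web X. \<forall>b\<in>web Y. psummable (psum Rp) (\<lambda>i. h a (TPair i b)) NN) \<and>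
    lin X Y (\<lambda>a b. the_psum (psum Rp) (\<lambda>i. h a (TPair i b)) NN)"
proof -
  note cl = pts_closed[OF X] Q_closed hC
  note ctbl = space_countable[OF X] space_countable[OF Y]
  have bij1: "bij_betw (\<lambda>((a, b), i). (a, TPair i b)) ((web X \<times> web Y) \<times> NN) (web X \<times> wprod NN (web Y))"
    by (rule bij_betw_byWitness[where f' = "\<lambda>(a, c). case c of TPair i b \<Rightarrow> ((a, b), i)"])
      (auto simp: wprod_def)
  have bij2: "bij_betw (\<lambda>((i, b), a). ((a, b), i)) ((NN \<times> web Y) \<times> web X) ((web X \<times> web Y) \<times> NN)"
    by (rule bij_betw_byWitness[where f' = "\<lambda>((a, b), i). ((i, b), a)"]) auto
  show ?thesis
  proof (intro iffI conjI)
    assume h: "lin X (DS Y) h"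
    have *: "bsum (\<lambda>((a, b), i). x a \<star> y b \<star> h a (TPair i b)) ((web X \<times> web Y) \<times> NN)"
      if x: "x \<in> pts X" and y: "y \<in> Q Y" for x y
    proof -
      have "bsum (\<lambda>(a, c). x a \<star> mat NN (web Y) (\<lambda>_ b. y b) c \<star> h a c) (web X \<times> wprod NN (web Y))"
        using lin_bsum[OF h x diag_in_Q_DS[OF Y y]] by simp
      from bsum_bijI[OF bij1 this] show ?thesis
        by (rule bsum_cong[THEN iffD1, rotated]) auto
    qed
    show sum: "\<forall>a\<in>web X. \<forall>b\<in>web Y. psummable (psum Rp) (\<lambda>i. h a (TPair i b)) NN"
    proof (intro ballI)
      fix a b assume a: "a \<in> web X" and b: "b \<in> web Y"
      obtain x where x: "x \<in> pts X" "x a \<in> Units Rp"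
        by (rule pts_unit[OF X a])
      obtain y where y: "y \<in> Q Y" "y b \<in> Units Rp"
        by (rule Q_unit[OF Y b])
      have "psummable (psum Rp) (\<lambda>i. x a \<star> y b \<star> h a (TPair i b)) NN"
        using *[OF x(1) y(1)] a b by (simp add: bsum_Times3_iff ctbl)
      then show "psummable (psum Rp) (\<lambda>i. h a (TPair i b)) NN"
        by (rule P.psummable_scale_unit[rotated 2]) (use x y a b in \<open>auto simp: cl\<close>)
    qed
    show "lin X Y (\<lambda>a b. the_psum (psum Rp) (\<lambda>i. h a (TPair i b)) NN)"
      unfolding lin_def
    proof (intro conjI ballI)
      fix x y assume x: "x \<in> pts X" and y: "y \<in> Q Y"
      have "bsum (\<lambda>(a, b). the_psum (psum Rp) (\<lambda>i. x a \<star> y b \<star> h a (TPair i b)) NN) (web X \<times> web Y)"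
        using *[OF x y] by (simp add: bsum_Times3_iff ctbl)
      then show "bsum (\<lambda>(a, b). x a \<star> y b \<star> the_psum (psum Rp) (\<lambda>i. h a (TPair i b)) NN)
          (web X \<times> web Y)"
        by (rule bsum_cong_Times[THEN iffD1, rotated])
          (use x y sum in \<open>simp add: cl P.the_psum_scale\<close>)
    qed (use sum P.the_psum_closed in blast)
  next
    assume h: "(\<forall>a\<in>web X. \<forall>b\<in>web Y. psummable (psum Rp) (\<lambda>i. h a (TPair i b)) NN) \<and>
      lin X Y (\<lambda>a b. the_psum (psum Rp) (\<lambda>i. h a (TPair i b)) NN)"
    have *: "bsum (\<lambda>((i, b), a). y b \<star> (x a \<star> h a (TPair i b))) ((NN \<times> web Y) \<times> web X)"
      if x: "x \<in> pts X" and y: "y \<in> Q Y" for x y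
    proof -
      have "bsum (\<lambda>(a, b). the_psum (psum Rp) (\<lambda>i. x a \<star> y b \<star> h a (TPair i b)) NN) (web X \<times> web Y)"
        by (rule bsum_cong_Times[THEN iffD1, OF _ lin_bsum[OF conjunct2[OF h] x y]])
          (use h x y in \<open>simp add: cl P.the_psum_scale\<close>)
      then have "bsum (\<lambda>((a, b), i). x a \<star> y b \<star> h a (TPair i b)) ((web X \<times> web Y) \<times> NN)"
        using h x y by (simp add: bsum_Times3_iff ctbl cl P.the_psum_scale)
      from bsum_bijI[OF bij2 this] show ?thesis
        by (rule bsum_cong[THEN iffD1, rotated]) (use x y in \<open>auto simp: cl P.m_ac\<close>)
    qed
    have sum: "psummable (psum Rp) (\<lambda>a. x a \<star> h a (TPair i b)) (web X)"
      if x: "x \<in> pts X" and ib: "i \<in> NN" "b \<in> web Y" for x i b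
    proof -
      obtain y where y: "y \<in> Q Y" "y b \<in> Units Rp"
        by (rule Q_unit[OF Y ib(2)])
      have "psummable (psum Rp) (\<lambda>a. y b \<star> (x a \<star> h a (TPair i b))) (web X)"
        using *[OF x y(1)] ib by (auto simp: bsum_Times3_iff ctbl)
      then show ?thesis
        by (rule P.psummable_scale_unit[rotated 2]) (use x y ib in \<open>auto simp: cl\<close>)
    qed
    show "lin X (DS Y) h"
      \<comment> \<open>The points of \<open>DS Y\<close> are described by \<open>mem_DS\<close>,
        its dual only by definition; testing by application to \<open>x\<close> avoids arbitrary
        elements of that dual.\<close>
      unfolding lin_iff_app[OF X is_space_DS[OF Y]]
    proof (intro conjI ballI)
      fix x assume x: "x \<in> pts X"
      show "(\<lambda>c\<in>web (DS Y). the_psum (psum Rp) (\<lambda>a. x a \<star> h a c) (web X)) \<in> pts (DS Y)" (is "?t \<in> _")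
        unfolding mem_DS[OF Y]
      proof (intro conjI ballI)
        show "?t \<in> wprod NN (web Y) \<rightarrow>\<^sub>E Cp"
          using sum[OF x] by (auto simp: wprod_def intro!: P.the_psum_closed)
        fix y assume y: "y \<in> Q Y"
        have "bsum (\<lambda>(i, b). the_psum (psum Rp) (\<lambda>a. y b \<star> (x a \<star> h a (TPair i b))) (web X))
            (NN \<times> web Y)"
          using *[OF x y] by (simp add: bsum_Times3_iff ctbl)
        then show "bsum (\<lambda>(i, b). y b \<star> ?t (TPair i b)) (NN \<times> web Y)"
          by (rule bsum_cong_Times[THEN iffD1, rotated])
            (use sum[OF x] y in \<open>simp add: cl P.the_psum_scale\<close>)
      qed
    qed (use sum hC in \<open>auto simp: wprod_def\<close>)
  qed
qed

text \<open>A point \<open>x\<close> of the unit space is a scalar that maps \<open>B\<close> into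
  \<open>B\<close>, since every element of \<open>B\<close> is a vector of the dual. Applied to the
  pairing \<open>s\<close> of \<open>h\<close> and \<open>y\<close>, this is the required
  test.\<close>

lemma lin_unit_point:
  fixes X :: "('a, 'p) space"
  assumes X: "is_space Rp B X" and h: "h \<in> pts X"
  shows "lin (unit_space Rp B) X (\<lambda>_. h)"
  unfolding lin_def
proof (intro conjI ballI)
  fix x :: "'a tok \<Rightarrow> 'p" and y assume x: "x \<in> pts (unit_space Rp B)" and y: "y \<in> Q X"
  have xC: "x TStar \<in> Cp"
    using pts_closed[OF is_space_unit x] by simp
  obtain s where s: "s \<in> B" "has_psum (psum Rp) (\<lambda>a. h a \<star> y a) (web X) s"
    using pts_Q[OF h y] by (auto simp: bsum_def)
  let ?z = "\<lambda>_\<in>{TStar :: 'a tok}. s" and ?e = "std_basis Rp {TStar} TStar :: 'a tok \<Rightarrow> 'p"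
  have "?z \<in> orth Rp B {TStar} {?e}"
    using s(1) B_closed[OF s(1)] P.has_psum_singleton[of "\<lambda>a. ?e a \<star> ?z a" TStar]
    by (auto simp: mem_orth bsum_def std_basis_def kron_def)
  then have "?z \<in> Q (unit_space Rp B)"
    using subset_biorth[OF orth_subset_PiE] unfolding unit_space_def space.simps by blast
  from pts_Q[OF x this] have "bsum (\<lambda>a. x a \<star> ?z a) {TStar}"
    by simp
  moreover have "has_psum (psum Rp) (\<lambda>a. x a \<star> ?z a) {TStar} (x TStar \<star> s)"
    using P.has_psum_singleton[of "\<lambda>a. x a \<star> ?z a" TStar] xC B_closed[OF s(1)] by simp
  ultimately have xs: "x TStar \<star> s \<in> B"
    using P.has_psum_unique by (auto simp: bsum_def)
  have "has_psum (psum Rp) (\<lambda>b. x TStar \<star> (h b \<star> y b)) (web X) (x TStar \<star> s)"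
    using P.has_psum_scale[OF xC s(2)] .
  with xs have "bsum (\<lambda>b. x TStar \<star> (h b \<star> y b)) (web X)"
    unfolding bsum_def by (rule rev_bexI)
  moreover have "bij_betw snd ({TStar} \<times> web X) (web X)"
    by (auto simp: bij_betw_def inj_on_def)
  ultimately have "bsum (\<lambda>p. x TStar \<star> (h (snd p) \<star> y (snd p))) ({TStar} \<times> web X)"
    by (rule bsum_bijI[rotated])
  then show "bsum (\<lambda>(a, b). x a \<star> y b \<star> h b) (web (unit_space Rp B) \<times> web X)"
    unfolding web_unit_space
    by (rule bsum_cong[THEN iffD1, rotated]) (auto simp: xC pts_closed[OF X h] Q_closed[OF y] P.m_ac)
qed (use pts_closed[OF X h] in simp)

lemma lin_id:
  assumes X: "is_space Rp B X"
  shows "lin X X (kron Rp)"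
  unfolding lin_def
proof (intro conjI ballI)
  fix x y assume x: "x \<in> pts X" and y: "y \<in> Q X"
  have "bsum (\<lambda>(a, b). x a \<star> y b \<star> kron Rp a b) (web X \<times> web X) \<longleftrightarrow>
      bsum (\<lambda>a. (\<lambda>(a, b). x a \<star> y b \<star> kron Rp a b) (a, a)) (web X)"
    using space_countable[OF X] pts_closed[OF X x] Q_closed[OF y]
    by (intro bsum_reindex_support) (auto simp: inj_on_def kron_def)
  moreover have "bsum (\<lambda>a. x a \<star> y a) (web X)"
    by (rule pts_Q[OF x y])
  ultimately show "bsum (\<lambda>(a, b). x a \<star> y b \<star> kron Rp a b) (web X \<times> web X)"
    using pts_closed[OF X x] Q_closed[OF y] by (simp add: kron_def cong: bsum_cong)
qed simp

lemma lin_zero: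
  assumes X: "is_space Rp B X" and Y: "is_space Rp B Y"
  shows "lin X Y (\<lambda>_ _. rzero Rp)"
  unfolding lin_def using space_countable[OF X] space_countable[OF Y]
  by (auto intro!: bsum_zero simp: pts_closed[OF X] Q_closed)


section \<open>Matrices over an absolute ring\<close>

abbreviation "rsum \<equiv> the_psum (psum R)"
abbreviation "W \<equiv> Web Rp B R \<nu>"
abbreviation "Hom X Y \<equiv> Mpts R \<nu> (limp Rp B X Y)"
abbreviation "MAT X Y \<equiv> mat (web X) (web Y)"

lemma abs_closed [simp]: "x \<in> Cr \<Longrightarrow> \<nu> x \<in> Cp"
  using absolute by (auto simp: absolute_pcr_def)

lemma abs_zero [simp]: "\<nu> (rzero R) = rzero Rp"
  using absolute by (auto simp: absolute_pcr_def)

lemma abs_one [simp]: "\<nu> \<one>\<^bsub>R\<^esub> = \<one>\<^bsub>Rp\<^esub>"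
  using absolute by (auto simp: absolute_pcr_def)

lemma abs_mult [simp]: "x \<in> Cr \<Longrightarrow> y \<in> Cr \<Longrightarrow> \<nu> (x \<odot> y) = \<nu> x \<star> \<nu> y"
  using absolute by (auto simp: absolute_pcr_def)

lemma abs_kron [simp]: "\<nu> (kron R a b) = kron Rp a b"
  by (simp add: kron_def)

lemma abs_psummable:
  assumes "\<And>a. a \<in> A \<Longrightarrow> x a \<in> Cr"
  shows "psummable (psum R) x A \<longleftrightarrow> psummable (psum Rp) (\<lambda>a. \<nu> (x a)) A"
proof (cases "countable A")
  case True
  then have "(\<lambda>n. x (from_nat_into A n)) \<in> to_nat_on A ` A \<rightarrow> Cr"
    using assms by auto
  then show ?thesis
    using absolute True by (simp add: absolute_pcr_def psummable_def has_psum_def)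
qed (simp add: psummable_def has_psum_def)

lemma abs_sum_le:
  assumes "has_psum (psum R) x A s" "has_psum (psum Rp) (\<lambda>a. \<nu> (x a)) A t"
  shows "lle (\<nu> s) t"
proof -
  have "countable A" "\<And>a. a \<in> A \<Longrightarrow> x a \<in> Cr"
    by (rule R.has_psum_countable[OF assms(1)], rule R.has_psum_terms[OF assms(1)])
  then have "(\<lambda>n. x (from_nat_into A n)) \<in> to_nat_on A ` A \<rightarrow> Cr"
    by auto
  moreover have "psum R (to_nat_on A ` A) (\<lambda>n. x (from_nat_into A n)) = Some s"
    "psum Rp (to_nat_on A ` A) (\<lambda>n. \<nu> (x (from_nat_into A n))) = Some t"
    using assms by (simp_all add: has_psum_def)
  moreover have "lle (\<nu> s) t" if "x \<in> A \<rightarrow> Cr" "psum R A x = Some s"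
    "psum Rp A (\<lambda>a. \<nu> (x a)) = Some t" for A x
    using absolute that by (simp add: absolute_pcr_def)
  ultimately show ?thesis
    by blast
qed

definition hom_fun :: "('a, 'p) space \<Rightarrow> ('a, 'p) space \<Rightarrow> ('a tok \<Rightarrow> 'a tok \<Rightarrow> 'r) \<Rightarrow> bool" where
  "hom_fun X Y f \<longleftrightarrow>
    (\<forall>a\<in>web X. \<forall>b\<in>web Y. f a b \<in> Cr) \<and> lin X Y (\<lambda>a b. \<nu> (f a b))"

lemma hom_fun_closed: "hom_fun X Y f \<Longrightarrow> a \<in> web X \<Longrightarrow> b \<in> web Y \<Longrightarrow> f a b \<in> Cr"
  by (simp add: hom_fun_def)

lemma mat_in_Hom: "is_space Rp B X \<Longrightarrow> MAT X Y f \<in> Hom X Y \<longleftrightarrow> hom_fun X Y f"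
proof -
  assume X: "is_space Rp B X"
  have eq: "(\<lambda>c\<in>wprod (web X) (web Y). \<nu> (MAT X Y f c)) = MAT X Y (\<lambda>a b. \<nu> (f a b))"
    by (rule extensional_wprod_eqI[where V = "web X" and W = "web Y"]) auto
  have "lin X Y (\<lambda>a b. MAT X Y (\<lambda>a b. \<nu> (f a b)) (TPair a b)) \<longleftrightarrow> lin X Y (\<lambda>a b. \<nu> (f a b))"
    by (rule lin_cong) simp
  then show ?thesis
    unfolding Mpts_def web_limp mem_Collect_eq eq mem_limp[OF space_pts_subset[OF X]]
    by (auto simp: hom_fun_def)
qed

lemma Hom_eta:
  "t \<in> Hom X Y \<Longrightarrow> MAT X Y (\<lambda>a b. t (TPair a b)) = t"
  by (rule mat_eta[where A = Cr]) (simp add: Mpts_def)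

lemma HomE:
  assumes "is_space Rp B X" "t \<in> Hom X Y"
  obtains f where "t = MAT X Y f" "hom_fun X Y f"
  using Hom_eta[OF assms(2)] assms by (metis mat_in_Hom)

lemma web_tensor [simp]: "web (tensor Rp B X Y) = wprod (web X) (web Y)"
  by (simp add: tensor_def Let_def)

lemma Web_simps [simp]:
  "obj W = {X. is_space Rp B X}" "hom W = Hom"
  "idm W X = MAT X X (kron R)" "ten W = tensor Rp B" "unt W = unit_space Rp B"
  "ihom W = limp Rp B"
  by (simp_all add: Web_def)

lemma comp_mat:
  "comp W X Y Z (MAT Y Z g) (MAT X Y f) =
    MAT X Z (\<lambda>a c. rsum (\<lambda>b. f a b \<odot> g b c) (web Y))"
  by (auto simp: Web_def intro!: mat_cong R.the_psum_cong)

text \<open>The entries are summable because their absolute values are, by \<open>lin_comp\<close>;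
  the product is dominated by the product of the matrices of absolute values.\<close>

lemma hom_fun_comp:
  assumes X: "is_space Rp B X" and Y: "is_space Rp B Y" and Z: "is_space Rp B Z"
    and f: "hom_fun X Y f" and g: "hom_fun Y Z g"
  shows "\<And>a c. a \<in> web X \<Longrightarrow> c \<in> web Z \<Longrightarrow> psummable (psum R) (\<lambda>b. f a b \<odot> g b c) (web Y)"
    and "hom_fun X Z (\<lambda>a c. rsum (\<lambda>b. f a b \<odot> g b c) (web Y))"
proof -
  note cl = hom_fun_closed[OF f] hom_fun_closed[OF g]
  have fg: "lin X Y (\<lambda>a b. \<nu> (f a b))" "lin Y Z (\<lambda>a b. \<nu> (g a b))"
    using f g by (simp_all add: hom_fun_def)
  note comp = lin_comp[OF X Y Z fg]
  have abs: "psummable (psum Rp) (\<lambda>b. \<nu> (f a b \<odot> g b c)) (web Y)"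
    "the_psum (psum Rp) (\<lambda>b. \<nu> (f a b \<odot> g b c)) (web Y) =
      the_psum (psum Rp) (\<lambda>b. \<nu> (f a b) \<star> \<nu> (g b c)) (web Y)"
    if "a \<in> web X" "c \<in> web Z" for a c
    using comp(1)[OF that] that
    by (auto simp: cl cong: P.psummable_cong intro!: P.the_psum_cong)
  show sum: "psummable (psum R) (\<lambda>b. f a b \<odot> g b c) (web Y)" if "a \<in> web X" "c \<in> web Z" for a c
    using abs(1)[OF that] that by (subst abs_psummable) (auto simp: cl)
  show "hom_fun X Z (\<lambda>a c. rsum (\<lambda>b. f a b \<odot> g b c) (web Y))"
    unfolding hom_fun_def
  proof (intro conjI ballI)
    show "lin X Z (\<lambda>a c. \<nu> (rsum (\<lambda>b. f a b \<odot> g b c) (web Y)))"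
    proof (rule lin_mono[OF comp(2) X], intro conjI)
      fix a c assume ac: "a \<in> web X" "c \<in> web Z"
      show "\<nu> (rsum (\<lambda>b. f a b \<odot> g b c) (web Y)) \<in> Cp"
        using sum[OF ac] by (simp add: R.the_psum_closed)
      show "lle (\<nu> (rsum (\<lambda>b. f a b \<odot> g b c) (web Y)))
          (the_psum (psum Rp) (\<lambda>b. \<nu> (f a b) \<star> \<nu> (g b c)) (web Y))"
        using abs_sum_le[OF R.has_psum_the_psum[OF sum[OF ac]] P.has_psum_the_psum[OF abs(1)[OF ac]]]
        by (simp add: abs(2)[OF ac])
    qed
  qed (use sum R.the_psum_closed in blast)
qed

lemma hom_fun_id: "is_space Rp B X \<Longrightarrow> hom_fun X X (kron R)"
  by (simp add: hom_fun_def lin_id)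

lemma hom_fun_zero: "is_space Rp B X \<Longrightarrow> is_space Rp B Y \<Longrightarrow> hom_fun X Y (\<lambda>_ _. rzero R)"
  by (simp add: hom_fun_def lin_zero)

text \<open>\<open>the_psum_assoc\<close> asks for the double sum in \<open>R\<close>. Two
  applications of \<open>lin_comp\<close> give the iterated sum of absolute values, PA in
  \<open>Rp\<close> assembles it, and absoluteness transfers summability to
  \<open>R\<close>.\<close>

lemma comp_assoc:
  assumes V: "is_space Rp B V" and X: "is_space Rp B X" and Y: "is_space Rp B Y" and Z: "is_space Rp B Z"
    and f: "hom_fun V X f" and g: "hom_fun X Y g" and h: "hom_fun Y Z h"
    and a: "a \<in> web V" and d: "d \<in> web Z"
  shows "rsum (\<lambda>c. rsum (\<lambda>b. f a b \<odot> g b c) (web X) \<odot> h c d) (web Y) =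
    rsum (\<lambda>b. f a b \<odot> rsum (\<lambda>c. g b c \<odot> h c d) (web Y)) (web X)"
proof (rule R.the_psum_assoc)
  note cl = hom_fun_closed[OF f] hom_fun_closed[OF g] hom_fun_closed[OF h]
  have lin: "lin V X (\<lambda>a b. \<nu> (f a b))" "lin X Y (\<lambda>a b. \<nu> (g a b))" "lin Y Z (\<lambda>a b. \<nu> (h a b))"
    using f g h by (simp_all add: hom_fun_def)
  note fg = lin_comp[OF V X Y lin(1,2)]
  have scale: "psummable (psum Rp) (\<lambda>b. \<nu> (h c d) \<star> (\<nu> (f a b) \<star> \<nu> (g b c))) (web X)"
    "the_psum (psum Rp) (\<lambda>b. \<nu> (h c d) \<star> (\<nu> (f a b) \<star> \<nu> (g b c))) (web X) =
      the_psum (psum Rp) (\<lambda>b. \<nu> (f a b) \<star> \<nu> (g b c)) (web X) \<star> \<nu> (h c d)"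
    if "c \<in> web Y" for c
    using P.the_psum_scale[OF _ fg(1)[OF a that]] P.the_psum_closed[OF fg(1)[OF a that]] that d
    by (simp_all add: cl P.m_comm)
  have "psummable (psum Rp) (\<lambda>c. the_psum (psum Rp) (\<lambda>b. \<nu> (h c d) \<star> (\<nu> (f a b) \<star> \<nu> (g b c))) (web X)) (web Y)"
    using lin_comp(1)[OF V Y Z fg(2) lin(3) a d] by (simp add: scale(2) cong: P.psummable_cong)
  then have "psummable (psum Rp) (\<lambda>(c, b). \<nu> (h c d) \<star> (\<nu> (f a b) \<star> \<nu> (g b c))) (web Y \<times> web X)"
    using scale(1) by (auto simp: psummable_def P.has_psum_Times_iff space_countable[OF Y])
  moreover have "\<nu> (case p of (c, b) \<Rightarrow> f a b \<odot> g b c \<odot> h c d) =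
      (case p of (c, b) \<Rightarrow> \<nu> (h c d) \<star> (\<nu> (f a b) \<star> \<nu> (g b c)))" if "p \<in> web Y \<times> web X" for p
    using that a d by (auto simp: cl P.m_comm)
  ultimately show "psummable (psum R) (\<lambda>(c, b). f a b \<odot> g b c \<odot> h c d) (web Y \<times> web X)"
    using a d by (subst abs_psummable) (auto simp: cl cong: P.psummable_cong)
qed (use assms space_countable hom_fun_closed hom_fun_comp(1) in blast)+

lemma is_category_Web: "is_category W"
  unfolding is_category_def
proof (intro conjI ballI)
  fix X Y Z f g assume obj: "X \<in> obj W" "Y \<in> obj W" "Z \<in> obj W"
    and fg: "f \<in> hom W X Y" "g \<in> hom W Y Z"
  then have sp: "is_space Rp B X" "is_space Rp B Y" "is_space Rp B Z"
    by simp_all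
  obtain f' g' where "f = MAT X Y f'" "g = MAT Y Z g'" "hom_fun X Y f'" "hom_fun Y Z g'"
    using fg HomE sp by (metis Web_simps(2))
  then show "comp W X Y Z g f \<in> hom W X Z"
    using hom_fun_comp(2)[OF sp] by (simp add: comp_mat mat_in_Hom sp)
next
  fix X Y f assume obj: "X \<in> obj W" "Y \<in> obj W" and f: "f \<in> hom W X Y"
  then have sp: "is_space Rp B X" "is_space Rp B Y"
    by simp_all
  obtain f' where f': "f = MAT X Y f'" "hom_fun X Y f'"
    using f HomE sp by (metis Web_simps(2))
  show "comp W X X Y f (idm W X) = f"
    unfolding f'(1) Web_simps comp_mat using hom_fun_closed[OF f'(2)] space_countable sp
    by (intro mat_cong R.the_psum_kron_left) auto
  show "comp W X Y Y (idm W Y) f = f"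
    unfolding f'(1) Web_simps comp_mat using hom_fun_closed[OF f'(2)] space_countable sp
    by (intro mat_cong R.the_psum_kron_right) auto
next
  fix V X Y Z f g h assume obj: "V \<in> obj W" "X \<in> obj W" "Y \<in> obj W" "Z \<in> obj W"
    and fgh: "f \<in> hom W V X" "g \<in> hom W X Y" "h \<in> hom W Y Z"
  then have sp: "is_space Rp B V" "is_space Rp B X" "is_space Rp B Y" "is_space Rp B Z"
    by simp_all
  obtain f' where f': "f = MAT V X f'" "hom_fun V X f'"
    using fgh(1) HomE sp by (metis Web_simps(2))
  obtain g' where g': "g = MAT X Y g'" "hom_fun X Y g'"
    using fgh(2) HomE sp by (metis Web_simps(2))
  obtain h' where h': "h = MAT Y Z h'" "hom_fun Y Z h'"
    using fgh(3) HomE sp by (metis Web_simps(2))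
  show "comp W V Y Z h (comp W V X Y g f) = comp W V X Z (comp W X Y Z h g) f"
    unfolding f'(1) g'(1) h'(1) comp_mat using f'(2) g'(2) h'(2)
    by (intro mat_cong comp_assoc[OF sp]) auto
qed (simp add: mat_in_Hom hom_fun_id)

section \<open>The action of \<open>D \<multimap> -\<close> on matrices: copies of \<open>f\<close>
  along the diagonal of \<open>NN\<close>\<close>

definition dlift :: "('a tok \<Rightarrow> 'a tok \<Rightarrow> 'r) \<Rightarrow> 'a tok \<Rightarrow> 'a tok \<Rightarrow> 'r" where
  "dlift f p q = (case p of TPair i a \<Rightarrow> (case q of TPair j b \<Rightarrow> kron R i j \<odot> f a b | _ \<Rightarrow> undefined)
    | _ \<Rightarrow> undefined)"

text \<open>Contraction of the \<open>NN\<close> coordinate with \<open>h\<close>: a basis vector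
  gives a projection, the constant vector one gives the sum.\<close>

definition dproj :: "('a tok \<Rightarrow> 'r) \<Rightarrow> 'a tok \<Rightarrow> 'a tok \<Rightarrow> 'r" where
  "dproj h p b = (case p of TPair i a \<Rightarrow> h i \<odot> kron R a b | _ \<Rightarrow> undefined)"

lemma dlift_apply [simp]: "dlift f (TPair i a) (TPair j b) = kron R i j \<odot> f a b"
  by (simp add: dlift_def)

lemma dproj_apply [simp]: "dproj h (TPair i a) b = h i \<odot> kron R a b"
  by (simp add: dproj_def)

lemma mat_wprod_both_cong:
  "(\<And>i a j b. i \<in> U \<Longrightarrow> a \<in> V \<Longrightarrow> j \<in> U' \<Longrightarrow> b \<in> V' \<Longrightarrow> f (TPair i a) (TPair j b) = g (TPair i a) (TPair j b)) \<Longrightarrow>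
    mat (wprod U V) (wprod U' V') f = mat (wprod U V) (wprod U' V') g"
  by (rule mat_cong) auto

text \<open>The delta restricts the sum over \<open>(p, b)\<close> to the pairs
  \<open>(TPair i a, a)\<close>, and what remains is the pairing of \<open>t\<close> with
  \<open>h\<close> and \<open>y\<close> from \<open>DS_bsum\<close>.\<close>

lemma hom_fun_dproj:
  assumes X: "is_space Rp B X" and h: "\<And>i. i \<in> NN \<Longrightarrow> h i \<in> Cr" "(\<lambda>i\<in>NN. \<nu> (h i)) \<in> pts D"
  shows "hom_fun (DS X) X (dproj h)"
  unfolding hom_fun_def lin_def
proof (intro conjI ballI)
  fix t y assume t: "t \<in> pts (DS X)" and y: "y \<in> Q X"
  note cl = h(1) DS_closed[OF X t] Q_closed[OF y]
  \<comment> \<open>The trailing one is the value of \<open>kron\<close> on the diagonal, written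
    out to match \<open>dproj\<close>.\<close>
  have "bsum (\<lambda>(i, a). t (TPair i a) \<star> y a \<star> (\<nu> (h i) \<star> \<one>\<^bsub>Rp\<^esub>)) (NN \<times> web X)"
    using DS_bsum[OF X t h(2) y]
    by (rule bsum_cong_Times[THEN iffD1, rotated]) (auto simp: cl P.m_ac)
  then have "bsum (\<lambda>p. (\<lambda>(p, b). t p \<star> y b \<star> \<nu> (dproj h p b)) ((\<lambda>(i, a). (TPair i a, a)) p))
      (NN \<times> web X)"
    by (rule bsum_cong[THEN iffD1, rotated]) (auto simp: h(1) kron_def)
  moreover have "bsum (\<lambda>(p, b). t p \<star> y b \<star> \<nu> (dproj h p b)) (wprod NN (web X) \<times> web X) \<longleftrightarrow>
      bsum (\<lambda>p. (\<lambda>(p, b). t p \<star> y b \<star> \<nu> (dproj h p b)) ((\<lambda>(i, a). (TPair i a, a)) p)) (NN \<times> web X)"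
    using space_countable[OF X]
    by (intro bsum_reindex_support) (auto simp: inj_on_def cl kron_def image_iff)
  ultimately show "bsum (\<lambda>(p, b). t p \<star> y b \<star> \<nu> (dproj h p b)) (web (DS X) \<times> web X)"
    unfolding web_limp web_nat_space by (rule iffD2[rotated])
qed (auto simp: h(1))

lemma abs_const_one: "(\<lambda>i\<in>NN. \<nu> (const_one R NN i)) \<in> pts D"
proof -
  have "(\<lambda>i\<in>NN. \<nu> (const_one R NN i)) = const_one Rp NN"
    by (auto simp: const_one_def)
  then show ?thesis
    using const_one_in_nat by metis
qed

lemma dproj_one:
  "is_space Rp B X \<Longrightarrow> hom_fun (DS X) X (dproj (const_one R NN))"
  by (rule hom_fun_dproj[OF _ _ abs_const_one]) (auto simp: const_one_def)

text \<open>By \<open>lin_DS_iff\<close> the sum over the target index \<open>j\<close> decides. The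
  delta leaves the single term \<open>\<nu> (f a b)\<close>, which is the entry of the product of
  the absolute values of the sum map \<open>dproj (const_one R NN)\<close> and of \<open>f\<close>,
  and that product is linear.\<close>

lemma hom_fun_dlift:
  assumes X: "is_space Rp B X" and Y: "is_space Rp B Y" and f: "hom_fun X Y f"
  shows "hom_fun (DS X) (DS Y) (dlift f)"
  unfolding hom_fun_def
proof (intro conjI ballI)
  note cl = hom_fun_closed[OF f]
  show "dlift f p q \<in> Cr" if "p \<in> web (DS X)" "q \<in> web (DS Y)" for p q
    using that cl by auto
  have single: "has_psum (psum Rp) (\<lambda>j. \<nu> (dlift f (TPair i a) (TPair j b))) NN (\<nu> (f a b))"
    if "i \<in> NN" "a \<in> web X" "b \<in> web Y" for i a b
    using P.has_psum_single[of i NN "\<lambda>j. \<nu> (dlift f (TPair i a) (TPair j b))"] that cl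
    by (auto simp: kron_def)
  have comp: "lin (DS X) Y (\<lambda>p b. the_psum (psum Rp) (\<lambda>c. \<nu> (dproj (const_one R NN) p c) \<star> \<nu> (f c b)) (web X))"
    using lin_comp(2)[OF is_space_DS[OF X] X Y] dproj_one[OF X] f by (simp add: hom_fun_def)
  have eq: "the_psum (psum Rp) (\<lambda>c. \<nu> (dproj (const_one R NN) (TPair i a) c) \<star> \<nu> (f c b)) (web X)
      = \<nu> (f a b)" if "i \<in> NN" "a \<in> web X" "b \<in> web Y" for i a b
    using P.the_psum_kron_left[of a "web X" "\<lambda>c. \<nu> (f c b)"] that cl space_countable[OF X]
    by (simp add: const_one_def)
  have lin: "lin (DS X) Y (\<lambda>p b. the_psum (psum Rp) (\<lambda>j. \<nu> (dlift f p (TPair j b))) NN)"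
    using comp by (rule lin_cong[THEN iffD1, rotated])
      (auto simp: eq P.the_psum_eq[OF single] simp del: dlift_apply dproj_apply)
  have "psummable (psum Rp) (\<lambda>j. \<nu> (dlift f p (TPair j b))) NN"
    if "p \<in> web (DS X)" "b \<in> web Y" for p b
    using that by (auto simp del: dlift_apply intro: P.psummableI[OF single])
  then show "lin (DS X) (DS Y) (\<lambda>p q. \<nu> (dlift f p q))"
    using lin cl by (intro lin_DS_iff[THEN iffD2] conjI ballI is_space_DS X Y) auto
qed

text \<open>After \<open>ev\<close>, the matrix has the entry \<open>f a b\<close> at
  \<open>((i, a), j)\<close> if \<open>i = j\<close> and zero otherwise; \<open>cur\<close> only
  regroups the indices.\<close>

lemma ihom_mor_mat:
  assumes X: "is_space Rp B X" and f: "\<And>a b. a \<in> web X \<Longrightarrow> b \<in> web Y \<Longrightarrow> f a b \<in> Cr"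
  shows "ihom_mor W D X Y (MAT X Y f) = MAT (DS X) (DS Y) (dlift f)"
proof -
  have "comp W (tensor Rp B (DS X) D) X Y (MAT X Y f) (ev W D X) =
      mat (wprod (wprod NN (web X)) NN) (web Y)
        (\<lambda>p b. case p of TPair (TPair i a) j \<Rightarrow> kron R i j \<odot> f a b | _ \<Rightarrow> undefined)"
  proof -
    have ev: "ev W D X = MAT (tensor Rp B (DS X) D) X (\<lambda>p b'. case p of
        TPair (TPair a b) a' \<Rightarrow> kron R a a' \<odot> kron R b b' | _ \<Rightarrow> undefined)"
      by (simp add: Web_def)
    have "rsum (\<lambda>c. kron R i j \<odot> kron R a c \<odot> f c b) (web X) = kron R i j \<odot> f a b"
      if "a \<in> web X" "b \<in> web Y" for i j a b
      using R.the_psum_single[of a "web X" "\<lambda>c. kron R i j \<odot> kron R a c \<odot> f c b"] that f space_countable[OF X]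
      by (simp add: kron_def)
    then show ?thesis
      unfolding ev comp_mat by (auto simp: intro!: mat_cong)
  qed
  then show ?thesis
    by (auto simp: ihom_mor_def Let_def Web_def intro!: mat_wprod_both_cong)
qed

lemma is_endofunctor_DS: "is_endofunctor W DS (ihom_mor W D)"
  unfolding is_endofunctor_def
proof (intro conjI ballI)
  fix X assume "X \<in> obj W"
  then have X: "is_space Rp B X" by simp
  show "DS X \<in> obj W"
    using is_space_DS[OF X] by simp
  have "MAT (DS X) (DS X) (dlift (kron R)) = MAT (DS X) (DS X) (kron R)"
    by (auto simp: kron_def intro!: mat_wprod_both_cong)
  then show "ihom_mor W D X X (idm W X) = idm W (DS X)"
    using ihom_mor_mat[OF X, of X "kron R"] by simp
next
  fix X Y f assume "X \<in> obj W" "Y \<in> obj W" and f: "f \<in> hom W X Y"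
  then have sp: "is_space Rp B X" "is_space Rp B Y" by simp_all
  obtain f' where f': "f = MAT X Y f'" "hom_fun X Y f'"
    using f HomE sp by (metis Web_simps(2))
  have "ihom_mor W D X Y f = MAT (DS X) (DS Y) (dlift f')"
    unfolding f'(1) by (rule ihom_mor_mat[OF sp(1) hom_fun_closed[OF f'(2)]])
  then show "ihom_mor W D X Y f \<in> hom W (DS X) (DS Y)"
    using hom_fun_dlift[OF sp f'(2)] by (simp only: mat_in_Hom[OF is_space_DS[OF sp(1)]] Web_simps)
next
  fix X Y Z f g assume "X \<in> obj W" "Y \<in> obj W" "Z \<in> obj W" and fg: "f \<in> hom W X Y" "g \<in> hom W Y Z"
  then have sp: "is_space Rp B X" "is_space Rp B Y" "is_space Rp B Z" by simp_all
  obtain f' where f': "f = MAT X Y f'" "hom_fun X Y f'"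
    using fg(1) HomE sp by (metis Web_simps(2))
  obtain g' where g': "g = MAT Y Z g'" "hom_fun Y Z g'"
    using fg(2) HomE sp by (metis Web_simps(2))
  note cl = hom_fun_closed[OF f'(2)] hom_fun_closed[OF g'(2)]
  note sum = hom_fun_comp(1)[OF sp f'(2) g'(2)]
  have "rsum (\<lambda>q. dlift f' (TPair i a) q \<odot> dlift g' q (TPair k c)) (wprod NN (web Y)) =
      kron R i k \<odot> rsum (\<lambda>b. f' a b \<odot> g' b c) (web Y)"
    if i: "i \<in> NN" "k \<in> NN" and ac: "a \<in> web X" "c \<in> web Z" for i k a c
  proof -
    \<comment> \<open>The delta of the first factor leaves only the tokens
      \<open>TPair i b\<close>.\<close>
    have "rsum (\<lambda>q. dlift f' (TPair i a) q \<odot> dlift g' q (TPair k c)) (wprod NN (web Y)) =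
        rsum (\<lambda>b. dlift f' (TPair i a) (TPair i b) \<odot> dlift g' (TPair i b) (TPair k c)) (web Y)"
      using i ac cl space_countable[OF sp(2)]
      by (intro R.the_psum_reindex_support) (auto simp: inj_on_def kron_def)
    also have "\<dots> = rsum (\<lambda>b. kron R i k \<odot> (f' a b \<odot> g' b c)) (web Y)"
      using ac cl by (intro R.the_psum_cong) (auto simp: kron_def)
    also have "\<dots> = kron R i k \<odot> rsum (\<lambda>b. f' a b \<odot> g' b c) (web Y)"
      using sum[OF ac] by (simp add: R.the_psum_scale)
    finally show ?thesis .
  qed
  then show "ihom_mor W D X Z (comp W X Y Z g f) =
      comp W (DS X) (DS Y) (DS Z) (ihom_mor W D Y Z g) (ihom_mor W D X Y f)"
    unfolding f'(1) g'(1) comp_mat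
    by (simp add: ihom_mor_mat sp cl comp_mat sum R.the_psum_closed)
      (auto simp: comp_mat[of "DS X" "DS Y" "DS Z", simplified] intro!: mat_wprod_both_cong)
qed

section \<open>The right unitor and evaluation at a point of \<open>D\<close>\<close>

definition rinv :: "('a, 'p) space \<Rightarrow> 'a tok \<Rightarrow> 'r" where
  "rinv Z = mat (web Z) (wprod (web Z) {TStar})
    (\<lambda>p q. case q of TPair p' _ \<Rightarrow> kron R p p' | _ \<Rightarrow> undefined)"

text \<open>The delta reduces the test against \<open>w\<close> to the tokens
  \<open>TPair p TStar\<close>, where it is the condition on \<open>w\<close> for the elementary
  tensor of \<open>x\<close> with the basis vector of the unit space.\<close>

lemma rinv_in_Hom:
  assumes Z: "is_space Rp B Z"
  shows "rinv Z \<in> Hom Z (tensor Rp B Z (unit_space Rp B))"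
proof -
  let ?T = "tensor Rp B Z (unit_space Rp B)"
  let ?f = "\<lambda>p q. case q of TPair p' _ \<Rightarrow> kron R p p' | _ \<Rightarrow> undefined"
  let ?e = "std_basis Rp {TStar} TStar"
  have "lin Z ?T (\<lambda>p q. \<nu> (?f p q))"
    unfolding lin_def
  proof (intro conjI ballI)
    fix x w assume x: "x \<in> pts Z" and w: "w \<in> Q ?T"
    have wC: "w (TPair p TStar) \<in> Cp" if "p \<in> web Z" for p
      using Q_closed[OF w] that by simp
    have "{?e} \<subseteq> {TStar} \<rightarrow>\<^sub>E Cp"
      by (auto simp: std_basis_def)
    then have "?e \<in> pts (unit_space Rp B)"
      using subset_biorth[of "{?e}"] by (simp add: unit_space_def)
    with w x have bs: "bsum (\<lambda>(a, b). x a \<star> ?e b \<star> w (TPair a b)) (web Z \<times> {TStar})"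
      using mem_orth_tensor[OF space_pts_subset[OF Z] space_pts_subset[OF is_space_unit]]
      by auto
    have "bij_betw (\<lambda>p. (p, TStar)) (web Z) (web Z \<times> {TStar})"
      by (auto simp: bij_betw_def inj_on_def)
    from bsum_bijI[OF this bs] have "bsum (\<lambda>p. x p \<star> w (TPair p TStar) \<star> \<one>\<^bsub>Rp\<^esub>) (web Z)"
      by (rule bsum_cong[THEN iffD1, rotated])
        (simp add: std_basis_def kron_def pts_closed[OF Z x] wC)
    moreover have "bsum (\<lambda>(p, q). x p \<star> w q \<star> \<nu> (?f p q)) (web Z \<times> wprod (web Z) {TStar}) \<longleftrightarrow>
      bsum (\<lambda>p. (\<lambda>(p, q). x p \<star> w q \<star> \<nu> (?f p q)) (p, TPair p TStar)) (web Z)"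
      using space_countable[OF Z] pts_closed[OF Z x] wC
      by (intro bsum_reindex_support) (auto simp: inj_on_def kron_def image_iff)
    ultimately show "bsum (\<lambda>(p, q). x p \<star> w q \<star> \<nu> (?f p q)) (web Z \<times> web ?T)"
      by (simp add: kron_def)
  qed auto
  then have "hom_fun Z ?T ?f"
    by (auto simp: hom_fun_def)
  then show ?thesis
    using mat_in_Hom[OF Z, of ?T ?f] by (simp add: rinv_def)
qed

text \<open>\<open>inverse_mor\<close> is a definite description, so uniqueness counts as well:
  composing with \<open>runit\<close> only renames rows, hence \<open>g\<close> after
  \<open>runit\<close> being the identity fixes every entry of \<open>g\<close>.\<close>

lemma inverse_runit:
  assumes Z: "is_space Rp B Z"
  shows "inverse_mor W (tensor Rp B Z (unit_space Rp B)) Z (runit W Z) = rinv Z"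
proof -
  let ?T = "tensor Rp B Z (unit_space Rp B)"
  have runit: "runit W Z = MAT ?T Z (\<lambda>p b. case p of TPair a _ \<Rightarrow> kron R a b | _ \<Rightarrow> undefined)"
    by (simp add: Web_def)
  have rinv: "rinv Z = MAT Z ?T (\<lambda>p q. case q of TPair p' _ \<Rightarrow> kron R p p' | _ \<Rightarrow> undefined)"
    by (simp add: rinv_def)
  have comp_runit: "comp W ?T Z ?T (MAT Z ?T g) (runit W Z) =
      MAT ?T ?T (\<lambda>p q. case p of TPair a _ \<Rightarrow> g a q | _ \<Rightarrow> undefined)"
    if "\<And>a q. a \<in> web Z \<Longrightarrow> q \<in> web ?T \<Longrightarrow> g a q \<in> Cr" for g
    unfolding runit comp_mat using that space_countable[OF Z]
    by (auto simp: R.the_psum_kron_left intro!: mat_cong)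
  show ?thesis
    unfolding inverse_mor_def
  proof (rule the_equality, intro conjI)
    show "rinv Z \<in> hom W Z ?T"
      using rinv_in_Hom[OF Z] by simp
    show "comp W ?T Z ?T (rinv Z) (runit W Z) = idm W ?T"
      unfolding rinv by (subst comp_runit) (auto simp: kron_def intro!: mat_cong)
    have "rsum (\<lambda>q. (case q of TPair p' _ \<Rightarrow> kron R p p' | _ \<Rightarrow> undefined) \<odot>
        (case q of TPair a _ \<Rightarrow> kron R a b | _ \<Rightarrow> undefined)) (wprod (web Z) {TStar}) = kron R p b"
      if "p \<in> web Z" for p b
      using that space_countable[OF Z]
      by (subst R.the_psum_single[where a = "TPair p TStar"]) (auto simp: kron_def split: if_splits)
    then show "comp W Z ?T Z (runit W Z) (rinv Z) = idm W Z"
      unfolding rinv runit comp_mat by (auto intro!: mat_cong)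
  next
    fix g assume g: "g \<in> hom W Z ?T \<and> comp W ?T Z ?T g (runit W Z) = idm W ?T \<and>
      comp W Z ?T Z (runit W Z) g = idm W Z"
    obtain g' where g': "g = MAT Z ?T g'" "hom_fun Z ?T g'"
      using g HomE[OF Z] by (metis Web_simps(2))
    have "MAT ?T ?T (\<lambda>p q. case p of TPair a _ \<Rightarrow> g' a q | _ \<Rightarrow> undefined) = MAT ?T ?T (kron R)"
      using g comp_runit[of g'] hom_fun_closed[OF g'(2)] by (simp add: g'(1))
    then have *: "\<forall>p\<in>web ?T. \<forall>q\<in>web ?T. (case p of TPair a _ \<Rightarrow> g' a q | _ \<Rightarrow> undefined) = kron R p q"
      by (simp only: mat_eq_iff)
    have "g' a (TPair c TStar) = kron R (TPair a TStar) (TPair c TStar)"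
      if "a \<in> web Z" "c \<in> web Z" for a c
      using *[rule_format, of "TPair a TStar" "TPair c TStar"] that by simp
    then show "g = rinv Z"
      unfolding g'(1) rinv by (auto simp: kron_def intro!: mat_cong)
  qed
qed

lemma tenm_point:
  "tenm W Z (unit_space Rp B) Z D (idm W Z) (point NN h) =
    mat (wprod (web Z) {TStar}) (wprod (web Z) NN) (\<lambda>p q. case p of TPair a _ \<Rightarrow>
      (case q of TPair b j \<Rightarrow> kron R a b \<odot> h j | _ \<Rightarrow> undefined) | _ \<Rightarrow> undefined)"
  by (auto simp: Web_def point_def intro!: mat_cong)

text \<open>\<open>rinv\<close> attaches the token \<open>TStar\<close>, the tensor replaces it by
  an index \<open>j\<close> with weight \<open>h j\<close>, and \<open>ev\<close> keeps the terms
  with \<open>j = i\<close>. Each composition collapses to a single term.\<close>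

lemma eval_at_point:
  assumes X: "is_space Rp B X" and hPi: "h \<in> NN \<rightarrow> Cr"
  shows "eval_at W D (point NN h) X = MAT (DS X) X (dproj h)"
proof -
  have h: "h i \<in> Cr" if "i \<in> NN" for i
    using hPi that by blast
  let ?T = "tensor Rp B (DS X) (unit_space Rp B)" and ?TD = "tensor Rp B (DS X) D"
  let ?f = "\<lambda>p q. case p of TPair a _ \<Rightarrow>
      (case q of TPair b j \<Rightarrow> kron R a b \<odot> h j | _ \<Rightarrow> undefined) | _ \<Rightarrow> undefined"
  let ?g = "\<lambda>p b'. case p of TPair (TPair a b) a' \<Rightarrow> kron R a a' \<odot> kron R b b' | _ \<Rightarrow> undefined"
  let ?k = "\<lambda>p b. case p of TPair p' _ \<Rightarrow> dproj h p' b | _ \<Rightarrow> undefined"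
  have ctbl: "countable (web X)"
    using space_countable[OF X] .
  have "ev W D X = MAT ?TD X ?g"
    by (simp add: Web_def)
  moreover have "tenm W (DS X) (unit_space Rp B) (DS X) D (idm W (DS X)) (point NN h) = MAT ?T ?TD ?f"
    by (subst tenm_point) simp
  moreover have "comp W ?T ?TD X (MAT ?TD X ?g) (MAT ?T ?TD ?f) = MAT ?T X ?k"
    unfolding comp_mat
  proof (rule mat_cong)
    fix p b assume p: "p \<in> web ?T" and b: "b \<in> web X"
    obtain i a where ia: "p = TPair (TPair i a) TStar" "i \<in> NN" "a \<in> web X"
      using p by auto
    have "rsum (\<lambda>q. ?f p q \<odot> ?g q b) (web ?TD) =
        ?f p (TPair (TPair i a) i) \<odot> ?g (TPair (TPair i a) i) b"
      using ia h ctbl by (intro R.the_psum_single) (auto simp: kron_def split: if_splits)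
    then show "rsum (\<lambda>q. ?f p q \<odot> ?g q b) (web ?TD) = ?k p b"
      using ia h by (simp add: kron_def)
  qed
  moreover have "comp W (DS X) ?T X (MAT ?T X ?k) (rinv (DS X)) = MAT (DS X) X (dproj h)"
  proof -
    let ?r = "\<lambda>p q. case q of TPair p' _ \<Rightarrow> kron R p p' | _ \<Rightarrow> undefined"
    have rinv: "rinv (DS X) = MAT (DS X) ?T ?r"
      by (simp add: rinv_def)
    show ?thesis
      unfolding rinv comp_mat
    proof (rule mat_cong)
      fix p b assume p: "p \<in> web (DS X)" and b: "b \<in> web X"
      have k: "?k q b \<in> Cr" if "q \<in> web ?T" for q
        using that h by auto
      have "rsum (\<lambda>q. ?r p q \<odot> ?k q b) (web ?T) = ?r p (TPair p TStar) \<odot> ?k (TPair p TStar) b"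
        using p k h ctbl by (intro R.the_psum_single) (auto simp: kron_def split: if_splits)
      then show "rsum (\<lambda>q. ?r p q \<odot> ?k q b) (web ?T) = dproj h p b"
        using p h by (auto simp: kron_def)
    qed
  qed
  ultimately show ?thesis
    by (simp only: eval_at_def Let_def Web_simps inverse_runit[OF is_space_DS[OF X]])
qed

text \<open>Both composites have the product of \<open>h i\<close> and \<open>f a b\<close> as entry
  in row \<open>TPair i a\<close> and column \<open>b\<close>.\<close>

lemma is_natural_eval_at:
  fixes h :: "'a tok \<Rightarrow> 'r"
  assumes h: "h \<in> NN \<rightarrow> Cr" "(\<lambda>i\<in>NN. \<nu> (h i)) \<in> pts D"
  shows "is_natural_to_id W DS (ihom_mor W D) (eval_at W D (point NN h))"
  unfolding is_natural_to_id_def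
proof (intro conjI ballI)
  fix X :: "('a, 'p) space" assume "X \<in> obj W"
  then have X: "is_space Rp B X" by simp
  show "eval_at W D (point NN h) X \<in> hom W (DS X) X"
    unfolding eval_at_point[OF X h(1)] Web_simps mat_in_Hom[OF is_space_DS[OF X]]
    using h by (intro hom_fun_dproj[OF X]) auto
next
  fix X Y :: "('a, 'p) space" and f assume "X \<in> obj W" "Y \<in> obj W" and f: "f \<in> hom W X Y"
  then have sp: "is_space Rp B X" "is_space Rp B Y" by simp_all
  obtain f' where f': "f = MAT X Y f'" "hom_fun X Y f'"
    using f HomE sp by (metis Web_simps(2))
  note cl = hom_fun_closed[OF f'(2)] Pi_mem[OF h(1)]
  have 1: "rsum (\<lambda>c. dproj h (TPair i a) c \<odot> f' c b) (web X) = h i \<odot> f' a b"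
    if "i \<in> NN" "a \<in> web X" "b \<in> web Y" for i a b
    using R.the_psum_single[of a "web X" "\<lambda>c. dproj h (TPair i a) c \<odot> f' c b"] that cl
      space_countable[OF sp(1)] by (simp add: kron_def)
  have 2: "rsum (\<lambda>q. dlift f' (TPair i a) q \<odot> dproj h q b) (wprod NN (web Y)) = h i \<odot> f' a b"
    if "i \<in> NN" "a \<in> web X" "b \<in> web Y" for i a b
  proof -
    have "rsum (\<lambda>q. dlift f' (TPair i a) q \<odot> dproj h q b) (wprod NN (web Y)) =
        dlift f' (TPair i a) (TPair i b) \<odot> dproj h (TPair i b) b"
      using that cl space_countable[OF sp(2)]
      by (intro R.the_psum_single) (auto simp: kron_def split: if_splits)
    then show ?thesis
      using that cl by (simp add: kron_def R.m_comm)
  qed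
  have ih: "ihom_mor W D X Y (MAT X Y f') = MAT (DS X) (DS Y) (dlift f')"
    by (rule ihom_mor_mat[OF sp(1) hom_fun_closed[OF f'(2)]])
  show "comp W (DS X) X Y f (eval_at W D (point NN h) X) =
      comp W (DS X) (DS Y) Y (eval_at W D (point NN h) Y) (ihom_mor W D X Y f)"
    unfolding eval_at_point[OF sp(1) h(1)] eval_at_point[OF sp(2) h(1)] f'(1) ih comp_mat
    using 1 2 by (auto intro!: mat_cong)
qed

lemma zero_morphisms_Web: "zero_morphisms W (Web_zero R :: ('a, 'p) space \<Rightarrow> _)"
  unfolding zero_morphisms_def
proof (intro conjI ballI)
  fix X Y :: "('a, 'p) space" assume "X \<in> obj W" "Y \<in> obj W"
  then show "Web_zero R X Y \<in> hom W X Y"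
    by (simp add: Web_zero_def mat_in_Hom hom_fun_zero)
next
  fix X Y Z :: "('a, 'p) space" and f assume "X \<in> obj W" "Y \<in> obj W" "Z \<in> obj W" and f: "f \<in> hom W X Y"
  then have sp: "is_space Rp B X" "is_space Rp B Y" by simp_all
  obtain f' where f': "f = MAT X Y f'" "hom_fun X Y f'"
    using f HomE sp by (metis Web_simps(2))
  show "comp W X Y Z (Web_zero R Y Z) f = Web_zero R X Z"
    unfolding f'(1) Web_zero_def comp_mat using hom_fun_closed[OF f'(2)] space_countable[OF sp(2)]
    by (intro mat_cong R.the_psum_zero) auto
next
  fix X Y Z :: "('a, 'p) space" and g assume "X \<in> obj W" "Y \<in> obj W" "Z \<in> obj W" and g: "g \<in> hom W Y Z"
  then have sp: "is_space Rp B Y" by simp_all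
  obtain g' where g': "g = MAT Y Z g'" "hom_fun Y Z g'"
    using g HomE sp by (metis Web_simps(2))
  show "comp W X Y Z g (Web_zero R X Y) = Web_zero R X Z"
    unfolding g'(1) Web_zero_def comp_mat using hom_fun_closed[OF g'(2)] space_countable[OF sp]
    by (intro mat_cong R.the_psum_zero) auto
qed

section \<open>Projections, the total sum and the summation object\<close>

abbreviation "proj i \<equiv> eval_at W D (Web_inj R i)"
abbreviation "tot \<equiv> eval_at W D (Web_diag R)"

text \<open>For each \<open>i\<close>, the delta in \<open>dproj\<close> selects the token
  \<open>TPair i b\<close>, so the sum over \<open>wprod NN (web Y)\<close> becomes one over
  \<open>NN\<close>.\<close>

lemma comp_dproj:
  assumes Y: "is_space Rp B Y" and g: "g \<in> Hom X (DS Y)" and hPi: "h \<in> NN \<rightarrow> Cr"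
  shows "comp W X (DS Y) Y (MAT (DS Y) Y (dproj h)) g =
    MAT X Y (\<lambda>a b. rsum (\<lambda>i. g (TPair a (TPair i b)) \<odot> h i) NN)"
proof -
  have h: "h i \<in> Cr" if "i \<in> NN" for i
    using hPi that by blast
  have cl: "g (TPair a (TPair i b)) \<in> Cr" if "a \<in> web X" "i \<in> NN" "b \<in> web Y" for a i b
    using g PiE_mem[of g "web (limp Rp B X (DS Y))" "\<lambda>_. Cr"] that by (simp add: Mpts_def)
  have "comp W X (DS Y) Y (MAT (DS Y) Y (dproj h)) (MAT X (DS Y) (\<lambda>a c. g (TPair a c))) =
      MAT X Y (\<lambda>a b. rsum (\<lambda>i. g (TPair a (TPair i b)) \<odot> h i) NN)"
    unfolding comp_mat
  proof (rule mat_cong)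
    fix a b assume a: "a \<in> web X" and b: "b \<in> web Y"
    have "rsum (\<lambda>q. g (TPair a q) \<odot> dproj h q b) (web (DS Y)) =
        rsum (\<lambda>i. g (TPair a (TPair i b)) \<odot> dproj h (TPair i b) b) NN"
      using a b cl h space_countable[OF Y]
      by (intro R.the_psum_reindex_support) (auto simp: inj_on_def kron_def image_iff)
    then show "rsum (\<lambda>q. g (TPair a q) \<odot> dproj h q b) (web (DS Y)) =
        rsum (\<lambda>i. g (TPair a (TPair i b)) \<odot> h i) NN"
      using h by (auto simp: kron_def cong: R.the_psum_cong)
  qed
  then show ?thesis
    using Hom_eta[OF g] by simp
qed

lemma comp_proj:
  assumes Y: "is_space Rp B Y" and g: "g \<in> Hom X (DS Y)"
  shows "comp W X (DS Y) Y (proj n Y) g = MAT X Y (\<lambda>a b. g (TPair a (TPair (TNum n) b)))"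
proof -
  have cl: "g (TPair a (TPair i b)) \<in> Cr" if "a \<in> web X" "i \<in> NN" "b \<in> web Y" for a i b
    using g PiE_mem[of g "web (limp Rp B X (DS Y))" "\<lambda>_. Cr"] that by (simp add: Mpts_def)
  have h: "std_basis R NN (TNum n) \<in> NN \<rightarrow> Cr"
    by (auto simp: std_basis_def)
  have "rsum (\<lambda>i. g (TPair a (TPair i b)) \<odot> std_basis R NN (TNum n) i) NN =
      g (TPair a (TPair (TNum n) b))" if "a \<in> web X" "b \<in> web Y" for a b
    using that cl R.the_psum_single[of "TNum n" NN "\<lambda>i. g (TPair a (TPair i b)) \<odot> std_basis R NN (TNum n) i"]
    by (auto simp: std_basis_def kron_def)
  then show ?thesis
    unfolding Web_inj_def eval_at_point[OF Y h] comp_dproj[OF Y g h] by (simp add: mat_eq_iff)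
qed

lemma comp_total:
  assumes Y: "is_space Rp B Y" and g: "g \<in> Hom X (DS Y)"
  shows "comp W X (DS Y) Y (tot Y) g = MAT X Y (\<lambda>a b. rsum (\<lambda>i. g (TPair a (TPair i b))) NN)"
proof -
  have cl: "g (TPair a (TPair i b)) \<in> Cr" if "a \<in> web X" "i \<in> NN" "b \<in> web Y" for a i b
    using g PiE_mem[of g "web (limp Rp B X (DS Y))" "\<lambda>_. Cr"] that by (simp add: Mpts_def)
  have h: "const_one R NN \<in> NN \<rightarrow> Cr"
    by (simp add: const_one_def)
  have "rsum (\<lambda>i. g (TPair a (TPair i b)) \<odot> const_one R NN i) NN =
      rsum (\<lambda>i. g (TPair a (TPair i b))) NN" if "a \<in> web X" "b \<in> web Y" for a b
    using that cl by (intro R.the_psum_cong) (simp add: const_one_def)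
  then show ?thesis
    unfolding Web_diag_def eval_at_point[OF Y h] comp_dproj[OF Y g h] by (simp add: mat_eq_iff)
qed

lemma abs_std_basis: "(\<lambda>i\<in>NN. \<nu> (std_basis R NN (TNum n) i)) \<in> pts D"
proof -
  have "(\<lambda>i\<in>NN. \<nu> (std_basis R NN (TNum n) i)) = std_basis Rp NN (TNum n)"
    by (auto simp: std_basis_def)
  then show ?thesis
    using std_basis_in_nat by metis
qed

lemma is_natural_proj: "is_natural_to_id W DS (ihom_mor W D) (proj n)"
  unfolding Web_inj_def by (rule is_natural_eval_at[OF _ abs_std_basis]) (auto simp: std_basis_def)

lemma is_natural_total: "is_natural_to_id W DS (ihom_mor W D) tot"
  unfolding Web_diag_def by (rule is_natural_eval_at[OF _ abs_const_one]) (auto simp: const_one_def)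

text \<open>Projection \<open>i\<close> reads off the entries whose \<open>NN\<close> index is
  \<open>TNum i\<close>, and every token of \<open>NN\<close> has this form.\<close>

lemma jointly_monic:
  assumes Y: "is_space Rp B Y" and f: "f \<in> Hom X (DS Y)" and g: "g \<in> Hom X (DS Y)"
    and eq: "\<And>i. comp W X (DS Y) Y (proj i Y) f = comp W X (DS Y) Y (proj i Y) g"
  shows "f = g"
proof -
  have "f (TPair a (TPair (TNum i) b)) = g (TPair a (TPair (TNum i) b))"
    if "a \<in> web X" "b \<in> web Y" for a i b
    using eq[of i] that unfolding comp_proj[OF Y f] comp_proj[OF Y g] by (simp add: mat_eq_iff)
  then have "MAT X (DS Y) (\<lambda>a c. f (TPair a c)) = MAT X (DS Y) (\<lambda>a c. g (TPair a c))"
    by (intro mat_cong) auto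
  then show ?thesis
    using Hom_eta[OF f] Hom_eta[OF g] by simp
qed

lemma point_in_Hom:
  assumes "h \<in> NN \<rightarrow> Cr" "(\<lambda>i\<in>NN. \<nu> (h i)) \<in> pts D"
  shows "point NN h \<in> Hom (unit_space Rp B) D"
proof -
  have "lin (unit_space Rp B) D (\<lambda>_ i. \<nu> (h i))"
    using lin_unit_point[OF is_space_nat assms(2)] by (rule lin_cong[THEN iffD1, rotated]) auto
  then have "hom_fun (unit_space Rp B) D (\<lambda>_. h)"
    using assms(1) by (auto simp: hom_fun_def)
  then show ?thesis
    using mat_in_Hom[OF is_space_unit, of D "\<lambda>_. h"] by (simp add: point_def)
qed

lemma summation_object_nat: "summation_object W (D :: ('a, 'p) space) (Web_inj R) (Web_diag R)"
  unfolding summation_object_def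
proof (intro conjI allI ballI impI)
  show "unt W \<in> obj W" "D \<in> obj W"
    using is_space_unit is_space_nat by simp_all
  show "Web_inj R i \<in> hom W (unt W) D" for i
    unfolding Web_inj_def Web_simps by (rule point_in_Hom[OF _ abs_std_basis]) (auto simp: std_basis_def)
  show "Web_diag R \<in> hom W (unt W) D"
    unfolding Web_diag_def Web_simps by (rule point_in_Hom[OF _ abs_const_one]) (auto simp: const_one_def)
next
  fix X :: "('a, 'p) space" and f g assume "X \<in> obj W" and fg: "f \<in> hom W D X" "g \<in> hom W D X"
    and eq: "\<forall>i. comp W (unt W) D X f (Web_inj R i) = comp W (unt W) D X g (Web_inj R i)"
  \<comment> \<open>Composing with the injection \<open>i\<close> reads off row \<open>i\<close> of
    \<open>t\<close>, so \<open>f\<close> and \<open>g\<close> agree row by row.\<close>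
  have *: "comp W (unt W) D X t (Web_inj R i) = MAT (unit_space Rp B) X (\<lambda>_ a. t (TPair (TNum i) a))"
    if "t \<in> hom W D X" for t i
  proof -
    have "t \<in> Hom D X"
      using that by simp
    with is_space_nat obtain t' where t': "t = MAT D X t'" "hom_fun D X t'"
      by (rule HomE)
    have eq: "rsum (\<lambda>j. std_basis R NN (TNum i) j \<odot> t' j a) NN = t' (TNum i) a" if "a \<in> web X" for a
      using R.the_psum_single[of "TNum i" NN "\<lambda>j. std_basis R NN (TNum i) j \<odot> t' j a"]
        hom_fun_closed[OF t'(2)] that by (auto simp: std_basis_def kron_def)
    have inj: "Web_inj R i = MAT (unit_space Rp B) D (\<lambda>_. std_basis R NN (TNum i))"
      by (simp add: Web_inj_def point_def)
    show ?thesis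
      unfolding t'(1) Web_simps inj comp_mat by (rule mat_cong) (simp add: eq)
  qed
  have "f (TPair (TNum i) a) = g (TPair (TNum i) a)" if "a \<in> web X" for i a
    using eq[rule_format, of i] that unfolding *[OF fg(1)] *[OF fg(2)] by (simp add: mat_eq_iff)
  then have "MAT D X (\<lambda>j a. f (TPair j a)) = MAT D X (\<lambda>j a. g (TPair j a))"
    by (intro mat_cong) auto
  then show "f = g"
    using fg Hom_eta[of f D X] Hom_eta[of g D X] by simp
qed


section \<open>Sums of morphisms\<close>

text \<open>Relational form of \<open>Web_psum\<close> over any index type, so that pairs and lists
  can index families directly; \<open>has_psum_Web_psum\<close> is the bridge.\<close>

definition hom_has_sum ::
  "('a, 'p) space \<Rightarrow> ('a, 'p) space \<Rightarrow> ('i \<Rightarrow> 'a tok \<Rightarrow> 'r) \<Rightarrow> 'i set \<Rightarrow> ('a tok \<Rightarrow> 'r) \<Rightarrow> bool" where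
  "hom_has_sum X Y F A s \<longleftrightarrow> countable A \<and> (\<forall>k\<in>A. F k \<in> Hom X Y) \<and>
    (\<forall>a\<in>web X. \<forall>b\<in>web Y. psummable (psum Rp) (\<lambda>k. \<nu> (F k (TPair a b))) A) \<and>
    lin X Y (\<lambda>a b. the_psum (psum Rp) (\<lambda>k. \<nu> (F k (TPair a b))) A) \<and>
    s = MAT X Y (\<lambda>a b. rsum (\<lambda>k. F k (TPair a b)) A)"

lemma hom_has_sumD:
  assumes "hom_has_sum X Y F A s"
  shows "countable A" "\<And>k. k \<in> A \<Longrightarrow> F k \<in> Hom X Y"
    "\<And>a b. a \<in> web X \<Longrightarrow> b \<in> web Y \<Longrightarrow> psummable (psum Rp) (\<lambda>k. \<nu> (F k (TPair a b))) A"
    "lin X Y (\<lambda>a b. the_psum (psum Rp) (\<lambda>k. \<nu> (F k (TPair a b))) A)"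
    "s = MAT X Y (\<lambda>a b. rsum (\<lambda>k. F k (TPair a b)) A)"
  using assms by (simp_all add: hom_has_sum_def)

lemma Web_psum_iff:
  fixes A :: "nat set"
  assumes X: "is_space Rp B X"
  shows "Web_psum Rp B R \<nu> X Y A F = Some s \<longleftrightarrow> hom_has_sum X Y F A s"
proof -
  have R: "the (psum R A x) = rsum x A" if "\<exists>t. psum R A x = Some t" for x
    using that by (auto simp: R.has_psum_nat intro!: R.the_psum_eq[symmetric])
  have ex: "(\<exists>t\<in>pts (limp Rp B X Y). \<forall>c\<in>web (limp Rp B X Y). psum Rp A (\<lambda>k. \<nu> (F k c)) = Some (t c)) \<longleftrightarrow>
      (\<forall>a\<in>web X. \<forall>b\<in>web Y. psummable (psum Rp) (\<lambda>k. \<nu> (F k (TPair a b))) A) \<and>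
      lin X Y (\<lambda>a b. the_psum (psum Rp) (\<lambda>k. \<nu> (F k (TPair a b))) A)" (is "?L \<longleftrightarrow> ?S \<and> ?N")
  proof
    assume ?L
    then obtain t where t: "t \<in> pts (limp Rp B X Y)"
      "\<And>a b. a \<in> web X \<Longrightarrow> b \<in> web Y \<Longrightarrow> has_psum (psum Rp) (\<lambda>k. \<nu> (F k (TPair a b))) A (t (TPair a b))"
      by (auto simp: P.has_psum_nat)
    have "lin X Y (\<lambda>a b. t (TPair a b))"
      using t(1) mem_limp[OF space_pts_subset[OF X]] by blast
    then have ?N
      by (rule lin_cong[THEN iffD1, rotated]) (simp add: P.the_psum_eq[OF t(2)])
    then show "?S \<and> ?N"
      using t(2) P.psummableI by blast
  next
    assume SN: "?S \<and> ?N"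
    let ?t = "MAT X Y (\<lambda>a b. the_psum (psum Rp) (\<lambda>k. \<nu> (F k (TPair a b))) A)"
    have "lin X Y (\<lambda>a b. ?t (TPair a b))"
      using conjunct2[OF SN] by (rule lin_cong[THEN iffD1, rotated]) simp
    then have "?t \<in> pts (limp Rp B X Y)"
      using lin_closed[OF conjunct2[OF SN]] by (simp add: mem_limp[OF space_pts_subset[OF X]])
    moreover have "psum Rp A (\<lambda>k. \<nu> (F k c)) = Some (?t c)" if "c \<in> web (limp Rp B X Y)" for c
      using that SN by (auto simp: P.has_psum_nat[symmetric] intro!: P.has_psum_the_psum)
    ultimately show ?L
      by blast
  qed
  have sum: "(\<lambda>c\<in>web (limp Rp B X Y). the (psum R A (\<lambda>k. F k c))) =
      MAT X Y (\<lambda>a b. rsum (\<lambda>k. F k (TPair a b)) A)"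
    if S: ?S and F: "\<forall>k\<in>A. F k \<in> Hom X Y"
  proof (rule extensional_wprod_eqI[where V = "web X" and W = "web Y"])
    fix a b assume ab: "a \<in> web X" "b \<in> web Y"
    have "F k (TPair a b) \<in> Cr" if "k \<in> A" for k
      using F that PiE_mem[of "F k" "web (limp Rp B X Y)" "\<lambda>_. Cr" "TPair a b"] ab
      by (simp add: Mpts_def)
    then have "\<exists>t. psum R A (\<lambda>k. F k (TPair a b)) = Some t"
      using abs_psummable[of A "\<lambda>k. F k (TPair a b)"] S ab
      by (auto simp: psummable_def R.has_psum_nat)
    then show "(\<lambda>c\<in>web (limp Rp B X Y). the (psum R A (\<lambda>k. F k c))) (TPair a b) =
        MAT X Y (\<lambda>a b. rsum (\<lambda>k. F k (TPair a b)) A) (TPair a b)"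
      using ab R by simp
  qed simp_all
  show ?thesis
    unfolding Web_psum_def ex hom_has_sum_def Pi_iff using sum by auto
qed

text \<open>The PCM laws for \<open>Web_psum\<close> rest on \<open>hom_has_sum\<close> and come
  later, so the enumeration of \<open>A\<close> is moved through the entries, where the laws of
  \<open>Rp\<close> and \<open>R\<close> apply.\<close>

lemma has_psum_Web_psum:
  assumes X: "is_space Rp B X"
  shows "has_psum (Web_psum Rp B R \<nu> X Y) F A s \<longleftrightarrow> hom_has_sum X Y F A s"
proof (cases "countable A")
  case True
  let ?A = "to_nat_on A ` A" and ?F = "\<lambda>n. F (from_nat_into A n)"
  have "has_psum (psum Rp) (\<lambda>k. \<nu> (F k c)) A = has_psum (psum Rp) (\<lambda>n. \<nu> (?F n c)) ?A" for c
    using True by (intro ext) (simp add: P.has_psum_nat, simp add: has_psum_def)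
  moreover have "has_psum (psum R) (\<lambda>k. F k c) A = has_psum (psum R) (\<lambda>n. ?F n c) ?A" for c
    using True by (intro ext) (simp add: R.has_psum_nat, simp add: has_psum_def)
  ultimately have "hom_has_sum X Y ?F ?A s \<longleftrightarrow> hom_has_sum X Y F A s"
    using True by (simp add: hom_has_sum_def psummable_def the_psum_def)
  then show ?thesis
    using True Web_psum_iff[OF X] by (simp add: has_psum_def)
qed (simp add: has_psum_def hom_has_sum_def)

lemma Hom_closed:
  "t \<in> Hom X Y \<Longrightarrow> a \<in> web X \<Longrightarrow> b \<in> web Y \<Longrightarrow> t (TPair a b) \<in> Cr"
  using PiE_mem[of t "web (limp Rp B X Y)" "\<lambda>_. Cr" "TPair a b"] by (simp add: Mpts_def)

lemma Hom_lin:
  assumes "is_space Rp B X" "t \<in> Hom X Y"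
  shows "lin X Y (\<lambda>a b. \<nu> (t (TPair a b)))"
  using assms mat_in_Hom[OF assms(1), of Y "\<lambda>a b. t (TPair a b)"] Hom_eta[OF assms(2)]
  by (simp add: hom_fun_def)

lemma hom_has_sum_psummable:
  assumes "hom_has_sum X Y F A s" "a \<in> web X" "b \<in> web Y"
  shows "psummable (psum R) (\<lambda>k. F k (TPair a b)) A"
  using hom_has_sumD(2,3)[OF assms(1)] assms(2,3)
  by (subst abs_psummable) (auto intro: Hom_closed)

lemma hom_has_sum_entry_le:
  assumes "hom_has_sum X Y F A s" "a \<in> web X" "b \<in> web Y"
  shows "lle (\<nu> (rsum (\<lambda>k. F k (TPair a b)) A)) (the_psum (psum Rp) (\<lambda>k. \<nu> (F k (TPair a b))) A)"
  using abs_sum_le[OF R.has_psum_the_psum[OF hom_has_sum_psummable[OF assms]]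
      P.has_psum_the_psum[OF hom_has_sumD(3)[OF assms]]] .

text \<open>Absoluteness bounds each entry of \<open>s\<close> by the sum of absolute values, and
  the matrix of these sums is linear by assumption.\<close>

lemma hom_has_sum_closed:
  assumes X: "is_space Rp B X" and s: "hom_has_sum X Y F A s"
  shows "s \<in> Hom X Y"
proof -
  have cl: "rsum (\<lambda>k. F k (TPair a b)) A \<in> Cr" if "a \<in> web X" "b \<in> web Y" for a b
    using hom_has_sum_psummable[OF s that] by (rule R.the_psum_closed)
  have "lin X Y (\<lambda>a b. \<nu> (rsum (\<lambda>k. F k (TPair a b)) A))"
    using hom_has_sum_entry_le[OF s] cl by (intro lin_mono[OF hom_has_sumD(4)[OF s] X]) auto
  then show ?thesis
    using cl unfolding hom_has_sumD(5)[OF s] mat_in_Hom[OF X] by (simp add: hom_fun_def)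
qed

text \<open>The total of absolute values dominates everything: each block as a subsum, and the
  family of block sums because the absolute value of \<open>y i\<close> is at most the block total
  \<open>u i\<close>, and these add up to the total. The value is WPA in \<open>R\<close>, entry by
  entry.\<close>

lemma hom_has_sum_partition:
  assumes X: "is_space Rp B X" and s: "hom_has_sum X Y F A s" and I: "countable I"
    and P: "disjoint_family_on P I" "(\<Union>i\<in>I. P i) = A"
  defines "y \<equiv> \<lambda>i. MAT X Y (\<lambda>a b. rsum (\<lambda>k. F k (TPair a b)) (P i))"
  shows "i \<in> I \<Longrightarrow> hom_has_sum X Y F (P i) (y i)" and "hom_has_sum X Y y I s"
proof -
  have PA: "P i \<subseteq> A" if "i \<in> I" for i
    using P(2) that by blast
  have part: "hom_has_sum X Y F (P i) (y i)" if i: "i \<in> I" for i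
    unfolding hom_has_sum_def
  proof (intro conjI ballI)
    show "countable (P i)"
      using hom_has_sumD(1)[OF s] PA[OF i] countable_subset by blast
    show "F k \<in> Hom X Y" if "k \<in> P i" for k
      using hom_has_sumD(2)[OF s] PA[OF i] that by blast
    show sum: "psummable (psum Rp) (\<lambda>k. \<nu> (F k (TPair a b))) (P i)" if "a \<in> web X" "b \<in> web Y" for a b
      using hom_has_sumD(3)[OF s that] PA[OF i] by (rule P.psummable_subset)
    show "lin X Y (\<lambda>a b. the_psum (psum Rp) (\<lambda>k. \<nu> (F k (TPair a b))) (P i))"
    proof (rule lin_mono[OF hom_has_sumD(4)[OF s] X], intro conjI)
      fix a b assume ab: "a \<in> web X" "b \<in> web Y"
      show "the_psum (psum Rp) (\<lambda>k. \<nu> (F k (TPair a b))) (P i) \<in> Cp"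
        using sum[OF ab] by (rule P.the_psum_closed)
      show "lle (the_psum (psum Rp) (\<lambda>k. \<nu> (F k (TPair a b))) (P i))
          (the_psum (psum Rp) (\<lambda>k. \<nu> (F k (TPair a b))) A)"
        using P.has_psum_the_psum[OF hom_has_sumD(3)[OF s ab]] PA[OF i] P.has_psum_the_psum[OF sum[OF ab]]
        by (rule P.pleI)
    qed
  qed (simp add: y_def)
  then show "i \<in> I \<Longrightarrow> hom_has_sum X Y F (P i) (y i)" .
  have le: "\<exists>t. has_psum (psum Rp) (\<lambda>i. \<nu> (y i (TPair a b))) I t \<and>
      lle t (the_psum (psum Rp) (\<lambda>k. \<nu> (F k (TPair a b))) A)"
    if ab: "a \<in> web X" "b \<in> web Y" for a b
  proof -
    obtain u where u: "\<forall>i\<in>I. has_psum (psum Rp) (\<lambda>k. \<nu> (F k (TPair a b))) (P i) (u i)"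
      "has_psum (psum Rp) u I (the_psum (psum Rp) (\<lambda>k. \<nu> (F k (TPair a b))) A)"
      using P.has_psum_partition[OF P.has_psum_the_psum[OF hom_has_sumD(3)[OF s ab]] I P] by auto
    have "lle (\<nu> (y i (TPair a b))) (u i)" if "i \<in> I" for i
      using hom_has_sum_entry_le[OF part[OF that] ab] P.the_psum_eq[OF u(1)[rule_format, OF that]] ab
      by (simp add: y_def)
    then show ?thesis
      using u(2) by (rule P.has_psum_mono)
  qed
  show "hom_has_sum X Y y I s"
    unfolding hom_has_sum_def
  proof (intro conjI ballI)
    show "y i \<in> Hom X Y" if "i \<in> I" for i
      by (rule hom_has_sum_closed[OF X part[OF that]])
    show "psummable (psum Rp) (\<lambda>i. \<nu> (y i (TPair a b))) I" if "a \<in> web X" "b \<in> web Y" for a b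
      using le[OF that] by (auto intro: P.psummableI)
    show "lin X Y (\<lambda>a b. the_psum (psum Rp) (\<lambda>i. \<nu> (y i (TPair a b))) I)"
    proof (rule lin_mono[OF hom_has_sumD(4)[OF s] X])
      fix a b assume "a \<in> web X" "b \<in> web Y"
      then obtain t where t: "has_psum (psum Rp) (\<lambda>i. \<nu> (y i (TPair a b))) I t"
        "lle t (the_psum (psum Rp) (\<lambda>k. \<nu> (F k (TPair a b))) A)"
        using le by blast
      then show "the_psum (psum Rp) (\<lambda>i. \<nu> (y i (TPair a b))) I \<in> Cp \<and>
          lle (the_psum (psum Rp) (\<lambda>i. \<nu> (y i (TPair a b))) I)
            (the_psum (psum Rp) (\<lambda>k. \<nu> (F k (TPair a b))) A)"
        using P.has_psum_closed[OF t(1)] by (simp add: P.the_psum_eq[OF t(1)])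
    qed
    show "s = MAT X Y (\<lambda>a b. rsum (\<lambda>i. y i (TPair a b)) I)"
      unfolding hom_has_sumD(5)[OF s]
    proof (rule mat_cong)
      fix a b assume ab: "a \<in> web X" "b \<in> web Y"
      obtain u where u: "\<forall>i\<in>I. has_psum (psum R) (\<lambda>k. F k (TPair a b)) (P i) (u i)"
        "has_psum (psum R) u I (rsum (\<lambda>k. F k (TPair a b)) A)"
        using R.has_psum_partition[OF R.has_psum_the_psum[OF hom_has_sum_psummable[OF s ab]] I P] by auto
      have "y i (TPair a b) = u i" if "i \<in> I" for i
        using R.the_psum_eq[OF u(1)[rule_format, OF that]] ab by (simp add: y_def)
      then have "rsum (\<lambda>i. y i (TPair a b)) I = rsum u I"
        by (rule R.the_psum_cong)
      then show "rsum (\<lambda>k. F k (TPair a b)) A = rsum (\<lambda>i. y i (TPair a b)) I"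
        using R.the_psum_eq[OF u(2)] by simp
    qed
  qed (rule I)
qed

lemma hom_has_sum_singleton:
  assumes X: "is_space Rp B X" and F: "F k \<in> Hom X Y"
  shows "hom_has_sum X Y F {k} (F k)"
proof -
  have P1: "has_psum (psum Rp) (\<lambda>k. \<nu> (F k (TPair a b))) {k} (\<nu> (F k (TPair a b)))"
    and R1: "has_psum (psum R) (\<lambda>k. F k (TPair a b)) {k} (F k (TPair a b))"
    if "a \<in> web X" "b \<in> web Y" for a b
    using Hom_closed[OF F that]
    by (auto intro: P.has_psum_singleton[of "\<lambda>k. \<nu> (F k (TPair a b))"]
        R.has_psum_singleton[of "\<lambda>k. F k (TPair a b)"])
  have "lin X Y (\<lambda>a b. the_psum (psum Rp) (\<lambda>k. \<nu> (F k (TPair a b))) {k})"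
    using Hom_lin[OF X F] by (rule lin_cong[THEN iffD1, rotated]) (simp add: P.the_psum_eq[OF P1])
  moreover have "F k = MAT X Y (\<lambda>a b. rsum (\<lambda>k. F k (TPair a b)) {k})"
    by (subst Hom_eta[OF F, symmetric]) (rule mat_cong, simp add: R.the_psum_eq[OF R1])
  ultimately show ?thesis
    using F P.psummableI[OF P1] by (simp add: hom_has_sum_def)
qed

lemma pcm_Web_psum:
  fixes X Y :: "('a, 'p) space"
  assumes X: "is_space Rp B X" and Y: "is_space Rp B Y"
  shows "pcm (Hom X Y) (Web_psum Rp B R \<nu> X Y)"
proof
  show "Hom X Y \<noteq> {}"
    using mat_in_Hom[OF X] hom_fun_zero[OF X Y] by blast
next
  fix A F s assume "Web_psum Rp B R \<nu> X Y A F = Some s"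
  then have s: "hom_has_sum X Y F A s"
    by (simp add: Web_psum_iff[OF X])
  then show "F \<in> A \<rightarrow> Hom X Y \<and> s \<in> Hom X Y"
    using hom_has_sum_closed[OF X s] hom_has_sumD(2)[OF s] by auto
next
  fix A and F G :: "nat \<Rightarrow> 'a tok \<Rightarrow> 'r" assume eq: "\<And>a. a \<in> A \<Longrightarrow> F a = G a"
  have "psum Rp A (\<lambda>k. \<nu> (F k c)) = psum Rp A (\<lambda>k. \<nu> (G k c))"
    "psum R A (\<lambda>k. F k c) = psum R A (\<lambda>k. G k c)" for c
    by (auto intro!: P.cong R.cong simp: eq)
  moreover have "F \<in> A \<rightarrow> Hom X Y \<longleftrightarrow> G \<in> A \<rightarrow> Hom X Y"
    by (simp add: Pi_iff eq)
  ultimately show "Web_psum Rp B R \<nu> X Y A F = Web_psum Rp B R \<nu> X Y A G"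
    by (simp only: Web_psum_def)
next
  fix F and k :: nat assume "F k \<in> Hom X Y"
  then show "Web_psum Rp B R \<nu> X Y {k} F = Some (F k)"
    unfolding Web_psum_iff[OF X] by (rule hom_has_sum_singleton[OF X])
next
  fix A F s I P assume "Web_psum Rp B R \<nu> X Y A F = Some s" and P: "partition_of A I P"
  then have s: "hom_has_sum X Y F A s" and P': "disjoint_family_on P I" "(\<Union>i\<in>I. P i) = A"
    by (simp_all add: Web_psum_iff[OF X] partition_of_def)
  show "\<exists>y. (\<forall>i\<in>I. Web_psum Rp B R \<nu> X Y (P i) F = Some (y i)) \<and> Web_psum Rp B R \<nu> X Y I y = Some s"
    unfolding Web_psum_iff[OF X]
    by (intro exI[of _ "\<lambda>i. MAT X Y (\<lambda>a b. rsum (\<lambda>k. F k (TPair a b)) (P i))"] conjI ballI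
        hom_has_sum_partition[OF X s _ P']) simp_all
qed

lemma pzero_Web_psum:
  assumes X: "is_space Rp B X" and Y: "is_space Rp B Y"
  shows "pzero (Web_psum Rp B R \<nu> X Y) = Web_zero R X Y"
proof -
  have "hom_has_sum X Y (\<lambda>_. undefined) ({} :: nat set) (Web_zero R X Y)"
    using lin_zero[OF X Y]
    by (simp add: hom_has_sum_def Web_zero_def P.psummableI[OF P.has_psum_empty]
        P.the_psum_eq[OF P.has_psum_empty] R.the_psum_eq[OF R.has_psum_empty])
  then show ?thesis
    by (simp add: pzero_def Web_psum_iff[OF X, symmetric])
qed

section \<open>Families indexed by tuples\<close>

lemma proj_in_Hom:
  fixes X Y :: "('a, 'p) space"
  assumes X: "is_space Rp B X" and Y: "is_space Rp B Y" and g: "g \<in> Hom X (DS Y)"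
  shows "comp W X (DS Y) Y (proj n Y) g \<in> Hom X Y"
proof -
  have "is_category (W :: (('a, 'p) space, _) closed_cat)"
    "is_natural_to_id W DS (ihom_mor W D) (proj n :: ('a, 'p) space \<Rightarrow> _)"
    by (rule is_category_Web, rule is_natural_proj)
  then show ?thesis
    using X Y is_space_DS[OF Y] g unfolding is_category_def is_natural_to_id_def by simp
qed

text \<open>\<open>lin_DS_iff\<close> for the matrix of totals over \<open>k\<close> makes these
  summable over \<open>i\<close> too, and PA joins both sums into one over pairs. Absoluteness gives
  the joint sum in \<open>R\<close>; split along \<open>i\<close>, it is the sum over
  \<open>i\<close> of the slices of \<open>g\<close>, which is what \<open>tot\<close>
  computes.\<close>

lemma hom_has_sum_slices:
  assumes X: "is_space Rp B X" and Y: "is_space Rp B Y" and g: "hom_has_sum X (DS Y) G A g"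
  shows "hom_has_sum X Y (\<lambda>(i, k). MAT X Y (\<lambda>a b. G k (TPair a (TPair i b)))) (NN \<times> A)
    (comp W X (DS Y) Y (tot Y) g)"
proof -
  let ?F = "\<lambda>(i, k). MAT X Y (\<lambda>a b. G k (TPair a (TPair i b)))"
  note gD = hom_has_sumD[OF g]
  have g_in: "g \<in> Hom X (DS Y)"
    by (rule hom_has_sum_closed[OF X g])
  have clG: "G k (TPair a (TPair i b)) \<in> Cr" if "k \<in> A" "a \<in> web X" "i \<in> NN" "b \<in> web Y" for k a i b
    using Hom_closed[OF gD(2)[OF that(1)] that(2), of "TPair i b"] that by simp
  have sumG: "psummable (psum Rp) (\<lambda>k. \<nu> (G k (TPair a (TPair i b)))) A"
    if "a \<in> web X" "i \<in> NN" "b \<in> web Y" for a i b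
    using gD(3)[OF that(1), of "TPair i b"] that by simp
  have DS: "\<forall>a\<in>web X. \<forall>b\<in>web Y. psummable (psum Rp)
      (\<lambda>i. the_psum (psum Rp) (\<lambda>k. \<nu> (G k (TPair a (TPair i b)))) A) NN"
    "lin X Y (\<lambda>a b. the_psum (psum Rp)
      (\<lambda>i. the_psum (psum Rp) (\<lambda>k. \<nu> (G k (TPair a (TPair i b)))) A) NN)"
    using gD(4) P.the_psum_closed[OF sumG] by (subst (asm) lin_DS_iff[OF X Y]; blast)+
  have tot: "has_psum (psum Rp) (\<lambda>p. \<nu> (?F p (TPair a b))) (NN \<times> A)
      (the_psum (psum Rp) (\<lambda>i. the_psum (psum Rp) (\<lambda>k. \<nu> (G k (TPair a (TPair i b)))) A) NN)"
    if ab: "a \<in> web X" "b \<in> web Y" for a b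
  proof -
    have "has_psum (psum Rp) (\<lambda>(i, k). \<nu> (G k (TPair a (TPair i b)))) (NN \<times> A)
        (the_psum (psum Rp) (\<lambda>i. the_psum (psum Rp) (\<lambda>k. \<nu> (G k (TPair a (TPair i b)))) A) NN)"
      using sumG ab P.has_psum_the_psum[OF DS(1)[rule_format, OF ab]]
      by (simp add: P.has_psum_Times_iff)
    then show ?thesis
      by (rule P.has_psum_cong[THEN iffD1, rotated]) (use ab in auto)
  qed
  show ?thesis
    unfolding hom_has_sum_def
  proof (intro conjI ballI)
    show "countable (NN \<times> A)"
      using gD(1) by simp
    show "?F p \<in> Hom X Y" if pA: "p \<in> NN \<times> A" for p
    proof -
      obtain n k where p: "p = (TNum n, k)" "k \<in> A"
        using pA by auto
      show ?thesis
        using proj_in_Hom[OF X Y gD(2)[OF p(2)], of n] comp_proj[OF Y gD(2)[OF p(2)], of n]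
        by (simp add: p(1))
    qed
    show "psummable (psum Rp) (\<lambda>p. \<nu> (?F p (TPair a b))) (NN \<times> A)" if "a \<in> web X" "b \<in> web Y" for a b
      using tot[OF that] by (rule P.psummableI)
    show "lin X Y (\<lambda>a b. the_psum (psum Rp) (\<lambda>p. \<nu> (?F p (TPair a b))) (NN \<times> A))"
      using DS(2) by (rule lin_cong[THEN iffD1, rotated]) (simp only: P.the_psum_eq[OF tot])
    show "comp W X (DS Y) Y (tot Y) g = MAT X Y (\<lambda>a b. rsum (\<lambda>p. ?F p (TPair a b)) (NN \<times> A))"
      unfolding comp_total[OF Y g_in]
    proof (rule mat_cong)
      fix a b assume ab: "a \<in> web X" "b \<in> web Y"
      have "psummable (psum R) (\<lambda>p. ?F p (TPair a b)) (NN \<times> A)"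
        using P.psummableI[OF tot[OF ab]] clG ab by (subst abs_psummable) auto
      then have "has_psum (psum R) (\<lambda>p. ?F p (TPair a b)) (NN \<times> A)
          (rsum (\<lambda>p. ?F p (TPair a b)) (NN \<times> A))"
        by (rule R.has_psum_the_psum)
      from R.has_psum_TimesD(2)[OF this]
      have "rsum (\<lambda>i. rsum (\<lambda>k. ?F (i, k) (TPair a b)) A) NN = rsum (\<lambda>p. ?F p (TPair a b)) (NN \<times> A)"
        by (simp add: R.the_psum_eq)
      moreover have "rsum (\<lambda>i. rsum (\<lambda>k. ?F (i, k) (TPair a b)) A) NN =
          rsum (\<lambda>i. g (TPair a (TPair i b))) NN"
        using ab unfolding gD(5) by (intro R.the_psum_cong) simp
      ultimately show "rsum (\<lambda>i. g (TPair a (TPair i b))) NN = rsum (\<lambda>p. ?F p (TPair a b)) (NN \<times> A)"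
        by simp
    qed
  qed
qed

text \<open>The way back from \<open>hom_has_sum_slices\<close>: \<open>G k\<close> collects
  \<open>F (i, k)\<close> over all \<open>i\<close>. Its sums over \<open>i\<close> are subsums of
  the joint total, so \<open>G k\<close> is a morphism; the sums over \<open>k\<close> add up over
  \<open>i\<close> to the joint total, so \<open>G\<close> is summable by
  \<open>lin_DS_iff\<close>.\<close>

lemma hom_has_sum_tuple:
  fixes X Y :: "('a, 'p) space" and F :: "'a tok \<times> 'i \<Rightarrow> 'a tok \<Rightarrow> 'r"
  assumes X: "is_space Rp B X" and Y: "is_space Rp B Y" and s: "hom_has_sum X Y F (NN \<times> A) s"
    and A: "countable A"
  obtains G g where "hom_has_sum X (DS Y) G A g"
    "\<And>n k. k \<in> A \<Longrightarrow> comp W X (DS Y) Y (proj n Y) (G k) = F (TNum n, k)"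
proof -
  define G where "G = (\<lambda>k. MAT X (DS Y) (\<lambda>a c. case c of TPair i b \<Rightarrow> F (i, k) (TPair a b) | _ \<Rightarrow> undefined))"
  note sD = hom_has_sumD[OF s]
  have G: "G k (TPair a (TPair i b)) = F (i, k) (TPair a b)"
    if "a \<in> web X" "i \<in> NN" "b \<in> web Y" for k a i b
    using that by (simp add: G_def)
  have clF: "F (i, k) (TPair a b) \<in> Cr" if "i \<in> NN" "k \<in> A" "a \<in> web X" "b \<in> web Y" for k a i b
    using Hom_closed[OF sD(2) that(3,4)] that by simp
  have tot: "has_psum (psum Rp) (\<lambda>p. \<nu> (F p (TPair a b))) (NN \<times> A)
      (the_psum (psum Rp) (\<lambda>p. \<nu> (F p (TPair a b))) (NN \<times> A))"
    if "a \<in> web X" "b \<in> web Y" for a b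
    using sD(3)[OF that] by (rule P.has_psum_the_psum)
  have sums: "\<forall>i\<in>NN. psummable (psum Rp) (\<lambda>k. \<nu> (F (i, k) (TPair a b))) A"
    "has_psum (psum Rp) (\<lambda>i. the_psum (psum Rp) (\<lambda>k. \<nu> (F (i, k) (TPair a b))) A) NN
      (the_psum (psum Rp) (\<lambda>p. \<nu> (F p (TPair a b))) (NN \<times> A))"
    if "a \<in> web X" "b \<in> web Y" for a b
    using P.has_psum_TimesD[OF tot[OF that]] by simp_all
  have col: "psummable (psum Rp) (\<lambda>i. \<nu> (F (i, k) (TPair a b))) NN"
    "lle (the_psum (psum Rp) (\<lambda>i. \<nu> (F (i, k) (TPair a b))) NN)
      (the_psum (psum Rp) (\<lambda>p. \<nu> (F p (TPair a b))) (NN \<times> A))"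
    if k: "k \<in> A" and ab: "a \<in> web X" "b \<in> web Y" for k a b
  proof -
    have sub: "(\<lambda>i. (i, k)) ` NN \<subseteq> NN \<times> A" and inj: "inj_on (\<lambda>i. (i, k)) NN"
      using k by (auto simp: inj_on_def)
    have "psummable (psum Rp) (\<lambda>p. \<nu> (F p (TPair a b))) ((\<lambda>i. (i, k)) ` NN)"
      using sD(3)[OF ab] sub by (rule P.psummable_subset)
    then have "has_psum (psum Rp) (\<lambda>p. \<nu> (F p (TPair a b))) ((\<lambda>i. (i, k)) ` NN)
        (the_psum (psum Rp) (\<lambda>p. \<nu> (F p (TPair a b))) ((\<lambda>i. (i, k)) ` NN))"
      by (rule P.has_psum_the_psum)
    with P.pleI[OF tot[OF ab] sub this] show
      "psummable (psum Rp) (\<lambda>i. \<nu> (F (i, k) (TPair a b))) NN"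
      "lle (the_psum (psum Rp) (\<lambda>i. \<nu> (F (i, k) (TPair a b))) NN)
        (the_psum (psum Rp) (\<lambda>p. \<nu> (F p (TPair a b))) (NN \<times> A))"
      unfolding P.has_psum_reindex[OF inj] by (simp_all add: P.the_psum_eq P.psummableI)
  qed
  have G_in: "G k \<in> Hom X (DS Y)" if k: "k \<in> A" for k
  proof -
    have *: "lin X Y (\<lambda>a b. the_psum (psum Rp) (\<lambda>i. \<nu> (F (i, k) (TPair a b))) NN)"
      using col[OF k] P.the_psum_closed by (intro lin_mono[OF sD(4) X]) blast
    have eq: "the_psum (psum Rp) (\<lambda>i. \<nu> (G k (TPair a (TPair i b)))) NN =
        the_psum (psum Rp) (\<lambda>i. \<nu> (F (i, k) (TPair a b))) NN" if "a \<in> web X" "b \<in> web Y" for a b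
      using that by (intro P.the_psum_cong) (simp add: G)
    have "lin X (DS Y) (\<lambda>a c. \<nu> (G k (TPair a c)))"
    proof (rule lin_DS_iff[OF X Y, THEN iffD2], goal_cases)
      case (1 a i b)
      then show ?case
        using clF k by (simp add: G)
    next
      case 2
      have "psummable (psum Rp) (\<lambda>i. \<nu> (G k (TPair a (TPair i b)))) NN" if "a \<in> web X" "b \<in> web Y" for a b
        using col(1)[OF k that] by (rule P.psummable_cong[THEN iffD1, rotated]) (use that in \<open>simp add: G\<close>)
      moreover have "lin X Y (\<lambda>a b. the_psum (psum Rp) (\<lambda>i. \<nu> (G k (TPair a (TPair i b)))) NN)"
        using * by (rule lin_cong[THEN iffD1, rotated]) (simp only: eq)
      ultimately show ?case
        by blast
    qed
    moreover have "G k (TPair a c) \<in> Cr" if "a \<in> web X" "c \<in> web (DS Y)" for a c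
      using that clF k by (auto simp: G)
    ultimately have "hom_fun X (DS Y) (\<lambda>a c. G k (TPair a c))"
      by (simp add: hom_fun_def)
    then have "MAT X (DS Y) (\<lambda>a c. G k (TPair a c)) \<in> Hom X (DS Y)"
      by (simp only: mat_in_Hom[OF X])
    moreover have "MAT X (DS Y) (\<lambda>a c. G k (TPair a c)) = G k"
      by (rule extensional_wprod_eqI[where V = "web X" and W = "web (DS Y)"]) (simp_all add: G_def)
    ultimately show ?thesis
      by simp
  qed
  have sumG: "psummable (psum Rp) (\<lambda>k. \<nu> (G k (TPair a (TPair i b)))) A"
    "the_psum (psum Rp) (\<lambda>k. \<nu> (G k (TPair a (TPair i b)))) A =
      the_psum (psum Rp) (\<lambda>k. \<nu> (F (i, k) (TPair a b))) A"
    if "a \<in> web X" "i \<in> NN" "b \<in> web Y" for a i b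
    using sums(1)[OF that(1,3), rule_format, OF that(2)] that by (simp_all add: G)
  have sumG': "has_psum (psum Rp) (\<lambda>i. the_psum (psum Rp) (\<lambda>k. \<nu> (G k (TPair a (TPair i b)))) A) NN
      (the_psum (psum Rp) (\<lambda>p. \<nu> (F p (TPair a b))) (NN \<times> A))"
    if "a \<in> web X" "b \<in> web Y" for a b
    using sums(2)[OF that] by (rule P.has_psum_cong[THEN iffD1, rotated]) (use that in \<open>simp add: sumG(2)\<close>)
  have "lin X (DS Y) (\<lambda>a c. the_psum (psum Rp) (\<lambda>k. \<nu> (G k (TPair a c))) A)"
  proof (rule lin_DS_iff[OF X Y, THEN iffD2], goal_cases)
    case (1 a i b)
    then show ?case
      by (intro P.the_psum_closed sumG)
  next
    case 2
    have "lin X Y (\<lambda>a b. the_psum (psum Rp)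
        (\<lambda>i. the_psum (psum Rp) (\<lambda>k. \<nu> (G k (TPair a (TPair i b)))) A) NN)"
      using sD(4) by (rule lin_cong[THEN iffD1, rotated]) (simp only: P.the_psum_eq[OF sumG'])
    then show ?case
      using P.psummableI[OF sumG'] by blast
  qed
  then have "hom_has_sum X (DS Y) G A (MAT X (DS Y) (\<lambda>a c. rsum (\<lambda>k. G k (TPair a c)) A))"
    using A G_in sumG(1) by (auto simp: hom_has_sum_def)
  moreover have "comp W X (DS Y) Y (proj n Y) (G k) = F (TNum n, k)" if "k \<in> A" for n k
  proof -
    have "MAT X Y (\<lambda>a b. G k (TPair a (TPair (TNum n) b))) = MAT X Y (\<lambda>a b. F (TNum n, k) (TPair a b))"
      by (rule mat_cong) (simp add: G)
    then show ?thesis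
      unfolding comp_proj[OF Y G_in[OF that]] using Hom_eta[OF sD(2)] that by simp
  qed
  ultimately show thesis
    by (rule that)
qed

text \<open>The recursion of \<open>iter_proj\<close> passes from \<open>Y\<close> to
  \<open>DS Y\<close>, hence the induction with \<open>Y\<close> arbitrary and
  \<open>funpow_swap1\<close> to move one \<open>DS\<close> next to \<open>Y\<close>.\<close>

lemma iter_proj_in_Hom:
  assumes X: "is_space Rp B X"
  shows "is_space Rp B Y \<Longrightarrow> f \<in> Hom X ((DS ^^ length is) Y) \<Longrightarrow>
    iter_proj W DS proj X Y is f \<in> Hom X Y"
proof (induction "is" arbitrary: Y)
  case (Cons i "is")
  have "iter_proj W DS proj X (DS Y) is f \<in> Hom X (DS Y)"
    using Cons by (simp add: is_space_DS funpow_swap1)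
  then show ?case
    using proj_in_Hom[OF X Cons.prems(1)] by simp
qed simp

text \<open>The head of a list belongs to the outermost projection, the one at \<open>Y\<close>; the
  tail indexes a family of morphisms into \<open>DS Y\<close>.\<close>

lemma bij_betw_Cons:
  "bij_betw (\<lambda>l. (TNum (hd l), tl l)) {l :: nat list. length l = Suc n} (NN \<times> {l. length l = n})"
  \<comment> \<open>The default 0 is never reached, since every element of \<open>NN\<close> is some
    \<open>TNum m\<close>.\<close>
  by (rule bij_betw_byWitness[where f' = "\<lambda>(i, l). (case i of TNum m \<Rightarrow> m | _ \<Rightarrow> 0) # l"])
    (auto simp: length_Suc_conv)

lemma hom_has_sum_bij_betw:
  assumes X: "is_space Rp B X" and Y: "is_space Rp B Y" and h: "bij_betw h A A'"
  shows "hom_has_sum X Y F A' s \<longleftrightarrow> hom_has_sum X Y (\<lambda>k. F (h k)) A s"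
  using pcm.has_psum_bij_betw[OF pcm_Web_psum[OF X Y] h] by (simp add: has_psum_Web_psum[OF X])

lemma hom_has_sum_cong:
  assumes X: "is_space Rp B X" and Y: "is_space Rp B Y" and eq: "\<And>k. k \<in> A \<Longrightarrow> F k = G k"
  shows "hom_has_sum X Y F A s \<longleftrightarrow> hom_has_sum X Y G A s"
  using pcm.has_psum_cong[OF pcm_Web_psum[OF X Y] eq] by (simp add: has_psum_Web_psum[OF X])

text \<open>The induction hypothesis sums the family of tails in \<open>Hom X (DS Y)\<close>. By
  \<open>hom_has_sum_slices\<close>, applying \<open>tot\<close> at \<open>Y\<close> sums all slices
  over heads and tails, and \<open>comp_proj\<close> identifies the slices with the
  projections.\<close>

lemma iter_sum_correct:
  assumes X: "is_space Rp B X"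
  shows "is_space Rp B Y \<Longrightarrow> f \<in> Hom X ((DS ^^ n) Y) \<Longrightarrow>
    (\<And>is. length is = n \<Longrightarrow> iter_proj W DS proj X Y is f = F is) \<Longrightarrow>
    hom_has_sum X Y F {is. length is = n} (iter_sum W DS tot X Y n f)"
proof (induction n arbitrary: Y F)
  \<comment> \<open>The only list of length 0 is \<open>[]\<close>, so this is a one-term
    family.\<close>
  case 0
  then have "f = F []"
    by force
  then show ?case
    using hom_has_sum_singleton[OF X, of F "[]" Y] 0 by simp
next
  case (Suc n)
  note Y = Suc.prems(1)
  define G where "G = (\<lambda>is. iter_proj W DS proj X (DS Y) is f)"
  have f: "f \<in> Hom X ((DS ^^ n) (DS Y))"
    using Suc.prems(2) by (simp add: funpow_swap1)
  have G_in: "G is \<in> Hom X (DS Y)" if "length is = n" for "is"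
    using iter_proj_in_Hom[OF X is_space_DS[OF Y], of f "is"] f that by (simp add: G_def)
  have "hom_has_sum X (DS Y) G {is. length is = n} (iter_sum W DS tot X (DS Y) n f)"
    by (rule Suc.IH[OF is_space_DS[OF Y] f]) (simp add: G_def)
  from hom_has_sum_bij_betw[OF X Y bij_betw_Cons, THEN iffD1, OF hom_has_sum_slices[OF X Y this]]
  have sum: "hom_has_sum X Y (\<lambda>l. MAT X Y (\<lambda>a b. G (tl l) (TPair a (TPair (TNum (hd l)) b))))
      {is. length is = Suc n} (iter_sum W DS tot X Y (Suc n) f)"
    by simp
  have slice: "MAT X Y (\<lambda>a b. G (tl l) (TPair a (TPair (TNum (hd l)) b))) = F l"
    if l: "length l = Suc n" for l
  proof -
    have "MAT X Y (\<lambda>a b. G (tl l) (TPair a (TPair (TNum (hd l)) b))) =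
        comp W X (DS Y) Y (proj (hd l) Y) (G (tl l))"
      using comp_proj[OF Y G_in] l by simp
    also have "\<dots> = iter_proj W DS proj X Y (hd l # tl l) f"
      by (simp add: G_def)
    also have "\<dots> = F l"
      using Suc.prems(3)[OF l] l by (cases l) simp_all
    finally show ?thesis .
  qed
  show ?case
    using sum by (rule hom_has_sum_cong[OF X Y, THEN iffD1, rotated]) (simp add: slice)
qed

text \<open>\<open>hom_has_sum_tuple\<close> absorbs the heads into morphisms to
  \<open>DS Y\<close>, which leaves a summable family over the tails for the induction hypothesis.
  Family and sum change with each step, so \<open>F\<close> and \<open>s\<close> are arbitrary as
  well as \<open>Y\<close>.\<close>

lemma iter_proj_exists:
  fixes X Y :: "('a, 'p) space"
  assumes X: "is_space Rp B X"
  shows "is_space Rp B Y \<Longrightarrow> hom_has_sum X Y F {is. length is = n} s \<Longrightarrow>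
    \<exists>f\<in>Hom X ((DS ^^ n) Y). \<forall>is. length is = n \<longrightarrow> iter_proj W DS proj X Y is f = F is"
proof (induction n arbitrary: Y F s)
  case 0
  then show ?case
    using hom_has_sumD(2)[OF 0(2), of "[]"] by (intro bexI[of _ "F []"]) simp_all
next
  case (Suc n)
  note Y = Suc.prems(1)
  define F' where "F' = (\<lambda>(i :: 'a tok, l). F ((case i of TNum m \<Rightarrow> m | _ \<Rightarrow> 0) # l))"
  have "hom_has_sum X Y (\<lambda>l. F' (TNum (hd l), tl l)) {l. length l = Suc n} s"
    using Suc.prems(2)
    by (rule hom_has_sum_cong[OF X Y, THEN iffD1, rotated]) (auto simp: F'_def length_Suc_conv)
  then have "hom_has_sum X Y F' (NN \<times> {l. length l = n}) s"
    by (simp only: hom_has_sum_bij_betw[OF X Y bij_betw_Cons])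
  then obtain G g where G: "hom_has_sum X (DS Y) G {l. length l = n} g"
    "\<And>m l. l \<in> {l. length l = n} \<Longrightarrow> comp W X (DS Y) Y (proj m Y) (G l) = F' (TNum m, l)"
    by (rule hom_has_sum_tuple[OF X Y]) auto
  obtain f where f: "f \<in> Hom X ((DS ^^ n) (DS Y))"
    "\<forall>is. length is = n \<longrightarrow> iter_proj W DS proj X (DS Y) is f = G is"
    using Suc.IH[OF is_space_DS[OF Y] G(1)] by blast
  show ?case
  proof (intro bexI[of _ f] allI impI)
    fix l :: "nat list" assume l: "length l = Suc n"
    then obtain i m where im: "l = i # m" "length m = n"
      by (auto simp: length_Suc_conv)
    then show "iter_proj W DS proj X Y l f = F l"
      using f(2) G(2)[of m i] by (simp add: F'_def)
  next
    show "f \<in> Hom X ((DS ^^ Suc n) Y)"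
      using f(1) by (simp add: funpow_swap1)
  qed
qed

lemma summability_structure_Web:
  "summability_structure W DS (ihom_mor W D) proj tot (Web_zero R :: ('a, 'p) space \<Rightarrow> _)
    (Web_psum Rp B R \<nu>)"
  unfolding summability_structure_def
proof (intro conjI ballI allI impI)
  fix X Y :: "('a, 'p) space" and f g
  assume "X \<in> obj W" "Y \<in> obj W" and fg: "f \<in> hom W X (DS Y)" "g \<in> hom W X (DS Y)"
    "\<forall>i. comp W X (DS Y) Y (proj i Y) f = comp W X (DS Y) Y (proj i Y) g"
  then show "f = g"
    by (intro jointly_monic[of Y f X g]) simp_all
next
  fix X Y :: "('a, 'p) space" assume "X \<in> obj W" "Y \<in> obj W"
  then have sp: "is_space Rp B X" "is_space Rp B Y" by simp_all
  show "pcm (hom W X Y) (Web_psum Rp B R \<nu> X Y)"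
    using pcm_Web_psum[OF sp] by simp
  show "pzero (Web_psum Rp B R \<nu> X Y) = Web_zero R X Y"
    by (rule pzero_Web_psum[OF sp])
  fix n F
  show "has_psum (Web_psum Rp B R \<nu> X Y) F {is. length is = n} (iter_sum W DS tot X Y n f)"
    if "f \<in> hom W X ((DS ^^ n) Y)" "\<forall>is. length is = n \<longrightarrow> iter_proj W DS proj X Y is f = F is" for f
    unfolding has_psum_Web_psum[OF sp(1)]
    by (rule iter_sum_correct[OF sp]) (use that in simp_all)
  \<comment> \<open>The sum formula just shown gives one direction; \<open>iter_proj_exists\<close>
    constructs \<open>f\<close> for the other.\<close>
  then show "psummable (Web_psum Rp B R \<nu> X Y) F {is. length is = n} \<longleftrightarrow>
      (\<exists>f\<in>hom W X ((DS ^^ n) Y). \<forall>is. length is = n \<longrightarrow> iter_proj W DS proj X Y is f = F is)"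
    using iter_proj_exists[OF sp, of F n]
    unfolding psummable_def has_psum_Web_psum[OF sp(1)] by auto
qed (simp_all add: is_category_Web is_endofunctor_DS is_natural_proj is_natural_total zero_morphisms_Web)

theorem representable_by_Web:
  "representable_by W (Web_zero R) (Web_psum Rp B R \<nu>) (D :: ('a, 'p) space) (Web_inj R) (Web_diag R)"
  unfolding representable_by_def
  using summation_object_nat summability_structure_Web by simp

end

text \<open>For the identity, the bound of \<open>|\<Sigma>x|\<close> by \<open>\<Sigma>|x|\<close>
  is reflexivity of the order.\<close>

lemma absolute_pcr_id:
  assumes "strong_pcr Rp"
  shows "absolute_pcr Rp Rp id"
proof -
  interpret strong_pcr Rp
    by fact
  have "s \<in> carrier Rp" if "psum Rp A x = Some s" for A x s
    using closed[OF that] by blast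
  then show ?thesis
    using pcr_axioms by (auto simp: absolute_pcr_def intro: ple_refl)
qed

theorem theorem7p3:
  fixes Rp :: "'p pcr" and B :: "'p set" and R :: "'r pcr" and \<nu> :: "'r \<Rightarrow> 'p"
    and CR :: "(('a, 'p) space, 'a tok \<Rightarrow> 'r) closed_cat"
    and CP :: "(('a, 'p) space, 'a tok \<Rightarrow> 'p) closed_cat"
  assumes "strong_pcr Rp"
    and "downward_closed Rp B" and "B \<inter> Units Rp \<noteq> {}"
    and "absolute_pcr R Rp \<nu>"
  defines "CR \<equiv> Web Rp B R \<nu>" and "CP \<equiv> Web Rp B Rp id"
  shows
    "(representable CR (Web_zero R) (Web_psum Rp B R \<nu>) \<and>
      representable_by CR (Web_zero R) (Web_psum Rp B R \<nu>)
        (nat_space Rp B) (Web_inj R) (Web_diag R)) \<and>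
     (representable CP (Web_zero Rp) (Web_psum Rp B Rp id) \<and>
      representable_by CP (Web_zero Rp) (Web_psum Rp B Rp id)
        (nat_space Rp B) (Web_inj Rp) (Web_diag Rp))"
proof -
  have "abs_web Rp B R \<nu>" "abs_web Rp B Rp id"
    using assms absolute_pcr_id by (simp_all add: abs_web_def)
  from this[THEN abs_web.representable_by_Web] show ?thesis
    unfolding CR_def CP_def representable_def by blast
qed

end
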